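(* Let $n\in\{2,3\}$, $g,L>0$, $0<\rho_-<\rho_+$, $\Omega=\mathbb T^{n-1}\times(-L,L)$ with $|\mathbb T|=1$, $\lambda\in(0,1/2)$, and let $T>0$ be such that $\lambda\frac{\rho_+-\rho_-}{\rho_-}\frac{gT^2}2<L$. Let $z_\lambda=(\mu_\lambda,w_\lambda,m_\lambda,h_\lambda,\sigma_\lambda,e_\lambda)$ be the one-dimensional non-strict subsolution (described in the context) with $m_\lambda=gt(\mu_\lambda-\lambda a(\mu_\lambda))e_n$, $\mu_\lambda$ the unique entropy solution of $\partial_t\mu+\partial_{y_n}\big(gt(\mu-\lambda a(\mu))\big)=0$, $\mu(\cdot,0)=\rho_0$, and dissipation measure $\nu_\lambda=\lambda(2\lambda-1)g^2t\,a(\mu_\lambda)$, where $a(r)=\frac{(\rho_+-r)(r-\rho_-)}{\rho_++\rho_--r}$. Then there exists a constant $C=C(\lambda,g,\rho_-,\rho_+)>0$ such that for all $\delta>0$ sufficiently small depending on $\lambda,\rho_-,\rho_+,g$, there exists a strict subsolution $z_\lambda^\delta$ with $$\mu_\lambda^\delta=\mu_\lambda,\quad m_\lambda^\delta=m_\lambda,\quad e_\lambda^\delta=e_\lambda+\delta t^2(\rho_+-\mu_\lambda)^2(\mu_\lambda-\rho_-)^2,$$ and dissipation measure $\nu_\lambda^\delta\le0$ satisfying $$|\nu_\lambda^\delta-\nu_\lambda|\le C\delta t(\rho_+-\mu_\lambda)(\mu_\lambda-\rho_-).$$ The parameter $\varepsilon>0$ in the defining inequality (S) of a strict subsolution can be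 chosen to be $1$.
   Context: $\rho_0(x)=\rho_+$ for $x_n>0$ and $\rho_0(x)=\rho_-$ for $x_n<0$. Set $\mathscr D(t)=\Omega+\frac12gt^2e_n$, $\mathscr D=\{(y,t):t\in(0,T),\,y\in\mathscr D(t)\}$, $\overline{\mathscr D}^*=\bigcup_{t\in[0,T)}\overline{\mathscr D(t)}\times\{t\}$, $\partial_{rel}\mathscr D=\bigcup_{t\in(0,T)}\partial\mathscr D(t)\times\{t\}$, $\vec n$ the outer unit normal. $\mathcal S_0^{n\times n}$ is the space of symmetric traceless matrices, $Z=\mathbb R\times\mathbb R^n\times\mathbb R^n\times\mathbb R^n\times\mathcal S_0^{n\times n}\times\mathbb R\ni z=(\mu,w,m,h,\sigma,e)$, and $\lambda_{\max}$ is the largest eigenvalue. Linear system: $z\in L^\infty(\mathscr D;Z)$ with pressure $q\in L^\infty(\mathscr D)\cap L^1(\partial_{rel}\mathscr D)$ and dissipation measure $\nu\in(C_c^\infty(\overline{\mathscr D}^* ))^*$, $\nu[\varphi]\le0$ for $\varphi\ge0$, is a weak solution with initial data $(\rho_0,0,0)$ if for all $\Phi\in C_c^\infty(\overline{\mathscr D}^*;\mathbb R^n)$, $\Psi\in C_c^\infty(\overline{\mathscr D}^* )$: $\int_{\mathscr D}[m\cdot\partial_t\Phi+(\sigma+\frac2ne\,\mathrm{id}+q\,\mathrm{id}):\nabla\Phi]-\int_0^T\int_{\partial\mathscr D(t)}q\Phi\cdot\vec n=0$; $\int_{\mathscr D}(w-gte_n)\cdot\nabla\Psi=0$; $\int_{\mathscr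 D}[\mu\partial_t\Psi+m\cdot\nabla\Psi]+\int_\Omega\rho_0\Psi(\cdot,0)=0$; $\int_{\mathscr D}[e\partial_t\Psi+h\cdot\nabla\Psi]-\int_0^Tgt\int_{\partial\mathscr D(t)}q\Psi e_n\cdot\vec n=-\nu[\Psi]$. For $\mu\in(\rho_-,\rho_+)$ let $\tilde M(z)=\frac{\mu\rho_-\rho_+w\otimes w-\rho_-\rho_+(m\otimes w+w\otimes m)+(\rho_++\rho_--\mu)m\otimes m}{(\rho_+-\mu)(\mu-\rho_-)}-\sigma$ and $T_\pm(z)=\frac{\rho_\pm}2\frac{|m-\rho_\mp w|^2}{(\mu-\rho_\mp)^2}$. A strict subsolution is such a weak solution for which there are an open set $\mathscr U\subset\mathscr D$ (mixing zone) and $\varepsilon>0$ such that $z$ is continuous on $\mathscr U$, $q\in L^\infty(\mathscr U)\cap C^0(\mathscr U)$, $T_\pm(z)\in L^\infty(\mathscr U)$, on $\mathscr U$ there holds $\rho_-<\mu<\rho_+$ and (S) $\lambda_{\max}(\tilde M(z))+\varepsilon\big|h-(e+q)w-\frac{T_+(z)-T_-(z)}{\rho_+-\rho_-}(m-\mu w)\big|<\frac2ne$, and a.e. in $\mathscr D\setminus\mathscr U$: $m=\mu w$, $h=(e+q)w$, $\mu w\otimes w=\sigma+\frac2ne\,\mathrm{id}$, $\mu\in\{\rho_-,\rho_+\}$. A subsolution is one-dimensional if $z,q,\nu$ depend only on $(y_n,t)$, $w=gte_n$, $m_j=h_j=0$ for $j<n$, and $\sigma=\frac12\mathrm{diag}(-f,f)$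 if $n=2$, $\sigma=\frac13\mathrm{diag}(-f,-f,2f)$ if $n=3$, where $f=\frac{\mu\rho_-\rho_+g^2t^2-2\rho_-\rho_+m_ngt+(\rho_++\rho_--\mu)m_n^2}{(\rho_+-\mu)(\mu-\rho_-)}$ in $\mathscr U$ and $f=\mu g^2t^2$ where $\mu\in\{\rho_\pm\}$. A one-dimensional non-strict subsolution is defined as a one-dimensional strict one except that (S) is replaced by: $e=\frac12f$ and $h=(e+q)w+\frac{T_+(z)-T_-(z)}{\rho_+-\rho_-}(m-\mu w)$. In particular $z_\lambda$ has $w_\lambda=gte_n$, $\sigma_\lambda=\frac12\mathrm{diag}(-f,f)$ if $n=2$, $\sigma_\lambda=\frac13\mathrm{diag}(-f,-f,2f)$ if $n=3$, and $e_\lambda=\frac12f$, where $f=\frac{\mu_\lambda\rho_-\rho_+g^2t^2-2\rho_-\rho_+m_{\lambda,n}gt+(\rho_++\rho_--\mu_\lambda)m_{\lambda,n}^2}{(\rho_+-\mu_\lambda)(\mu_\lambda-\rho_-)}$ where $\rho_-<\mu_\lambda<\rho_+$, $f=\mu_\lambda g^2t^2$ where $\mu_\lambda\in\{\rho_-,\rho_+\}$, and $m_{\lambda,n}=gt(\mu_\lambda-\lambda a(\mu_\lambda))$ is the $n$-th component of $m_\lambda$; its existence (with a suitable pressure $q_\lambda$) and the formula for $\nu_\lambda$ are taken as known. *)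

theory Defs
  imports "HOL-Analysis.Analysis"
begin

text \<open>
  Space is real ^ 'n, and N :: 'n is the index of the vertical coordinate y_n. A function on the
  torus factor (period 1) is a function that is 1-periodic in every coordinate other than N.
  Points of space-time are pairs (y, t).
\<close>

section \<open>Smooth functions\<close>

definition pd :: "('a::real_normed_vector \<Rightarrow> 'b::real_normed_vector) \<Rightarrow> 'a \<Rightarrow> 'a \<Rightarrow> 'b" where
  "pd f v p = frechet_derivative f (at p) v"

primrec Ck :: "nat \<Rightarrow> ('a::euclidean_space \<Rightarrow> 'b::real_normed_vector) \<Rightarrow> bool" where
  "Ck 0 f \<longleftrightarrow> continuous_on UNIV f"
| "Ck (Suc k) f \<longleftrightarrow> f differentiable_on UNIV \<and> (\<forall>b\<in>Basis. Ck k (pd f b))"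

definition smooth :: "('a::euclidean_space \<Rightarrow> 'b::real_normed_vector) \<Rightarrow> bool" where
  "smooth f \<longleftrightarrow> (\<forall>k. Ck k f)"

primrec derivs_le :: "nat \<Rightarrow> real \<Rightarrow> 'a set \<Rightarrow> ('a::euclidean_space \<Rightarrow> real) \<Rightarrow> bool" where
  "derivs_le 0 M S f \<longleftrightarrow> (\<forall>p\<in>S. \<bar>f p\<bar> \<le> M)"
| "derivs_le (Suc k) M S f \<longleftrightarrow>
     (\<forall>p\<in>S. \<bar>f p\<bar> \<le> M) \<and> (\<forall>b\<in>Basis. derivs_le k M S (pd f b))"

definition Linfty ::
  "'a::euclidean_space set \<Rightarrow> ('a \<Rightarrow> 'b::real_normed_vector) \<Rightarrow> bool" where
  "Linfty S f \<longleftrightarrow> f \<in> borel_measurable (lebesgue_on S) \<and>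
     (\<exists>K. AE p in lebesgue_on S. norm (f p) \<le> K)"


section \<open>The accelerated domain\<close>

definition periodic :: "'n \<Rightarrow> ((real ^ 'n) \<times> real \<Rightarrow> 'b) \<Rightarrow> bool" where
  "periodic N f \<longleftrightarrow> (\<forall>i y t. i \<noteq> N \<longrightarrow> f (y + axis i 1, t) = f (y, t))"

definition Omega :: "'n \<Rightarrow> real \<Rightarrow> (real ^ 'n) set" where
  "Omega N L = {x. - L < x $ N \<and> x $ N < L}"

definition Dslice :: "'n::finite \<Rightarrow> real \<Rightarrow> real \<Rightarrow> real \<Rightarrow> (real ^ 'n) set" where
  "Dslice N g L t = (\<lambda>x. x + ((1/2) * g * t\<^sup>2) *\<^sub>R axis N 1) ` Omega N L"

definition Dom :: "'n::finite \<Rightarrow> real \<Rightarrow> real \<Rightarrow> real \<Rightarrow> ((real ^ 'n) \<times> real) set" where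
  "Dom N g L T = {(y, t). 0 < t \<and> t < T \<and> y \<in> Dslice N g L t}"

definition Dbar :: "'n::finite \<Rightarrow> real \<Rightarrow> real \<Rightarrow> real \<Rightarrow> ((real ^ 'n) \<times> real) set" where
  "Dbar N g L T = {(y, t). 0 \<le> t \<and> t < T \<and> y \<in> closure (Dslice N g L t)}"

text \<open>A fundamental domain of the torus directions; integrals over the domain and over Omega are
  taken over it. Almost-everywhere statements are made on the whole strip, which for periodic
  functions is the same as on the fundamental domain.\<close>

definition torus_cell :: "'n \<Rightarrow> (real ^ 'n) set" where
  "torus_cell N = {x. \<forall>i. i \<noteq> N \<longrightarrow> 0 \<le> x $ i \<and> x $ i < 1}"

definition int_Dom ::
  "'n::finite \<Rightarrow> real \<Rightarrow> real \<Rightarrow> real \<Rightarrow> ((real ^ 'n) \<times> real \<Rightarrow> real) \<Rightarrow> real" where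
  "int_Dom N g L T F = integral\<^sup>L (lebesgue_on (Dom N g L T \<inter> (torus_cell N \<times> UNIV))) F"

definition int_Omega :: "'n::finite \<Rightarrow> real \<Rightarrow> ((real ^ 'n) \<Rightarrow> real) \<Rightarrow> real" where
  "int_Omega N L F = integral\<^sup>L (lebesgue_on (Omega N L \<inter> torus_cell N)) F"

text \<open>The lateral boundary consists, for s = 1 and s = -1, of the hyperplanes
  y_n = s L + g t^2 / 2, with outer unit normal s e_n. The surface integral over each is
  an integral over the (n-1)-dimensional torus, written here as an integral over the unit cube of all
  n coordinates of a function that ignores the coordinate N (which contributes a factor 1).\<close>

definition bpt ::
  "'n \<Rightarrow> real \<Rightarrow> real \<Rightarrow> real \<Rightarrow> (real ^ 'n) \<times> real \<Rightarrow> (real ^ 'n) \<times> real" where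
  "bpt N g L s = (\<lambda>(x, t). ((\<chi> i. if i = N then s * L + (1/2) * g * t\<^sup>2 else x $ i), t))"

definition bdry_cell :: "real \<Rightarrow> ((real ^ 'n) \<times> real) set" where
  "bdry_cell T = {x. \<forall>i. 0 \<le> x $ i \<and> x $ i < 1} \<times> {0<..<T}"

text \<open>The integral over t in (0,T) and over the boundary of D(t) of F times the n-th component of
  the outer unit normal.\<close>

definition int_bdry_normal ::
  "'n::finite \<Rightarrow> real \<Rightarrow> real \<Rightarrow> real \<Rightarrow> ((real ^ 'n) \<times> real \<Rightarrow> real) \<Rightarrow> real" where
  "int_bdry_normal N g L T F =
     integral\<^sup>L (lebesgue_on (bdry_cell T)) (\<lambda>p. F (bpt N g L 1 p))
     - integral\<^sup>L (lebesgue_on (bdry_cell T)) (\<lambda>p. F (bpt N g L (-1) p))"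

text \<open>Compactly supported smooth functions on Dbar, as restrictions of smooth functions. The
  slices of Dbar are compact modulo the torus periods and are closed, so compact support only means
  vanishing for times close to T.\<close>

definition vanishes_from ::
  "'n::finite \<Rightarrow> real \<Rightarrow> real \<Rightarrow> real \<Rightarrow> real \<Rightarrow> ((real ^ 'n) \<times> real \<Rightarrow> 'b::real_normed_vector) \<Rightarrow> bool"
  where
  "vanishes_from N g L T T' \<phi> \<longleftrightarrow> (\<forall>p\<in>Dbar N g L T. T' \<le> snd p \<longrightarrow> \<phi> p = 0)"

definition testfun ::
  "'n::finite \<Rightarrow> real \<Rightarrow> real \<Rightarrow> real \<Rightarrow> ((real ^ 'n) \<times> real \<Rightarrow> 'b::real_normed_vector) \<Rightarrow> bool"
  where
  "testfun N g L T \<phi> \<longleftrightarrow>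
     smooth \<phi> \<and> periodic N \<phi> \<and> (\<exists>T'<T. vanishes_from N g L T T' \<phi>)"

text \<open>Nonpositive elements of the dual of the space of test functions. Nonpositivity makes the
  value on a test function depend only on its restriction to Dbar.\<close>

definition dissipation_measure ::
  "'n::finite \<Rightarrow> real \<Rightarrow> real \<Rightarrow> real \<Rightarrow> (((real ^ 'n) \<times> real \<Rightarrow> real) \<Rightarrow> real) \<Rightarrow> bool" where
  "dissipation_measure N g L T \<nu> \<longleftrightarrow>
     (\<forall>\<phi> \<psi> a b. testfun N g L T \<phi> \<longrightarrow> testfun N g L T \<psi> \<longrightarrow>
        \<nu> (\<lambda>p. a * \<phi> p + b * \<psi> p) = a * \<nu> \<phi> + b * \<nu> \<psi>) \<and>
     (\<forall>T'<T. \<exists>k K. \<forall>\<phi> M. testfun N g L T \<phi> \<longrightarrow> vanishes_from N g L T T' \<phi> \<longrightarrow>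
        derivs_le k M (Dbar N g L T) \<phi> \<longrightarrow> \<bar>\<nu> \<phi>\<bar> \<le> K * M) \<and>
     (\<forall>\<phi>. testfun N g L T \<phi> \<longrightarrow> (\<forall>p\<in>Dbar N g L T. 0 \<le> \<phi> p) \<longrightarrow> \<nu> \<phi> \<le> 0)"

definition has_density ::
  "'n::finite \<Rightarrow> real \<Rightarrow> real \<Rightarrow> real \<Rightarrow> (((real ^ 'n) \<times> real \<Rightarrow> real) \<Rightarrow> real) \<Rightarrow>
   ((real ^ 'n) \<times> real \<Rightarrow> real) \<Rightarrow> bool" where
  "has_density N g L T \<nu> d \<longleftrightarrow>
     periodic N d \<and> d \<in> borel_measurable (lebesgue_on (Dom N g L T)) \<and>
     integrable (lebesgue_on (Dom N g L T \<inter> (torus_cell N \<times> UNIV))) d \<and>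
     (\<forall>\<phi>. testfun N g L T \<phi> \<longrightarrow> \<nu> \<phi> = int_Dom N g L T (\<lambda>p. d p * \<phi> p))"


section \<open>State space and nonlinear quantities\<close>

type_synonym 'n state =
  "real \<times> (real ^ 'n) \<times> (real ^ 'n) \<times> (real ^ 'n) \<times> (real ^ 'n ^ 'n) \<times> real"

fun zmu :: "'n state \<Rightarrow> real" where "zmu (\<mu>, w, m, h, \<sigma>, e) = \<mu>"
fun zw :: "'n state \<Rightarrow> real ^ 'n" where "zw (\<mu>, w, m, h, \<sigma>, e) = w"
fun zm :: "'n state \<Rightarrow> real ^ 'n" where "zm (\<mu>, w, m, h, \<sigma>, e) = m"
fun zh :: "'n state \<Rightarrow> real ^ 'n" where "zh (\<mu>, w, m, h, \<sigma>, e) = h"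
fun zsigma :: "'n state \<Rightarrow> real ^ 'n ^ 'n" where "zsigma (\<mu>, w, m, h, \<sigma>, e) = \<sigma>"
fun ze :: "'n state \<Rightarrow> real" where "ze (\<mu>, w, m, h, \<sigma>, e) = e"

definition Zset :: "'n::finite state set" where
  "Zset = {z. transpose (zsigma z) = zsigma z \<and> trace (zsigma z) = 0}"

definition outer :: "real ^ 'n \<Rightarrow> real ^ 'n \<Rightarrow> real ^ 'n ^ 'n" where
  "outer v w = (\<chi> i j. v $ i * w $ j)"

definition lambda_max :: "real ^ 'n ^ 'n \<Rightarrow> real" where
  "lambda_max A = Max {l. \<exists>v. v \<noteq> 0 \<and> A *v v = l *\<^sub>R v}"

definition Mtilde :: "real \<Rightarrow> real \<Rightarrow> 'n::finite state \<Rightarrow> real ^ 'n ^ 'n" where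
  "Mtilde rm rp z =
     (1 / ((rp - zmu z) * (zmu z - rm))) *\<^sub>R
       ((zmu z * rm * rp) *\<^sub>R outer (zw z) (zw z)
        - (rm * rp) *\<^sub>R (outer (zm z) (zw z) + outer (zw z) (zm z))
        + (rp + rm - zmu z) *\<^sub>R outer (zm z) (zm z))
     - zsigma z"

definition Tplus :: "real \<Rightarrow> real \<Rightarrow> 'n::finite state \<Rightarrow> real" where
  "Tplus rm rp z = rp / 2 * (norm (zm z - rm *\<^sub>R zw z))\<^sup>2 / (zmu z - rm)\<^sup>2"

definition Tminus :: "real \<Rightarrow> real \<Rightarrow> 'n::finite state \<Rightarrow> real" where
  "Tminus rm rp z = rm / 2 * (norm (zm z - rp *\<^sub>R zw z))\<^sup>2 / (zmu z - rp)\<^sup>2"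

text \<open>The value 0 at s = 0 is immaterial.\<close>

definition rho0 :: "real \<Rightarrow> real \<Rightarrow> real \<Rightarrow> real" where
  "rho0 rm rp s = (if s > 0 then rp else if s < 0 then rm else 0)"


section \<open>Weak solutions of the linear system\<close>

definition weak_solution ::
  "'n::finite \<Rightarrow> real \<Rightarrow> real \<Rightarrow> real \<Rightarrow> real \<Rightarrow> real \<Rightarrow>
   ((real ^ 'n) \<times> real \<Rightarrow> 'n state) \<Rightarrow> ((real ^ 'n) \<times> real \<Rightarrow> real) \<Rightarrow>
   (((real ^ 'n) \<times> real \<Rightarrow> real) \<Rightarrow> real) \<Rightarrow> bool" where
  "weak_solution N rm rp g L T z q \<nu> \<longleftrightarrow>
     periodic N z \<and> periodic N q \<and>
     Linfty (Dom N g L T) z \<and> (AE p in lebesgue_on (Dom N g L T). z p \<in> Zset) \<and>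
     Linfty (Dom N g L T) q \<and>
     (\<forall>s\<in>{1, -1}. integrable (lebesgue_on (bdry_cell T)) (\<lambda>p. q (bpt N g L s p))) \<and>
     dissipation_measure N g L T \<nu> \<and>
     (\<forall>\<Phi> :: (real ^ 'n) \<times> real \<Rightarrow> real ^ 'n. testfun N g L T \<Phi> \<longrightarrow>
        int_Dom N g L T (\<lambda>p.
            zm (z p) \<bullet> pd \<Phi> (0, 1) p
            + (\<Sum>i\<in>UNIV. \<Sum>j\<in>UNIV.
                 (zsigma (z p) + mat (2 / real CARD('n) * ze (z p)) + mat (q p)) $ i $ j
                 * pd \<Phi> (axis j 1, 0) p $ i))
        - int_bdry_normal N g L T (\<lambda>p. q p * \<Phi> p $ N) = 0) \<and>
     (\<forall>\<Psi> :: (real ^ 'n) \<times> real \<Rightarrow> real. testfun N g L T \<Psi> \<longrightarrow>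
        int_Dom N g L T (\<lambda>p. \<Sum>i\<in>UNIV.
            (zw (z p) - (g * snd p) *\<^sub>R axis N 1) $ i * pd \<Psi> (axis i 1, 0) p) = 0 \<and>
        int_Dom N g L T (\<lambda>p. zmu (z p) * pd \<Psi> (0, 1) p
            + (\<Sum>i\<in>UNIV. zm (z p) $ i * pd \<Psi> (axis i 1, 0) p))
          + int_Omega N L (\<lambda>x. rho0 rm rp (x $ N) * \<Psi> (x, 0)) = 0 \<and>
        int_Dom N g L T (\<lambda>p. ze (z p) * pd \<Psi> (0, 1) p
            + (\<Sum>i\<in>UNIV. zh (z p) $ i * pd \<Psi> (axis i 1, 0) p))
          - int_bdry_normal N g L T (\<lambda>p. g * snd p * q p * \<Psi> p) = - \<nu> \<Psi>)"


section \<open>Subsolutions\<close>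

definition mixing_zone ::
  "'n::finite \<Rightarrow> real \<Rightarrow> real \<Rightarrow> real \<Rightarrow> real \<Rightarrow> real \<Rightarrow>
   ((real ^ 'n) \<times> real \<Rightarrow> 'n state) \<Rightarrow> ((real ^ 'n) \<times> real \<Rightarrow> real) \<Rightarrow>
   ((real ^ 'n) \<times> real) set \<Rightarrow> bool" where
  "mixing_zone N rm rp g L T z q U \<longleftrightarrow>
     open U \<and> U \<subseteq> Dom N g L T \<and> periodic N (\<lambda>p. p \<in> U) \<and>
     continuous_on U z \<and> Linfty U q \<and> continuous_on U q \<and>
     Linfty U (\<lambda>p. Tplus rm rp (z p)) \<and> Linfty U (\<lambda>p. Tminus rm rp (z p)) \<and>
     (\<forall>p\<in>U. rm < zmu (z p) \<and> zmu (z p) < rp) \<and>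
     (AE p in lebesgue_on (Dom N g L T - U).
        zm (z p) = zmu (z p) *\<^sub>R zw (z p) \<and>
        zh (z p) = (ze (z p) + q p) *\<^sub>R zw (z p) \<and>
        zmu (z p) *\<^sub>R outer (zw (z p)) (zw (z p))
          = zsigma (z p) + mat (2 / real CARD('n) * ze (z p)) \<and>
        zmu (z p) \<in> {rm, rp})"

definition strict_subsolution_with ::
  "real \<Rightarrow> 'n::finite \<Rightarrow> real \<Rightarrow> real \<Rightarrow> real \<Rightarrow> real \<Rightarrow> real \<Rightarrow>
   ((real ^ 'n) \<times> real \<Rightarrow> 'n state) \<Rightarrow> ((real ^ 'n) \<times> real \<Rightarrow> real) \<Rightarrow>
   (((real ^ 'n) \<times> real \<Rightarrow> real) \<Rightarrow> real) \<Rightarrow> bool" where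
  "strict_subsolution_with \<epsilon> N rm rp g L T z q \<nu> \<longleftrightarrow>
     \<epsilon> > 0 \<and> weak_solution N rm rp g L T z q \<nu> \<and>
     (\<exists>U. mixing_zone N rm rp g L T z q U \<and>
        (\<forall>p\<in>U.
           lambda_max (Mtilde rm rp (z p))
           + \<epsilon> * norm (zh (z p) - (ze (z p) + q p) *\<^sub>R zw (z p)
                - ((Tplus rm rp (z p) - Tminus rm rp (z p)) / (rp - rm)) *\<^sub>R
                    (zm (z p) - zmu (z p) *\<^sub>R zw (z p)))
           < 2 / real CARD('n) * ze (z p)))"

definition strict_subsolution ::
  "'n::finite \<Rightarrow> real \<Rightarrow> real \<Rightarrow> real \<Rightarrow> real \<Rightarrow> real \<Rightarrow>
   ((real ^ 'n) \<times> real \<Rightarrow> 'n state) \<Rightarrow> ((real ^ 'n) \<times> real \<Rightarrow> real) \<Rightarrow>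
   (((real ^ 'n) \<times> real \<Rightarrow> real) \<Rightarrow> real) \<Rightarrow> bool" where
  "strict_subsolution N rm rp g L T z q \<nu> \<longleftrightarrow>
     (\<exists>\<epsilon>>0. strict_subsolution_with \<epsilon> N rm rp g L T z q \<nu>)"

text \<open>The function f of the one-dimensional ansatz, in terms of t, r = mu and s = m_n.\<close>

definition f1d :: "real \<Rightarrow> real \<Rightarrow> real \<Rightarrow> real \<Rightarrow> real \<Rightarrow> real \<Rightarrow> real" where
  "f1d rm rp g t r s =
     (if rm < r \<and> r < rp
      then (r * rm * rp * g\<^sup>2 * t\<^sup>2 - 2 * rm * rp * s * g * t + (rp + rm - r) * s\<^sup>2)
             / ((rp - r) * (r - rm))
      else r * g\<^sup>2 * t\<^sup>2)"

definition fz :: "'n::finite \<Rightarrow> real \<Rightarrow> real \<Rightarrow> real \<Rightarrow> real \<Rightarrow> 'n state \<Rightarrow> real" where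
  "fz N rm rp g t z = f1d rm rp g t (zmu z) (zm z $ N)"

text \<open>(1/2) diag(-f, f) for n = 2 and (1/3) diag(-f, -f, 2f) for n = 3, the last entry being
  the one with index N.\<close>

definition sigma1d :: "'n::finite \<Rightarrow> real \<Rightarrow> real ^ 'n ^ 'n" where
  "sigma1d N f = (\<chi> i j. if i \<noteq> j then 0
      else if i = N then (real CARD('n) - 1) * f / real CARD('n) else - f / real CARD('n))"

text \<open>Dependence of \<open>\<nu>\<close> on (y_n, t) only is invariance under translations
  in the torus directions.\<close>

definition one_dimensional ::
  "'n::finite \<Rightarrow> real \<Rightarrow> real \<Rightarrow> real \<Rightarrow> real \<Rightarrow> real \<Rightarrow>
   ((real ^ 'n) \<times> real \<Rightarrow> 'n state) \<Rightarrow> ((real ^ 'n) \<times> real \<Rightarrow> real) \<Rightarrow>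
   (((real ^ 'n) \<times> real \<Rightarrow> real) \<Rightarrow> real) \<Rightarrow> bool" where
  "one_dimensional N rm rp g L T z q \<nu> \<longleftrightarrow>
     (\<exists>z1 :: real \<times> real \<Rightarrow> 'n state.
        AE p in lebesgue_on (Dom N g L T). z p = z1 (fst p $ N, snd p)) \<and>
     (\<exists>q1 :: real \<times> real \<Rightarrow> real.
        (AE p in lebesgue_on (Dom N g L T). q p = q1 (fst p $ N, snd p)) \<and>
        (\<forall>s\<in>{1, -1}. AE p in lebesgue_on (bdry_cell T).
           q (bpt N g L s p) = q1 (fst (bpt N g L s p) $ N, snd p))) \<and>
     (\<forall>\<phi> v. testfun N g L T \<phi> \<longrightarrow> v $ N = 0 \<longrightarrow> \<nu> (\<lambda>(y, t). \<phi> (y + v, t)) = \<nu> \<phi>) \<and>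
     (AE p in lebesgue_on (Dom N g L T).
        zw (z p) = (g * snd p) *\<^sub>R axis N 1 \<and>
        (\<forall>j. j \<noteq> N \<longrightarrow> zm (z p) $ j = 0 \<and> zh (z p) $ j = 0) \<and>
        zsigma (z p) = sigma1d N (fz N rm rp g (snd p) (z p)))"

definition nonstrict_subsolution_1d ::
  "'n::finite \<Rightarrow> real \<Rightarrow> real \<Rightarrow> real \<Rightarrow> real \<Rightarrow> real \<Rightarrow>
   ((real ^ 'n) \<times> real \<Rightarrow> 'n state) \<Rightarrow> ((real ^ 'n) \<times> real \<Rightarrow> real) \<Rightarrow>
   (((real ^ 'n) \<times> real \<Rightarrow> real) \<Rightarrow> real) \<Rightarrow> bool" where
  "nonstrict_subsolution_1d N rm rp g L T z q \<nu> \<longleftrightarrow>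
     weak_solution N rm rp g L T z q \<nu> \<and> one_dimensional N rm rp g L T z q \<nu> \<and>
     (\<exists>U. mixing_zone N rm rp g L T z q U \<and>
        (\<forall>p\<in>U.
           ze (z p) = (1/2) * fz N rm rp g (snd p) (z p) \<and>
           zh (z p) = (ze (z p) + q p) *\<^sub>R zw (z p)
             + ((Tplus rm rp (z p) - Tminus rm rp (z p)) / (rp - rm)) *\<^sub>R
                 (zm (z p) - zmu (z p) *\<^sub>R zw (z p))))"


section \<open>The scalar conservation law\<close>

definition afun :: "real \<Rightarrow> real \<Rightarrow> real \<Rightarrow> real" where
  "afun rm rp r = (rp - r) * (r - rm) / (rp + rm - r)"

definition flux :: "real \<Rightarrow> real \<Rightarrow> real \<Rightarrow> real \<Rightarrow> real" where
  "flux rm rp lam r = r - lam * afun rm rp r"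

text \<open>Kruzhkov entropy solutions on the whole line, with values in [rm, rp], where the flux is
  regular (it has a pole at rm + rp); constants k outside that range would only repeat the weak
  form of the equation, which k = rm and k = rp already yield.\<close>

definition entropy_solution ::
  "real \<Rightarrow> real \<Rightarrow> real \<Rightarrow> real \<Rightarrow> real \<Rightarrow> (real \<times> real \<Rightarrow> real) \<Rightarrow> bool" where
  "entropy_solution rm rp g lam T u \<longleftrightarrow>
     u \<in> borel_measurable (lebesgue_on (UNIV \<times> {0<..<T})) \<and>
     (AE p in lebesgue_on (UNIV \<times> {0<..<T}). rm \<le> u p \<and> u p \<le> rp) \<and>
     (\<forall>k \<phi>. rm \<le> k \<longrightarrow> k \<le> rp \<longrightarrow> smooth \<phi> \<longrightarrow>
        (\<exists>R. \<exists>T'<T. \<forall>y t. 0 \<le> t \<longrightarrow> t < T \<longrightarrow> R \<le> \<bar>y\<bar> \<or> T' \<le> t \<longrightarrow> \<phi> (y, t) = 0) \<longrightarrow>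
        (\<forall>y t. 0 \<le> t \<longrightarrow> t < T \<longrightarrow> 0 \<le> \<phi> (y, t)) \<longrightarrow>
        0 \<le> integral\<^sup>L (lebesgue_on (UNIV \<times> {0<..<T})) (\<lambda>p.
              \<bar>u p - k\<bar> * pd \<phi> (0, 1) p
              + g * snd p * sgn (u p - k) * (flux rm rp lam (u p) - flux rm rp lam k)
                * pd \<phi> (1, 0) p)
            + integral\<^sup>L lebesgue (\<lambda>y. \<bar>rho0 rm rp y - k\<bar> * \<phi> (y, 0)))"

end

theory Submission
  imports Defs
begin

text \<open>
  Write P = (rp - mu) (mu - rm) and gamma = 1 - 2/n. The given state satisfies the constraint (S) with
  equality: for w = g t e_n and the diagonal sigma of the ansatz, the matrix Mtilde is (f/n) times the
  identity, 2 e / n = f / n, and the vector inside the second term of (S) vanishes. Raising the energy by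
  A = delta t^2 P^2, which is positive exactly in the mixing zone, makes the inequality strict,
  because Mtilde does not contain e. The other fields are adjusted so that nothing else moves:
  the pressure drops by (2/n) A, which keeps sigma + (2/n) e id + q id and hence the momentum equation,
  and h grows by gamma A w, which is the change of (e + q) w, so that the second term of (S) stays 0.
  Hence (S) holds with every factor epsilon, in particular with 1. Outside the mixing zone A = 0.

  The price is paid in the energy balance, whose dissipation density changes by
  dA/dt + gamma g t dA/dy_n. This has to be a function that is at most C delta t P, so mu must be known
  well. The flux F(r) = r - lam a(r) is increasing and strictly convex on [rm, rp], and the initial datum
  jumps upwards, so the entropy solution is a rarefaction wave: mu is a function \<open>fan\<close> of the
  similarity variable xi = 2 y_n / (g t^2) (\<open>entropy_solution_eq_fan\<close>). As a function of xi,
  the product P has kinks at the two edges of the wave, but P^2 is continuously differentiable with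
  derivative P H for a bounded function H (\<open>prof_sq_DERIV\<close>); this is where the square in A
  enters. The chain rule then gives
  dA/dt + gamma g t dA/dy_n = delta t (2 P^2 + 2 (gamma - xi) P H), which is of the order delta t P.
  Because the original density is -lam (1 - 2 lam) g^2 t a(mu), and a(mu) is at least P / rp, the new density
  remains nonpositive for small delta.

  That the entropy solution u is the rarefaction wave follows by a direct comparison with
  its level rays. Fix k in [rm, rp]. In the region y < F'(k) g t^2 / 2 the quantity (u - k)^+ is 0
  initially, and by convexity its flux through the moving boundary points outwards; hence u is at most k there. In the same way u is
  at least k for y > F'(k) g t^2 / 2. Letting k run through the rationals determines u almost everywhere
  (\<open>entropy_solution_one_side\<close>). The test functions for this argument are products of
  cutoffs exp(-1/x).

  Two devices avoid splitting off the coordinate y_n in higher dimension. A null set of the (y_n, t)-plane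
  pulls back to a null set because the preimages of all its translates have the same measure, and these
  measures average to 0 (\<open>null_set_pullback\<close>). The integral of a directional derivative over a translation invariant
  set vanishes because the integral of each difference quotient does
  (\<open>integral_directional_derivative_eq_0\<close>); this yields the weak form of the energy
  balance (\<open>int_Dom_fan_by_parts\<close>).
\<close>


section \<open>Smooth functions and a flat cutoff\<close>

lemma pd_eq: "(f has_derivative f') (at p) \<Longrightarrow> pd f v p = f' v"
  unfolding pd_def by (metis frechet_derivative_at)

lemma has_derivative_pd:
  "f differentiable (at p) \<Longrightarrow> (f has_derivative (\<lambda>v. pd f v p)) (at p)"
  unfolding pd_def by (simp add: frechet_derivative_works[symmetric])

lemma Ck_imp_differentiable: "Ck (Suc k) f \<Longrightarrow> f differentiable (at p)"
  by (simp add: differentiable_on_def)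

lemma Ck_Suc_imp_Ck: "Ck (Suc k) f \<Longrightarrow> Ck k f"
proof (induction k arbitrary: f)
  case 0 then show ?case by (simp add: differentiable_imp_continuous_on)
next
  case (Suc k) then show ?case by (metis Ck.simps(2))
qed

text \<open>
  Avoids the Frechet derivative of the definition: any explicit derivative may be used to show
  smoothness.
\<close>

lemma Ck_SucI:
  assumes "\<And>p. (f has_derivative f' p) (at p)" and "\<And>b. b \<in> Basis \<Longrightarrow> Ck k (\<lambda>p. f' p b)"
  shows "Ck (Suc k) f"
proof -
  have "pd f b = (\<lambda>p. f' p b)" for b using pd_eq[OF assms(1)] by blast
  moreover have "f differentiable_on UNIV"
    using assms(1) by (auto simp: differentiable_on_def differentiable_def)
  ultimately show ?thesis using assms(2) by simp
qed

lemma Ck_const: "Ck k (\<lambda>_. c)"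
proof (induction k arbitrary: c)
  case (Suc k)
  show ?case by (rule Ck_SucI[where f' = "\<lambda>_ _. 0"]) (auto intro: Suc)
qed simp

lemma Ck_bounded_linear: "bounded_linear L \<Longrightarrow> Ck k L"
proof (cases k)
  case (Suc j)
  assume L: "bounded_linear L"
  show ?thesis unfolding Suc
    by (rule Ck_SucI[where f' = "\<lambda>_. L"]) (auto intro: Ck_const bounded_linear_imp_has_derivative L)
qed (simp add: linear_continuous_on)

lemma Ck_add: "Ck k f \<Longrightarrow> Ck k g \<Longrightarrow> Ck k (\<lambda>p. f p + g p)"
proof (induction k arbitrary: f g)
  case 0 then show ?case by (simp add: continuous_on_add)
next
  case (Suc k)
  show ?case
    by (rule Ck_SucI[where f' = "\<lambda>p v. pd f v p + pd g v p"])
      (use Suc.prems in \<open>auto intro!: has_derivative_add has_derivative_pd Ck_imp_differentiable[of k] Suc.IH\<close>)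
qed

lemma Ck_mult:
  fixes f g :: "'a::euclidean_space \<Rightarrow> real"
  shows "Ck k f \<Longrightarrow> Ck k g \<Longrightarrow> Ck k (\<lambda>p. f p * g p)"
proof (induction k arbitrary: f g)
  case 0 then show ?case by (simp add: continuous_on_mult)
next
  case (Suc k)
  show ?case
  proof (rule Ck_SucI[where f' = "\<lambda>p v. f p * pd g v p + pd f v p * g p"])
    show "((\<lambda>p. f p * g p) has_derivative (\<lambda>v. f p * pd g v p + pd f v p * g p)) (at p)" for p
      by (intro has_derivative_mult has_derivative_pd Ck_imp_differentiable[of k] Suc.prems)
    fix b :: 'a assume "b \<in> Basis"
    then show "Ck k (\<lambda>p. f p * pd g b p + pd f b p * g p)"
      using Suc.prems Ck_Suc_imp_Ck[OF Suc.prems(1)] Ck_Suc_imp_Ck[OF Suc.prems(2)]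
      by (auto intro!: Ck_add Suc.IH)
  qed
qed

lemma smooth_const: "smooth (\<lambda>_. c)"
  and smooth_add: "smooth f \<Longrightarrow> smooth g \<Longrightarrow> smooth (\<lambda>p. f p + g p)"
  and smooth_bounded_linear: "bounded_linear L \<Longrightarrow> smooth L"
  by (auto simp: smooth_def Ck_const Ck_add Ck_bounded_linear)

lemma smooth_mult:
  fixes f g :: "'a::euclidean_space \<Rightarrow> real"
  shows "smooth f \<Longrightarrow> smooth g \<Longrightarrow> smooth (\<lambda>p. f p * g p)"
  by (auto simp: smooth_def Ck_mult)

lemma smooth_differentiable: "smooth f \<Longrightarrow> f differentiable (at p)"
  unfolding smooth_def using Ck_imp_differentiable by blast

lemma smooth_continuous_on: "smooth f \<Longrightarrow> continuous_on S f"
  unfolding smooth_def by (metis Ck.simps(1) continuous_on_subset subset_UNIV)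

lemma smooth_pd: "smooth f \<Longrightarrow> b \<in> Basis \<Longrightarrow> smooth (pd f b)"
  unfolding smooth_def by (metis Ck.simps(2))

text \<open>
  The case n = 0 is the classical smooth cutoff exp(-1/x). The powers of 1/x make the family closed
  under differentiation up to linear combinations, so smoothness follows by one induction.
\<close>

definition flat :: "nat \<Rightarrow> real \<Rightarrow> real" where
  "flat n x = (if x > 0 then inverse x ^ n * exp (- inverse x) else 0)"

lemma flat_over_x_tendsto_0: "((\<lambda>x. flat n x / x) \<longlongrightarrow> 0) (at 0)"
proof -
  have "((\<lambda>x. flat n x / x) \<longlongrightarrow> 0) (at_right 0)"
  proof -
    have "((\<lambda>x::real. inverse x ^ Suc n / exp (inverse x)) \<longlongrightarrow> 0) (at_right 0)"
      by (rule filterlim_compose[OF tendsto_power_div_exp_0 filterlim_inverse_at_top_right])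
    moreover have "\<forall>\<^sub>F x in at_right (0::real). inverse x ^ Suc n / exp (inverse x) = flat n x / x"
      by (auto simp: eventually_at_filter flat_def exp_minus field_simps)
    ultimately show ?thesis by (rule Lim_transform_eventually)
  qed
  moreover have "((\<lambda>x. flat n x / x) \<longlongrightarrow> 0) (at_left 0)"
    by (rule tendsto_eventually) (auto simp: eventually_at_filter flat_def)
  ultimately show ?thesis by (simp add: filterlim_split_at)
qed

lemma flat_has_derivative:
  "(flat n has_real_derivative (flat (n + 2) x - real n * flat (n + 1) x)) (at x)"
proof -
  consider "x > 0" | "x < 0" | "x = 0" by linarith
  then show ?thesis
  proof cases
    case 1
    have i: "(inverse has_real_derivative - (inverse x)\<^sup>2) (at x)"
      using DERIV_inverse[of x UNIV] 1 by (simp add: power2_eq_square)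
    have "((\<lambda>x. inverse x ^ n * exp (- inverse x)) has_real_derivative
        (real n * (- (inverse x)\<^sup>2 * inverse x ^ (n - Suc 0)) * exp (- inverse x)
          + exp (- inverse x) * - (- (inverse x)\<^sup>2) * inverse x ^ n)) (at x)"
      by (intro DERIV_mult DERIV_power DERIV_fun_exp DERIV_minus i)
    also have "real n * (- (inverse x)\<^sup>2 * inverse x ^ (n - Suc 0)) * exp (- inverse x)
          + exp (- inverse x) * - (- (inverse x)\<^sup>2) * inverse x ^ n
        = flat (n + 2) x - real n * flat (n + 1) x"
      using 1 by (cases n) (simp_all add: flat_def power_add power2_eq_square algebra_simps)
    finally have "((\<lambda>x. inverse x ^ n * exp (- inverse x)) has_real_derivative
        (flat (n + 2) x - real n * flat (n + 1) x)) (at x)" .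
    then show ?thesis
      by (rule has_field_derivative_transform_within_open[where S = "{0<..}"])
        (use 1 in \<open>auto simp: flat_def\<close>)
  next
    case 2
    have "((\<lambda>_. 0) has_real_derivative (flat (n + 2) x - real n * flat (n + 1) x)) (at x)"
      using 2 by (simp add: flat_def)
    then show ?thesis
      by (rule has_field_derivative_transform_within_open[where S = "{..<0}"])
        (use 2 in \<open>auto simp: flat_def\<close>)
  next
    case 3
    then show ?thesis using flat_over_x_tendsto_0[of n]
      by (simp add: has_field_derivative_iff flat_def)
  qed
qed

text \<open>
  Both functions in the derivative of \<open>flat n\<close> belong to the same family, so the
  induction hypothesis has to be available for all n at once.
\<close>

lemma Ck_flat: "Ck k \<alpha> \<Longrightarrow> Ck k (\<lambda>p. flat n (\<alpha> p))"
proof (induction k arbitrary: \<alpha> n)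
  case 0
  have "continuous_on UNIV (flat n)"
    by (rule DERIV_continuous_on) (rule has_field_derivative_at_within[OF flat_has_derivative])
  then show ?case using 0 continuous_on_compose2[of UNIV "flat n" UNIV \<alpha>] by simp
next
  case (Suc k)
  have \<alpha>: "Ck k \<alpha>" using Suc.prems by (rule Ck_Suc_imp_Ck)
  show ?case
  proof (rule Ck_SucI[where f' = "\<lambda>p v. (flat (n + 2) (\<alpha> p) + (- real n) * flat (n + 1) (\<alpha> p)) * pd \<alpha> v p"])
    show "((\<lambda>p. flat n (\<alpha> p)) has_derivative
        (\<lambda>v. (flat (n + 2) (\<alpha> p) + (- real n) * flat (n + 1) (\<alpha> p)) * pd \<alpha> v p)) (at p)" for p
      using has_derivative_compose[OF has_derivative_pd[OF Ck_imp_differentiable[OF Suc.prems]]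
         has_field_derivative_imp_has_derivative[OF flat_has_derivative[of n]]]
      by simp
    fix b :: 'a assume "b \<in> Basis"
    then have "Ck k (pd \<alpha> b)" using Suc.prems by simp
    then show "Ck k (\<lambda>p. (flat (n + 2) (\<alpha> p) + (- real n) * flat (n + 1) (\<alpha> p)) * pd \<alpha> b p)"
      by (rule Ck_mult[OF Ck_add[OF Suc.IH[OF \<alpha>] Ck_mult[OF Ck_const Suc.IH[OF \<alpha>]]]])
  qed
qed

lemma smooth_flat: "smooth \<alpha> \<Longrightarrow> smooth (\<lambda>p. flat n (\<alpha> p))"
  by (simp add: smooth_def Ck_flat)

lemma flat_nonneg: "0 \<le> flat n x"
  and flat_pos: "0 < x \<Longrightarrow> 0 < flat n x"
  and flat_eq_0: "x \<le> 0 \<Longrightarrow> flat n x = 0"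
  by (auto simp: flat_def)


section \<open>Null sets and integrals of directional derivatives\<close>

text \<open>
  The measure of a shifted preimage does not depend on the shift, because \<open>j\<close> lifts every
  shift of the target space to a translation of the source. Integrating it over all shifts gives 0 by
  Fubini, since for each fixed p the shifts that send \<open>f p\<close> into Z form a null set. A
  constant with vanishing integral over a space of infinite measure is 0.
\<close>

lemma null_set_pullback:
  fixes f :: "'a::euclidean_space \<Rightarrow> 'b::euclidean_space" and j :: "'b \<Rightarrow> 'a"
  assumes f: "f \<in> borel_measurable borel" and j: "j \<in> borel_measurable borel"
    and fj: "\<And>p v. f (p + j v) = f p + v"
    and Z: "Z \<in> null_sets lborel"
  shows "f -` Z \<in> null_sets lborel"
proof -
  have Zb: "Z \<in> sets borel" using Z by auto
  have E: "f -` Z \<in> sets borel" using measurable_sets[OF f Zb] by simp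
  have shift_sets: "(+) c -` X \<in> sets borel" if "X \<in> sets borel" for c :: "'c::euclidean_space" and X
    using measurable_sets[of "(+) c" borel borel X] that by simp
  have shift: "emeasure lborel ((+) c -` X) = emeasure lborel X" if "X \<in> sets borel" for c :: "'c::euclidean_space" and X
  proof -
    have "emeasure lborel X = emeasure (distr lborel borel ((+) c)) X"
      by (simp add: lborel_distr_plus)
    also have "\<dots> = emeasure lborel ((+) c -` X)"
      by (subst emeasure_distr) (use that in auto)
    finally show ?thesis ..
  qed
  have m: "(\<lambda>(v, p). indicator Z (f p + v) :: ennreal) \<in> borel_measurable (lborel \<Otimes>\<^sub>M lborel)"
    using f Zb by measurable
  have "(\<integral>\<^sup>+ v. \<integral>\<^sup>+ p. indicator Z (f p + v) \<partial>lborel \<partial>lborel) =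
        (\<integral>\<^sup>+ p. \<integral>\<^sup>+ v. indicator Z (f p + v) \<partial>lborel \<partial>lborel)"
    by (rule lborel_pair.Fubini'[OF m, symmetric])
  also have "\<dots> = 0"
  proof -
    have "(\<integral>\<^sup>+ v. indicator Z (f p + v) \<partial>lborel) = 0" for p
    proof -
      have "(\<integral>\<^sup>+ v. indicator Z (f p + v) \<partial>lborel) = (\<integral>\<^sup>+ v. indicator ((+) (f p) -` Z) v \<partial>lborel)"
        by (simp add: indicator_def)
      also have "\<dots> = emeasure lborel ((+) (f p) -` Z)"
        by (rule nn_integral_indicator) (simp add: shift_sets[OF Zb])
      finally show ?thesis using shift[OF Zb] Z by (simp add: null_sets_def)
    qed
    then show ?thesis by simp
  qed
  finally have 0: "(\<integral>\<^sup>+ v. \<integral>\<^sup>+ p. indicator Z (f p + v) \<partial>lborel \<partial>lborel) = 0" .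
  have "(\<integral>\<^sup>+ p. indicator Z (f p + v) \<partial>lborel) = emeasure lborel (f -` Z)" for v
  proof -
    have "(\<integral>\<^sup>+ p. indicator Z (f p + v) \<partial>lborel) = (\<integral>\<^sup>+ p. indicator ((+) (j v) -` (f -` Z)) p \<partial>lborel)"
      by (simp add: indicator_def add.commute[of "j v"] fj)
    also have "\<dots> = emeasure lborel ((+) (j v) -` (f -` Z))"
      by (rule nn_integral_indicator) (simp add: shift_sets[OF E])
    finally show ?thesis using shift[OF E] by simp
  qed
  with 0 have "emeasure lborel (f -` Z) * emeasure lborel (UNIV :: 'b set) = 0"
    by simp
  then show ?thesis using E by (auto simp: null_sets_def emeasure_lborel_UNIV)
qed

lemma AE_lebesgue_pullback:
  fixes f :: "'a::euclidean_space \<Rightarrow> 'b::euclidean_space" and j :: "'b \<Rightarrow> 'a"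
  assumes "f \<in> borel_measurable borel" and "j \<in> borel_measurable borel"
    and "\<And>p v. f (p + j v) = f p + v"
    and "AE x in lebesgue. P x"
  shows "AE p in lebesgue. P (f p)"
proof -
  have "AE x in lborel. P x" using assms(4) by (simp add: AE_completion_iff)
  then obtain Z where Z: "Z \<in> null_sets lborel" "{x. \<not> P x} \<subseteq> Z"
    by (auto simp: eventually_ae_filter)
  have "AE p in lborel. P (f p)"
    using null_set_pullback[OF assms(1-3) Z(1)] Z(2) by (intro AE_I') auto
  then show ?thesis by (rule AE_completion)
qed

text \<open>
  The set where two continuous functions differ is open, and a nonempty open set is not a null set.
\<close>

lemma AE_eq_imp_eq_on_open:
  fixes f g :: "'a::euclidean_space \<Rightarrow> 'b::real_normed_vector"
  assumes U: "open U" "U \<subseteq> D" and D: "D \<in> sets lebesgue"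
    and fg: "continuous_on U f" "continuous_on U g"
    and AE: "AE p in lebesgue_on D. f p = g p" and p: "p \<in> U"
  shows "f p = g p"
proof (rule ccontr)
  assume ne: "f p \<noteq> g p"
  define V where "V = {x \<in> U. f x - g x \<in> - {0}}"
  have "open V" unfolding V_def
    using continuous_open_preimage[of U "\<lambda>x. f x - g x" "- {0}"] U fg
    by (simp add: continuous_on_diff vimage_def Int_def open_Compl)
  moreover have "V \<in> null_sets lebesgue"
  proof -
    have "AE x in lebesgue. x \<in> D \<longrightarrow> f x = g x" using AE D by (simp add: AE_restrict_space_iff)
    then have "AE x in lebesgue. x \<notin> V" by eventually_elim (use U in \<open>auto simp: V_def\<close>)
    then show ?thesis using \<open>open V\<close> by (simp add: AE_iff_null_sets)
  qed
  ultimately have "V = {}"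
    using open_not_negligible negligible_iff_null_sets by blast
  then show False using ne p by (auto simp: V_def)
qed

text \<open>
  By translation invariance every difference quotient of W in the direction v has integral 0 over S.
  The quotients are bounded by M, by the mean value theorem along lines, and vanish outside a fixed
  ball, so dominated convergence applies.
\<close>

lemma integral_directional_derivative_eq_0:
  fixes W W' :: "'a::euclidean_space \<Rightarrow> real"
  assumes S: "S \<in> sets borel" and inv: "\<And>p s. p \<in> S \<Longrightarrow> p + s *\<^sub>R v \<in> S"
    and W: "W \<in> borel_measurable borel"
    and der: "\<And>p. p \<in> S \<Longrightarrow> ((\<lambda>s. W (p + s *\<^sub>R v)) has_real_derivative W' p) (at 0)"
    and bnd: "\<And>p. p \<in> S \<Longrightarrow> \<bar>W' p\<bar> \<le> M" "\<And>p. p \<in> S \<Longrightarrow> \<bar>W p\<bar> \<le> M"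
    and supp: "\<And>p. p \<in> S \<Longrightarrow> r < norm p \<Longrightarrow> W p = 0"
  shows "integrable (lebesgue_on S) W'" and "integral\<^sup>L (lebesgue_on S) W' = 0"
proof -
  define f where "f p = indicator S p * W p" for p
  define f' where "f' = (\<lambda>p. indicator S p * W' p)"
  define Q where "Q k = (\<lambda>p. real (Suc k) * (f (p + (1 / real (Suc k)) *\<^sub>R v) - f p))" for k
  define w where "w p = (\<bar>M\<bar>) * indicator (cball 0 (r + norm v)) p" for p :: 'a
  have fb[measurable]: "f \<in> borel_measurable borel"
    unfolding f_def using S W by measurable
  have S_iff: "p + s *\<^sub>R v \<in> S \<longleftrightarrow> p \<in> S" for p s
    using inv[of p s] inv[of "p + s *\<^sub>R v" "- s"] by auto
  have ball: "integrable lborel (\<lambda>p. c * indicator (cball 0 R) (p::'a) :: real)" for c R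
    by (intro integrable_mult_right integrable_real_indicator)
      (simp_all add: emeasure_bounded_finite flip: infinity_ennreal_def)
  have fint: "integrable lborel f"
  proof (rule Bochner_Integration.integrable_bound[OF ball[of "\<bar>M\<bar>" r]])
    show "AE p in lborel. norm (f p) \<le> norm (\<bar>M\<bar> * indicator (cball 0 r) p)"
    proof (rule AE_I2)
      fix p show "norm (f p) \<le> norm (\<bar>M\<bar> * indicator (cball 0 r) p)"
        using bnd(2)[of p] supp[of p] by (auto simp: f_def indicator_def)
    qed
  qed simp
  have Qint0: "integral\<^sup>L lborel (Q k) = 0" for k
  proof -
    have "integrable lborel (\<lambda>p. f ((1 / real (Suc k)) *\<^sub>R v + p))"
      using fint integrable_distr[of "(+) ((1 / real (Suc k)) *\<^sub>R v)" lborel borel f]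
      by (simp add: lborel_distr_plus)
    moreover have "integral\<^sup>L lborel (\<lambda>p. f ((1 / real (Suc k)) *\<^sub>R v + p)) = integral\<^sup>L lborel f"
    proof -
      have "integral\<^sup>L lborel f = integral\<^sup>L (distr lborel borel ((+) ((1 / real (Suc k)) *\<^sub>R v))) f"
        by (simp add: lborel_distr_plus)
      then show ?thesis by (subst (asm) integral_distr) auto
    qed
    ultimately show ?thesis using fint by (simp add: Q_def add.commute del: of_nat_Suc)
  qed
  have lines: "((\<lambda>s. W (p + s *\<^sub>R v)) has_real_derivative W' (p + s *\<^sub>R v)) (at s)" if "p \<in> S" for p s
  proof -
    have "((\<lambda>u. W ((p + s *\<^sub>R v) + u *\<^sub>R v)) has_real_derivative W' (p + s *\<^sub>R v)) (at 0)"
      using der inv that by blast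
    then have "((\<lambda>u. W (p + (s + u) *\<^sub>R v)) has_real_derivative W' (p + s *\<^sub>R v)) (at 0)"
      by (simp add: algebra_simps)
    then show ?thesis using DERIV_shift[of "\<lambda>u. W (p + u *\<^sub>R v)" _ 0 s] by (simp add: add.commute)
  qed
  have Qlim: "(\<lambda>k. Q k p) \<longlonglongrightarrow> f' p" for p
  proof (cases "p \<in> S")
    case True
    have "((\<lambda>s. (W (p + s *\<^sub>R v) - W p) / s) \<longlongrightarrow> W' p) (at 0)"
      using der[OF True] by (simp add: has_field_derivative_iff)
    moreover have "filterlim (\<lambda>k. 1 / real (Suc k)) (at 0) sequentially"
      by (auto intro!: filterlim_atI LIMSEQ_Suc[OF lim_const_over_n] lim_1_over_n simp del: of_nat_Suc)
    ultimately have "(\<lambda>k. (W (p + (1 / real (Suc k)) *\<^sub>R v) - W p) / (1 / real (Suc k))) \<longlonglongrightarrow> W' p"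
      by (rule filterlim_compose)
    then show ?thesis using True S_iff by (simp add: Q_def f_def f'_def mult.commute)
  next
    case False
    then show ?thesis using S_iff by (simp add: Q_def f_def f'_def)
  qed
  have Qb: "norm (Q k p) \<le> w p" for k p
  proof (cases "p \<in> S")
    case True
    let ?s = "1 / real (Suc k)"
    have "\<bar>W (p + ?s *\<^sub>R v) - W (p + 0 *\<^sub>R v)\<bar> \<le> M * \<bar>?s - 0\<bar>"
      using field_differentiable_bound[of UNIV "\<lambda>s. W (p + s *\<^sub>R v)" "\<lambda>s. W' (p + s *\<^sub>R v)" M ?s 0]
        lines[OF True] bnd(1)[OF inv[OF True]] by simp
    then have "real (Suc k) * \<bar>W (p + ?s *\<^sub>R v) - W p\<bar> \<le> M"
      by (simp add: field_simps)
    then have 1: "\<bar>Q k p\<bar> \<le> M"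
      using True S_iff by (simp add: Q_def f_def abs_mult del: of_nat_Suc)
    have 2: "Q k p = 0" if "r + norm v < norm p"
    proof -
      have n: "norm p \<le> norm (p + ?s *\<^sub>R v) + norm (?s *\<^sub>R v)"
        using norm_triangle_ineq4[of "p + ?s *\<^sub>R v" "?s *\<^sub>R v"] by simp
      have "norm (?s *\<^sub>R v) \<le> norm v" by (simp add: field_simps)
      then have "r < norm p" "r < norm (p + ?s *\<^sub>R v)" using that n norm_ge_zero[of v] by linarith+
      then show ?thesis using True S_iff supp inv by (simp add: Q_def f_def)
    qed
    show ?thesis using 1 2 by (auto simp: w_def indicator_def)
  next
    case False
    then show ?thesis using S_iff by (simp add: Q_def f_def w_def)
  qed
  have Qm: "Q k \<in> borel_measurable lborel" for k unfolding Q_def by measurable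
  have f'm: "f' \<in> borel_measurable lborel"
    by (rule borel_measurable_LIMSEQ_real[OF Qlim Qm])
  have wi: "integrable lborel w" unfolding w_def by (rule ball)
  have Qlim_AE: "AE p in lborel. (\<lambda>k. Q k p) \<longlonglongrightarrow> f' p" by (rule AE_I2) (rule Qlim)
  have Qb_AE: "AE p in lborel. norm (Q k p) \<le> w p" for k by (rule AE_I2) (rule Qb)
  note dc = integrable_dominated_convergence[OF f'm Qm wi Qlim_AE Qb_AE]
    integral_dominated_convergence[OF f'm Qm wi Qlim_AE Qb_AE]
  have 0: "integral\<^sup>L lborel f' = 0" using dc(2) by (simp add: Qint0 LIMSEQ_const_iff)
  have SL: "S \<in> sets lebesgue" using S by simp
  show "integrable (lebesgue_on S) W'"
    using dc(1) f'm SL by (simp add: integrable_restrict_space integrable_completion f'_def)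
  show "integral\<^sup>L (lebesgue_on S) W' = 0"
    using 0 f'm SL by (simp add: integral_restrict_space integral_completion f'_def)
qed


section \<open>Test functions on the space-time strip\<close>

lemma smooth_fst: "smooth (\<lambda>p::real \<times> real. fst p)"
  and smooth_snd: "smooth (\<lambda>p::real \<times> real. snd p)"
  by (auto intro: smooth_bounded_linear bounded_linear_fst bounded_linear_snd)

lemma smooth_diff:
  fixes f h :: "'a::euclidean_space \<Rightarrow> real"
  shows "smooth f \<Longrightarrow> smooth h \<Longrightarrow> smooth (\<lambda>p. f p - h p)"
  using smooth_add[of f "\<lambda>p. - 1 * h p"] smooth_mult[OF smooth_const[of "- 1"], of h] by simp

lemma integrable_lebesgue_on_bounded_support:
  fixes f :: "'a::euclidean_space \<Rightarrow> real"
  assumes S: "S \<in> sets lebesgue" and f: "f \<in> borel_measurable (lebesgue_on S)"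
    and bnd: "AE p in lebesgue_on S. \<bar>f p\<bar> \<le> M"
    and supp: "AE p in lebesgue_on S. r < norm p \<longrightarrow> f p = 0"
  shows "integrable (lebesgue_on S) f"
proof (rule Bochner_Integration.integrable_bound[OF _ f])
  have "integrable lebesgue (\<lambda>p. \<bar>M\<bar> * indicator (S \<inter> cball 0 r) p :: real)"
    by (intro integrable_mult_right integrable_real_indicator)
      (use S in \<open>auto intro!: fmeasurableD2 simp: less_top[symmetric] lmeasurable_cball fmeasurable_Int_fmeasurable Int_commute[of S]\<close>)
  moreover have "(\<lambda>p. \<bar>M\<bar> * indicator (S \<inter> cball 0 r) p :: real)
      = (\<lambda>p. indicator S p *\<^sub>R (\<bar>M\<bar> * indicator (cball 0 r) p))"
    by (auto simp: indicator_def)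
  ultimately show "integrable (lebesgue_on S) (\<lambda>p. \<bar>M\<bar> * indicator (cball 0 r) p :: real)"
    using S by (subst integrable_restrict_space) auto
  show "AE p in lebesgue_on S. norm (f p) \<le> norm (\<bar>M\<bar> * indicator (cball 0 r) p :: real)"
    using bnd supp by eventually_elim (auto simp: indicator_def)
qed

lemma borel_measurable_lebesgue_on:
  "f \<in> borel_measurable borel \<Longrightarrow> f \<in> borel_measurable (lebesgue_on S)"
  by (simp add: measurable_completion measurable_restrict_space1)

abbreviation strip :: "real \<Rightarrow> (real \<times> real) set" where
  "strip T \<equiv> UNIV \<times> {0<..<T}"

lemma strip_measurable: "strip T \<in> sets borel"
  by (intro borel_open open_Times) auto

text \<open>
  The class of test functions in the definition of an entropy solution, with the constants of the
  support condition made explicit.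
\<close>

definition strip_testfun :: "real \<Rightarrow> real \<Rightarrow> real \<Rightarrow> (real \<times> real \<Rightarrow> real) \<Rightarrow> bool" where
  "strip_testfun T R T' \<phi> \<longleftrightarrow> smooth \<phi> \<and> T' < T \<and>
     (\<forall>y t. 0 \<le> t \<longrightarrow> t < T \<longrightarrow> R \<le> \<bar>y\<bar> \<or> T' \<le> t \<longrightarrow> \<phi> (y, t) = 0)"

lemma pd_eq_0_of_vanishing:
  assumes "open V" "p \<in> V" "\<And>q. q \<in> V \<Longrightarrow> \<phi> q = 0"
  shows "pd \<phi> v p = 0"
proof -
  have "(\<phi> has_derivative (\<lambda>_. 0)) (at p)"
    by (rule has_derivative_transform_within_open[OF has_derivative_const[of 0] assms(1,2)]) (simp add: assms(3))
  then show ?thesis by (rule pd_eq)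
qed

lemma directional_DERIV:
  fixes f :: "'a::real_normed_vector \<Rightarrow> real"
  assumes "f differentiable (at p)"
  shows "((\<lambda>s. f (p + s *\<^sub>R v)) has_real_derivative pd f v p) (at 0)"
proof -
  have d: "(f has_derivative (\<lambda>v. pd f v p)) (at (p + 0 *\<^sub>R v))"
    using has_derivative_pd[OF assms] by simp
  have "((\<lambda>s::real. p + s *\<^sub>R v) has_derivative (\<lambda>s. s *\<^sub>R v)) (at 0)"
    by (auto intro!: derivative_eq_intros)
  from has_derivative_compose[OF this d]
  have "((\<lambda>s. f (p + s *\<^sub>R v)) has_derivative (\<lambda>s. pd f (s *\<^sub>R v) p)) (at 0)" .
  moreover have "(\<lambda>s. pd f (s *\<^sub>R v) p) = (*) (pd f v p)"
  proof
    fix s show "pd f (s *\<^sub>R v) p = pd f v p * s"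
      using linear_scale[OF has_derivative_linear[OF d], of s v] by (simp add: mult.commute)
  qed
  ultimately show ?thesis by (simp only: has_field_derivative_def)
qed

text \<open>
  A test function may be arbitrary for times outside [0,T), so uniform bounds hold on the strip only;
  there compactness of the support gives them.
\<close>

lemma strip_testfun_bounds:
  assumes \<phi>: "strip_testfun T R T' \<phi>"
  obtains M where "\<And>p. p \<in> strip T \<Longrightarrow> \<bar>\<phi> p\<bar> \<le> M"
    and "\<And>p. p \<in> strip T \<Longrightarrow> \<bar>pd \<phi> (0, 1) p\<bar> \<le> M"
    and "\<And>p. p \<in> strip T \<Longrightarrow> \<bar>pd \<phi> (1, 0) p\<bar> \<le> M"
    and "\<And>p v. p \<in> strip T \<Longrightarrow> \<bar>R\<bar> + \<bar>T\<bar> < norm p \<Longrightarrow> \<phi> p = 0 \<and> pd \<phi> v p = 0"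
proof -
  let ?K = "{-\<bar>R\<bar>..\<bar>R\<bar>} \<times> {0..T}"
  have sm: "smooth \<phi>" using \<phi> by (simp add: strip_testfun_def)
  have b: "\<exists>M. \<forall>p\<in>?K. \<bar>f p\<bar> \<le> M" if "smooth f" for f :: "real \<times> real \<Rightarrow> real"
  proof -
    have "compact (f ` ?K)"
      by (intro compact_continuous_image smooth_continuous_on that compact_Times compact_Icc)
    then show ?thesis using compact_imp_bounded bounded_iff by (metis (no_types, lifting) image_eqI real_norm_def)
  qed
  obtain M1 where M1: "\<forall>p\<in>?K. \<bar>\<phi> p\<bar> \<le> M1" using b[OF sm] by blast
  obtain M2 where M2: "\<forall>p\<in>?K. \<bar>pd \<phi> (0, 1) p\<bar> \<le> M2"
    using b[OF smooth_pd[OF sm, of "(0, 1)"]] by (auto simp: Basis_prod_def)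
  obtain M3 where M3: "\<forall>p\<in>?K. \<bar>pd \<phi> (1, 0) p\<bar> \<le> M3"
    using b[OF smooth_pd[OF sm, of "(1, 0)"]] by (auto simp: Basis_prod_def)
  have out: "\<phi> p = 0 \<and> pd \<phi> v p = 0" if "p \<in> strip T" "\<bar>R\<bar> < \<bar>fst p\<bar>" for p v
  proof
    show "\<phi> p = 0" using that \<phi> by (cases p) (auto simp: strip_testfun_def)
    show "pd \<phi> v p = 0"
    proof (rule pd_eq_0_of_vanishing)
      show "open ({y. \<bar>R\<bar> < \<bar>y\<bar>} \<times> {0<..<T})"
        by (intro open_Times open_Collect_less continuous_intros open_greaterThanLessThan)
      show "p \<in> {y. \<bar>R\<bar> < \<bar>y\<bar>} \<times> {0<..<T}" using that by (cases p) auto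
      show "\<phi> q = 0" if "q \<in> {y. \<bar>R\<bar> < \<bar>y\<bar>} \<times> {0<..<T}" for q
        using that \<phi> by (cases q) (auto simp: strip_testfun_def)
    qed
  qed
  show ?thesis
  proof (rule that[of "\<bar>M1\<bar> + \<bar>M2\<bar> + \<bar>M3\<bar>"])
    fix p assume p: "p \<in> strip T"
    have in_K: "p \<in> ?K" if "\<not> \<bar>R\<bar> < \<bar>fst p\<bar>" using that p by (cases p) auto
    show "\<bar>\<phi> p\<bar> \<le> \<bar>M1\<bar> + \<bar>M2\<bar> + \<bar>M3\<bar>"
      using out[OF p] M1 in_K by (cases "\<bar>R\<bar> < \<bar>fst p\<bar>") force+
    show "\<bar>pd \<phi> (0, 1) p\<bar> \<le> \<bar>M1\<bar> + \<bar>M2\<bar> + \<bar>M3\<bar>"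
      using out[OF p] M2 in_K by (cases "\<bar>R\<bar> < \<bar>fst p\<bar>") force+
    show "\<bar>pd \<phi> (1, 0) p\<bar> \<le> \<bar>M1\<bar> + \<bar>M2\<bar> + \<bar>M3\<bar>"
      using out[OF p] M3 in_K by (cases "\<bar>R\<bar> < \<bar>fst p\<bar>") force+
    show "\<phi> p = 0 \<and> pd \<phi> v p = 0" if n: "\<bar>R\<bar> + \<bar>T\<bar> < norm p" for v
    proof (rule out[OF p])
      have "norm p \<le> \<bar>fst p\<bar> + \<bar>snd p\<bar>"
        using norm_Pair_le[of "fst p" "snd p"] by simp
      then show "\<bar>R\<bar> < \<bar>fst p\<bar>" using n p by (cases p) auto
    qed
  qed
qed

lemma smooth_borel: "smooth \<phi> \<Longrightarrow> \<phi> \<in> borel_measurable borel"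
  by (simp add: borel_measurable_continuous_onI smooth_continuous_on)

lemma pd_borel: "smooth \<phi> \<Longrightarrow> b \<in> Basis \<Longrightarrow> pd \<phi> b \<in> borel_measurable borel"
  by (simp add: smooth_borel smooth_pd)

lemma strip_integral_pd_space:
  assumes \<phi>: "strip_testfun T R T' \<phi>"
  shows "integral\<^sup>L (lebesgue_on (strip T)) (\<lambda>p. snd p * pd \<phi> (1, 0) p) = 0"
proof -
  obtain M where M: "\<And>p. p \<in> strip T \<Longrightarrow> \<bar>\<phi> p\<bar> \<le> M"
    "\<And>p. p \<in> strip T \<Longrightarrow> \<bar>pd \<phi> (1, 0) p\<bar> \<le> M"
    "\<And>p v. p \<in> strip T \<Longrightarrow> \<bar>R\<bar> + \<bar>T\<bar> < norm p \<Longrightarrow> \<phi> p = 0 \<and> pd \<phi> v p = 0"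
    by (rule strip_testfun_bounds[OF \<phi>]) blast
  have sm: "smooth \<phi>" using \<phi> by (simp add: strip_testfun_def)
  show ?thesis
  proof (rule integral_directional_derivative_eq_0(2)[where v = "(1, 0)" and W = "\<lambda>p. snd p * \<phi> p"
        and M = "\<bar>T\<bar> * \<bar>M\<bar>" and r = "\<bar>R\<bar> + \<bar>T\<bar>"])
    show "strip T \<in> sets borel" by (rule strip_measurable)
    show "(\<lambda>p. snd p * \<phi> p) \<in> borel_measurable borel"
      using smooth_borel[OF smooth_mult[OF smooth_snd sm]] .
    fix p :: "real \<times> real" assume p: "p \<in> strip T"
    show "p + s *\<^sub>R (1, 0) \<in> strip T" for s using p by (cases p) auto
    note directional_DERIV[OF smooth_differentiable[OF sm], of p "(1, 0)"]
    from DERIV_cmult[OF this, of "snd p"]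
    show "((\<lambda>s. snd (p + s *\<^sub>R (1, 0)) * \<phi> (p + s *\<^sub>R (1, 0))) has_real_derivative
        snd p * pd \<phi> (1, 0) p) (at 0)"
      by simp
    have s: "\<bar>snd p\<bar> \<le> \<bar>T\<bar>" using p by auto
    show "\<bar>snd p * pd \<phi> (1, 0) p\<bar> \<le> \<bar>T\<bar> * \<bar>M\<bar>" "\<bar>snd p * \<phi> p\<bar> \<le> \<bar>T\<bar> * \<bar>M\<bar>"
      unfolding abs_mult by (intro mult_mono s; use M[OF p] in force)+
    show "snd p * \<phi> p = 0" if "\<bar>R\<bar> + \<bar>T\<bar> < norm p" using M(3)[OF p that] by simp
  qed
qed

lemma pd_time_DERIV:
  assumes "smooth \<phi>"
  shows "((\<lambda>t. \<phi> (y, t)) has_real_derivative pd \<phi> (0, 1) (y, t)) (at t)"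
  using directional_DERIV[OF smooth_differentiable[OF assms], of "(y, t)" "(0, 1)"]
    DERIV_shift[of "\<lambda>t. \<phi> (y, t)" "pd \<phi> (0, 1) (y, t)" 0 t]
  by (simp add: add.commute)

text \<open>
  The fundamental theorem of calculus on every line parallel to the time axis; the upper boundary term
  vanishes by continuity, because the test function is 0 shortly before the time T.
\<close>

lemma strip_integral_pd_time:
  assumes \<phi>: "strip_testfun T R T' \<phi>" and T: "T > 0"
  shows "integral\<^sup>L (lebesgue_on (strip T)) (pd \<phi> (0, 1)) = - integral\<^sup>L lebesgue (\<lambda>y. \<phi> (y, 0))"
proof -
  obtain M where M: "\<And>p. p \<in> strip T \<Longrightarrow> \<bar>pd \<phi> (0, 1) p\<bar> \<le> M"
    "\<And>p v. p \<in> strip T \<Longrightarrow> \<bar>R\<bar> + \<bar>T\<bar> < norm p \<Longrightarrow> \<phi> p = 0 \<and> pd \<phi> v p = 0"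
    by (rule strip_testfun_bounds[OF \<phi>]) blast
  have sm: "smooth \<phi>" using \<phi> by (simp add: strip_testfun_def)
  have pm: "pd \<phi> (0, 1) \<in> borel_measurable borel"
    by (rule pd_borel[OF sm]) (auto simp: Basis_prod_def)
  have SL: "strip T \<in> sets lebesgue" using strip_measurable by simp
  let ?f = "\<lambda>p. indicator (strip T) p * pd \<phi> (0, 1) p"
  have fm: "?f \<in> borel_measurable lborel"
    using pm strip_measurable by measurable
  have "integrable (lebesgue_on (strip T)) (pd \<phi> (0, 1))"
    using M SL by (intro integrable_lebesgue_on_bounded_support[where M = M and r = "\<bar>R\<bar> + \<bar>T\<bar>"]
        borel_measurable_lebesgue_on pm AE_I2) auto
  then have fi: "integrable (lborel \<Otimes>\<^sub>M lborel) ?f"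
    using fm SL by (simp add: integrable_restrict_space integrable_completion lborel_prod)
  have inner: "integral\<^sup>L lborel (\<lambda>t. ?f (y, t)) = - \<phi> (y, 0)" for y
  proof -
    have "\<phi> (y, T) = 0"
    proof -
      have lim: "((\<lambda>t. \<phi> (y, t)) \<longlongrightarrow> \<phi> (y, T)) (at_left T)"
        using DERIV_isCont[OF pd_time_DERIV[OF sm], of T y] unfolding isCont_def
        by (rule tendsto_within_subset) simp
      have "\<forall>\<^sub>F t in at_left T. \<phi> (y, t) = 0"
        using \<phi> T by (auto simp: strip_testfun_def eventually_at_left_field intro!: exI[of _ "max 0 T'"])
      then have "((\<lambda>t. \<phi> (y, t)) \<longlongrightarrow> 0) (at_left T)" by (rule tendsto_eventually)
      with lim show ?thesis by (rule tendsto_unique[OF trivial_limit_at_left_real])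
    qed
    moreover have "(\<integral>t. pd \<phi> (0, 1) (y, t) * indicator {0..T} t \<partial>lborel) = \<phi> (y, T) - \<phi> (y, 0)"
    proof (rule integral_FTC_Icc_real)
      show "isCont (\<lambda>t. pd \<phi> (0, 1) (y, t)) t" for t
        using DERIV_isCont[OF pd_time_DERIV[OF smooth_pd[OF sm, of "(0, 1)"]]]
        by (auto simp: Basis_prod_def)
    qed (use T pd_time_DERIV[OF sm] in auto)
    moreover have "integral\<^sup>L lborel (\<lambda>t. ?f (y, t)) = (\<integral>t. pd \<phi> (0, 1) (y, t) * indicator {0..T} t \<partial>lborel)"
    proof (rule integral_cong_AE)
      have 1: "(\<lambda>t. pd \<phi> (0, 1) (y, t)) \<in> borel_measurable borel"
        using pm by measurable
      then show "(\<lambda>t. pd \<phi> (0, 1) (y, t) * indicator {0..T} t) \<in> borel_measurable lborel" by measurable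
      show "(\<lambda>t. ?f (y, t)) \<in> borel_measurable lborel"
        using 1 by (simp add: indicator_times)
      show "AE t in lborel. ?f (y, t) = pd \<phi> (0, 1) (y, t) * indicator {0..T} t"
        using AE_lborel_singleton[of 0] AE_lborel_singleton[of T]
        by eventually_elim (auto simp: indicator_def)
    qed
    ultimately show ?thesis by simp
  qed
  have "integral\<^sup>L (lebesgue_on (strip T)) (pd \<phi> (0, 1)) = integral\<^sup>L (lborel \<Otimes>\<^sub>M lborel) ?f"
    using fm SL by (simp add: integral_restrict_space integral_completion lborel_prod)
  also have "\<dots> = (\<integral>y. \<integral>t. ?f (y, t) \<partial>lborel \<partial>lborel)"
    by (rule lborel_pair.integral_fst'[OF fi, symmetric])
  also have "\<dots> = - integral\<^sup>L lborel (\<lambda>y. \<phi> (y, 0))" by (simp only: inner) simp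
  also have "integral\<^sup>L lborel (\<lambda>y. \<phi> (y, 0)) = integral\<^sup>L lebesgue (\<lambda>y. \<phi> (y, 0))"
  proof (rule integral_completion[symmetric])
    have "continuous_on UNIV (\<lambda>y. \<phi> (y, 0))"
      by (rule continuous_on_compose2[OF smooth_continuous_on[OF sm, of UNIV]]) (auto intro!: continuous_intros)
    then show "(\<lambda>y. \<phi> (y, 0)) \<in> borel_measurable lborel"
      by (simp add: borel_measurable_continuous_onI)
  qed
  finally show ?thesis .
qed


section \<open>One-sided bounds for entropy solutions\<close>

text \<open>
  The slope of the secant of the flux between u and k, in closed form; for u = k it is the derivative
  of the flux. Its monotonicity in both arguments is the convexity of the flux.
\<close>

definition chord :: "real \<Rightarrow> real \<Rightarrow> real \<Rightarrow> real \<Rightarrow> real \<Rightarrow> real" where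
  "chord rm rp lam u k = 1 - lam + lam * (rm * rp) / ((rm + rp - u) * (rm + rp - k))"

text \<open>
  In this form a is visibly concave, and differences of the flux can be factored.
\<close>

lemma afun_eq:
  assumes "rm + rp - r \<noteq> (0::real)"
  shows "afun rm rp r = r - rm * rp / (rm + rp - r)"
  using assms by (simp add: afun_def field_simps)

lemma flux_diff_chord:
  assumes "rm + rp - u \<noteq> 0" "rm + rp - k \<noteq> 0"
  shows "flux rm rp lam u - flux rm rp lam k = (u - k) * chord rm rp lam u k"
proof -
  define x y where "x = rm + rp - u" and "y = rm + rp - k"
  have "x \<noteq> 0" "y \<noteq> 0" using assms by (auto simp: x_def y_def)
  define q where "q = rm * rp / (x * y)"
  have 1: "rm * rp / x - rm * rp / y = (u - k) * q"
    using \<open>x \<noteq> 0\<close> \<open>y \<noteq> 0\<close> by (simp add: q_def x_def y_def field_simps)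
  have 2: "chord rm rp lam u k = 1 - lam + lam * q"
    by (simp add: chord_def q_def x_def y_def)
  have "flux rm rp lam u - flux rm rp lam k
      = (u - k) - lam * ((u - k) - (rm * rp / x - rm * rp / y))"
    using assms by (simp add: flux_def afun_eq x_def y_def algebra_simps)
  also have "\<dots> = (u - k) * chord rm rp lam u k"
    unfolding 1 2 by (simp add: algebra_simps)
  finally show ?thesis .
qed

lemma chord_mono:
  assumes "0 < rm" "0 \<le> lam" "u \<le> u'" "k \<le> k'" "u' \<le> rp" "k' \<le> rp" "0 < rp"
  shows "chord rm rp lam u k \<le> chord rm rp lam u' k'"
  using assms by (auto simp: chord_def intro!: divide_left_mono mult_mono mult_pos_pos)

lemma chord_nonneg:
  assumes "0 < rm" "0 \<le> lam" "lam \<le> 1" "u \<le> rp" "k \<le> rp" "0 < rp"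
  shows "0 \<le> chord rm rp lam u k"
  using assms by (auto simp: chord_def intro!: add_nonneg_nonneg divide_nonneg_nonneg mult_nonneg_nonneg)

lemma flux_borel: "flux rm rp lam \<in> borel_measurable borel"
  unfolding flux_def afun_def by measurable

lemma sgn_borel: "(sgn :: real \<Rightarrow> real) \<in> borel_measurable borel"
proof -
  have "(sgn :: real \<Rightarrow> real) = (\<lambda>x. if x = 0 then 0 else if 0 < x then 1 else - 1)"
    by (auto simp: fun_eq_iff sgn_if)
  then show ?thesis by simp
qed

text \<open>
  Adding the entropy inequalities for k and for an end point k' of [rm, rp] and subtracting the
  constant |k - k'|, which satisfies the equation exactly, produces twice the one-sided entropy
  inequality: for k' = rm the sum |u - k| + |u - rm| - (k - rm) is 2 (u - k)^+, and for k' = rp it is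
  2 (k - u)^+. The flux of a constant is arbitrary, which leaves d free.
\<close>

lemma entropy_inequality_two_constants:
  fixes u :: "real \<times> real \<Rightarrow> real" and d :: real
  assumes ent: "entropy_solution rm rp g lam T u" and T: "0 < T"
    and c: "0 < rm" "rm < rp" "0 \<le> lam" "lam \<le> 1"
    and k: "rm \<le> k" "k \<le> rp" "rm \<le> k'" "k' \<le> rp"
    and \<phi>: "strip_testfun T R T' \<phi>"
    and pos: "\<And>y t. 0 \<le> t \<Longrightarrow> t < T \<Longrightarrow> 0 \<le> \<phi> (y, t)"
    and init: "\<And>y. \<bar>rho0 rm rp y - k\<bar> * \<phi> (y, 0) = \<bar>k - k'\<bar> * \<phi> (y, 0)"
      "\<And>y. \<bar>rho0 rm rp y - k'\<bar> * \<phi> (y, 0) = 0"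
  defines "X \<equiv> \<lambda>p. (\<bar>u p - k\<bar> + \<bar>u p - k'\<bar> - \<bar>k - k'\<bar>) * pd \<phi> (0, 1) p
      + g * snd p * (sgn (u p - k) * (flux rm rp lam (u p) - flux rm rp lam k)
          + sgn (u p - k') * (flux rm rp lam (u p) - flux rm rp lam k') - d) * pd \<phi> (1, 0) p"
  shows "integrable (lebesgue_on (strip T)) X" and "0 \<le> integral\<^sup>L (lebesgue_on (strip T)) X"
proof -
  let ?M = "lebesgue_on (strip T)"
  define E where "E k = (\<lambda>p. \<bar>u p - k\<bar> * pd \<phi> (0, 1) p
      + g * snd p * sgn (u p - k) * (flux rm rp lam (u p) - flux rm rp lam k) * pd \<phi> (1, 0) p)" for k
  have sm: "smooth \<phi>" using \<phi> by (simp add: strip_testfun_def)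
  obtain M where M: "\<And>p. p \<in> strip T \<Longrightarrow> \<bar>pd \<phi> (0, 1) p\<bar> \<le> M"
    "\<And>p. p \<in> strip T \<Longrightarrow> \<bar>pd \<phi> (1, 0) p\<bar> \<le> M"
    "\<And>p v. p \<in> strip T \<Longrightarrow> \<bar>R\<bar> + \<bar>T\<bar> < norm p \<Longrightarrow> \<phi> p = 0 \<and> pd \<phi> v p = 0"
    by (rule strip_testfun_bounds[OF \<phi>]) blast
  have M0: "0 \<le> M" using M(1)[of "(0, T / 2)"] T by auto
  have S: "strip T \<in> sets lebesgue" using strip_measurable by simp
  have b: "(0, 1) \<in> (Basis :: (real \<times> real) set)" "(1, 0) \<in> (Basis :: (real \<times> real) set)"
    by (auto simp: Basis_prod_def)
  note pm[measurable] = borel_measurable_lebesgue_on[OF pd_borel[OF sm b(1)], of "strip T"]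
    borel_measurable_lebesgue_on[OF pd_borel[OF sm b(2)], of "strip T"]
  have sndm[measurable]: "snd \<in> borel_measurable ?M"
    by (intro borel_measurable_lebesgue_on borel_measurable_continuous_onI continuous_on_snd continuous_on_id)
  have um[measurable]: "u \<in> borel_measurable ?M"
    and u_rng: "AE p in ?M. rm \<le> u p \<and> u p \<le> rp"
    using ent by (auto simp: entropy_solution_def)
  note flux_borel[measurable] sgn_borel[measurable]
  have ineq: "0 \<le> integral\<^sup>L ?M (E k) + integral\<^sup>L lebesgue (\<lambda>y. \<bar>rho0 rm rp y - k\<bar> * \<phi> (y, 0))"
    if "rm \<le> k" "k \<le> rp" for k
  proof -
    have "\<exists>R. \<exists>T'<T. \<forall>y t. 0 \<le> t \<longrightarrow> t < T \<longrightarrow> R \<le> \<bar>y\<bar> \<or> T' \<le> t \<longrightarrow> \<phi> (y, t) = 0"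
      using \<phi> unfolding strip_testfun_def by blast
    with ent that sm pos show ?thesis unfolding entropy_solution_def E_def by blast
  qed
  have Em: "E k \<in> borel_measurable ?M" for k unfolding E_def by measurable
  have Ei: "integrable ?M (E k)" if k: "rm \<le> k" "k \<le> rp" for k
  proof (rule integrable_lebesgue_on_bounded_support[OF S Em])
    let ?c = "chord rm rp lam rp rp"
    have c0: "0 \<le> ?c" using c by (intro chord_nonneg) auto
    have "AE p in ?M. p \<in> strip T" using AE_space[of ?M] S by simp
    then show "AE p in ?M. \<bar>E k p\<bar> \<le> (rp - rm) * M + \<bar>g\<bar> * T * 1 * ((rp - rm) * ?c) * M"
      using u_rng
    proof eventually_elim
      fix p assume p: "p \<in> strip T" and up: "rm \<le> u p \<and> u p \<le> rp"
      have 1: "\<bar>u p - k\<bar> \<le> rp - rm" using up k by auto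
      have "\<bar>chord rm rp lam (u p) k\<bar> \<le> ?c"
        using chord_nonneg[of rm lam "u p" rp k] chord_mono[of rm lam "u p" rp k rp rp] c up k by auto
      then have 2: "\<bar>flux rm rp lam (u p) - flux rm rp lam k\<bar> \<le> (rp - rm) * ?c"
        using 1 c up k by (subst flux_diff_chord) (auto simp: abs_mult intro!: mult_mono)
      have 3: "\<bar>snd p\<bar> \<le> T" using p by auto
      have 4: "\<bar>sgn (u p - k)\<bar> \<le> 1" by (simp add: sgn_if)
      have "\<bar>E k p\<bar> \<le> \<bar>u p - k\<bar> * \<bar>pd \<phi> (0, 1) p\<bar>
          + \<bar>g\<bar> * \<bar>snd p\<bar> * \<bar>sgn (u p - k)\<bar> * \<bar>flux rm rp lam (u p) - flux rm rp lam k\<bar> * \<bar>pd \<phi> (1, 0) p\<bar>"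
        unfolding E_def by (rule order_trans[OF abs_triangle_ineq]) (simp add: abs_mult)
      also have "\<dots> \<le> (rp - rm) * M + \<bar>g\<bar> * T * 1 * ((rp - rm) * ?c) * M"
        using 1 2 3 4 M(1,2)[OF p] M0 c0 c T
        by (intro add_mono mult_mono mult_nonneg_nonneg) auto
      finally show "\<bar>E k p\<bar> \<le> (rp - rm) * M + \<bar>g\<bar> * T * 1 * ((rp - rm) * ?c) * M" .
    qed
    show "AE p in ?M. \<bar>R\<bar> + \<bar>T\<bar> < norm p \<longrightarrow> E k p = 0"
      using S M(3) by (intro AE_I2) (auto simp: E_def)
  qed
  have ti: "integrable ?M (pd \<phi> (0, 1))"
    using M S by (intro integrable_lebesgue_on_bounded_support[where M = M and r = "\<bar>R\<bar> + \<bar>T\<bar>"]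
        pm AE_I2) auto
  have yi: "integrable ?M (\<lambda>p. snd p * pd \<phi> (1, 0) p)"
  proof (intro integrable_lebesgue_on_bounded_support[OF S, where M = "T * M" and r = "\<bar>R\<bar> + \<bar>T\<bar>"] AE_I2)
    fix p assume "p \<in> space ?M"
    then have p: "p \<in> strip T" using S by simp
    show "\<bar>snd p * pd \<phi> (1, 0) p\<bar> \<le> T * M"
      unfolding abs_mult using p M(2)[OF p] T by (intro mult_mono) auto
    show "\<bar>R\<bar> + \<bar>T\<bar> < norm p \<longrightarrow> snd p * pd \<phi> (1, 0) p = 0" using M(3)[OF p] by simp
  qed measurable
  have X_eq: "X = (\<lambda>p. E k p + E k' p - \<bar>k - k'\<bar> * pd \<phi> (0, 1) p - g * d * (snd p * pd \<phi> (1, 0) p))"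
    by (simp add: X_def E_def fun_eq_iff algebra_simps)
  show "integrable ?M X" unfolding X_eq
    by (intro Bochner_Integration.integrable_diff Bochner_Integration.integrable_add
        integrable_mult_right Ei ti yi k)
  have "integral\<^sup>L ?M X = integral\<^sup>L ?M (E k) + integral\<^sup>L ?M (E k')
      - \<bar>k - k'\<bar> * integral\<^sup>L ?M (pd \<phi> (0, 1)) - g * d * integral\<^sup>L ?M (\<lambda>p. snd p * pd \<phi> (1, 0) p)"
    unfolding X_eq using Ei[of k] Ei[of k'] k ti yi by simp
  also have "\<dots> = integral\<^sup>L ?M (E k) + integral\<^sup>L ?M (E k')
      + \<bar>k - k'\<bar> * integral\<^sup>L lebesgue (\<lambda>y. \<phi> (y, 0))"
    using strip_integral_pd_time[OF \<phi> T] strip_integral_pd_space[OF \<phi>] by simp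
  also have "\<dots> = (integral\<^sup>L ?M (E k) + integral\<^sup>L lebesgue (\<lambda>y. \<bar>rho0 rm rp y - k\<bar> * \<phi> (y, 0)))
     + (integral\<^sup>L ?M (E k') + integral\<^sup>L lebesgue (\<lambda>y. \<bar>rho0 rm rp y - k'\<bar> * \<phi> (y, 0)))"
    by (simp add: init)
  also have "\<dots> \<ge> 0" using ineq[of k] ineq[of k'] k by simp
  finally show "0 \<le> integral\<^sup>L ?M X" .
qed

lemma flat0_derivative: "(flat 0 has_real_derivative flat 2 x) (at x)"
  using flat_has_derivative[of 0 x] by (simp add: numeral_2_eq_2)

text \<open>
  For s = 1 the statement bounds u from above to the left of the ray through the origin with speed
  F'(k), for s = -1 from below to the right of it. The quantity (s (u - k))^+ vanishes there
  initially. It cannot enter through the ray, since by convexity its speed exceeds F'(k) when u > k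
  and falls below F'(k) when u < k; it cannot enter through the far end of the region, which for s = 1
  moves with the maximal speed F'(rp), and for s = -1 is at rest, all speeds being positive. The
  strictly decreasing cutoff in time makes the remaining term strictly negative wherever the bound
  fails.
\<close>

lemma entropy_solution_one_side:
  fixes u :: "real \<times> real \<Rightarrow> real"
  assumes ent: "entropy_solution rm rp g lam T u" and T: "0 < T" and g: "0 < g"
    and c: "0 < rm" "rm < rp" "0 \<le> lam" "lam \<le> 1"
    and k: "rm \<le> k" "k \<le> rp" and s: "s = 1 \<or> s = - 1" and T': "T' < T"
  shows "AE p in lebesgue_on (strip T).
    0 < s * (chord rm rp lam k k * g / 2 * (snd p)\<^sup>2 - fst p) \<longrightarrow>
    0 < R + s * fst p - (chord rm rp lam rp rp * g / 2) * (snd p)\<^sup>2 \<longrightarrow> snd p < T' \<longrightarrow>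
    s * (u p - k) \<le> 0"
proof -
  let ?M = "lebesgue_on (strip T)"
  define a where "a = chord rm rp lam k k * g / 2"
  \<comment> \<open>The far cutoff moves with the maximal speed for s = 1 and stands still for s = -1.\<close>
  define b where "b = (if s = 1 then chord rm rp lam rp rp * g / 2 else 0)"
  define k' where "k' = (if s = 1 then rm else rp)"
  \<comment> \<open>The flux that belongs to the constant |k - k'|.\<close>
  define d where "d = s * (flux rm rp lam k - flux rm rp lam k')"
  define \<alpha> where "\<alpha> = (\<lambda>p::real \<times> real. s * (a * (snd p * snd p) - fst p))"
  define \<beta> where "\<beta> = (\<lambda>p::real \<times> real. R + s * (fst p - b * (snd p * snd p)))"
  define \<theta> where "\<theta> = (\<lambda>p::real \<times> real. T' - snd p)"
  define \<phi> where "\<phi> = (\<lambda>p. flat 0 (\<alpha> p) * flat 0 (\<beta> p) * flat 0 (\<theta> p))"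
  have S: "strip T \<in> sets lebesgue" using strip_measurable by simp
  have sm: "smooth \<phi>" unfolding \<phi>_def \<alpha>_def \<beta>_def \<theta>_def
    by (intro smooth_mult smooth_flat smooth_diff smooth_add smooth_const smooth_fst smooth_snd)
  have der: "(\<phi> has_derivative (\<lambda>v.
      flat 2 (\<alpha> p) * (s * (a * (2 * snd p * snd v) - fst v)) * flat 0 (\<beta> p) * flat 0 (\<theta> p)
      + flat 0 (\<alpha> p) * flat 2 (\<beta> p) * (s * (fst v - b * (2 * snd p * snd v))) * flat 0 (\<theta> p)
      - flat 0 (\<alpha> p) * flat 0 (\<beta> p) * flat 2 (\<theta> p) * snd v)) (at p)" for p
  proof -
    have "(\<alpha> has_derivative (\<lambda>v. s * (a * (2 * snd p * snd v) - fst v))) (at p)"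
      unfolding \<alpha>_def by (auto intro!: derivative_eq_intros simp: algebra_simps)
    note A = DERIV_compose_FDERIV[OF flat0_derivative this]
    have "(\<beta> has_derivative (\<lambda>v. s * (fst v - b * (2 * snd p * snd v)))) (at p)"
      unfolding \<beta>_def by (auto intro!: derivative_eq_intros simp: algebra_simps)
    note B = DERIV_compose_FDERIV[OF flat0_derivative this]
    have "(\<theta> has_derivative (\<lambda>v. - snd v)) (at p)"
      unfolding \<theta>_def by (auto intro!: derivative_eq_intros)
    note C = DERIV_compose_FDERIV[OF flat0_derivative this]
    show ?thesis unfolding \<phi>_def
      by (rule has_derivative_eq_rhs[OF has_derivative_mult[OF has_derivative_mult[OF A B] C]])
        (simp add: fun_eq_iff algebra_simps)
  qed
  have pdt: "pd \<phi> (0, 1) p =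
      flat 2 (\<alpha> p) * (s * (a * (2 * snd p))) * flat 0 (\<beta> p) * flat 0 (\<theta> p)
      - flat 0 (\<alpha> p) * flat 2 (\<beta> p) * (s * (b * (2 * snd p))) * flat 0 (\<theta> p)
      - flat 0 (\<alpha> p) * flat 0 (\<beta> p) * flat 2 (\<theta> p)" for p
    by (simp add: pd_eq[OF der])
  have pdy: "pd \<phi> (1, 0) p =
      - (flat 2 (\<alpha> p) * s * flat 0 (\<beta> p) * flat 0 (\<theta> p))
      + flat 0 (\<alpha> p) * flat 2 (\<beta> p) * s * flat 0 (\<theta> p)" for p
    by (simp add: pd_eq[OF der])
  have ab: "0 \<le> a" "0 \<le> b" using c k g by (auto simp: a_def b_def chord_nonneg)
  have test: "strip_testfun T (\<bar>R\<bar> + a * T\<^sup>2 + b * T\<^sup>2) T' \<phi>"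
    unfolding strip_testfun_def
  proof (intro conjI allI impI sm T')
    fix y t assume t: "0 \<le> t" "t < T" and o: "\<bar>R\<bar> + a * T\<^sup>2 + b * T\<^sup>2 \<le> \<bar>y\<bar> \<or> T' \<le> t"
    have tt: "0 \<le> t * t" "t * t \<le> T\<^sup>2" using t by (auto simp: power2_eq_square intro!: mult_mono)
    have at: "0 \<le> a * (t * t)" "a * (t * t) \<le> a * T\<^sup>2" "0 \<le> b * (t * t)" "b * (t * t) \<le> b * T\<^sup>2"
      using tt ab by (auto intro!: mult_left_mono)
    have "\<alpha> (y, t) \<le> 0 \<or> \<beta> (y, t) \<le> 0 \<or> \<theta> (y, t) \<le> 0"
      using o at s by (auto simp: \<alpha>_def \<beta>_def \<theta>_def abs_if split: if_splits)
    then show "\<phi> (y, t) = 0" by (auto simp: \<phi>_def flat_eq_0)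
  qed
  have pos: "0 \<le> \<phi> (y, t)" for y t by (simp add: \<phi>_def flat_nonneg)
  have k': "rm \<le> k'" "k' \<le> rp" using c by (auto simp: k'_def)
  have init: "\<bar>rho0 rm rp y - k\<bar> * \<phi> (y, 0) = \<bar>k - k'\<bar> * \<phi> (y, 0)"
    "\<bar>rho0 rm rp y - k'\<bar> * \<phi> (y, 0) = 0" for y
  proof -
    have "s * y < 0 \<or> \<phi> (y, 0) = 0"
      by (auto simp: \<phi>_def \<alpha>_def flat_eq_0 not_less)
    then show "\<bar>rho0 rm rp y - k\<bar> * \<phi> (y, 0) = \<bar>k - k'\<bar> * \<phi> (y, 0)"
      "\<bar>rho0 rm rp y - k'\<bar> * \<phi> (y, 0) = 0"
      using s k by (auto simp: rho0_def k'_def)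
  qed
  define X where "X = (\<lambda>p. (\<bar>u p - k\<bar> + \<bar>u p - k'\<bar> - \<bar>k - k'\<bar>) * pd \<phi> (0, 1) p
      + g * snd p * (sgn (u p - k) * (flux rm rp lam (u p) - flux rm rp lam k)
          + sgn (u p - k') * (flux rm rp lam (u p) - flux rm rp lam k') - d) * pd \<phi> (1, 0) p)"
  note XX = entropy_inequality_two_constants[OF ent T c k k' test pos init, of d, folded X_def]
  have u_rng: "AE p in ?M. rm \<le> u p \<and> u p \<le> rp"
    using ent by (auto simp: entropy_solution_def)
  have strip: "AE p in ?M. p \<in> strip T" using AE_space[of ?M] S by simp
  \<comment> \<open>Off the set where the bound fails the two entropies and the constant cancel.\<close>
  have zero: "X p = 0" if up: "rm \<le> u p \<and> u p \<le> rp" and sk: "s * (u p - k) \<le> 0" for p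
    using s sk up k c
    by (auto simp: X_def d_def k'_def sgn_if abs_if)
  have neg: "X p \<le> - 2 * \<bar>u p - k\<bar> * (flat 0 (\<alpha> p) * flat 0 (\<beta> p) * flat 2 (\<theta> p))"
    if p: "p \<in> strip T" and up: "rm \<le> u p \<and> u p \<le> rp" and sk: "0 < s * (u p - k)" for p
  proof -
    let ?c = "chord rm rp lam (u p) k"
    have t: "0 < snd p" using p by auto
    have X: "X p = 2 * \<bar>u p - k\<bar> * (pd \<phi> (0, 1) p + g * snd p * ?c * pd \<phi> (1, 0) p)"
    proof -
      have f: "flux rm rp lam (u p) - flux rm rp lam k = (u p - k) * ?c"
        using c up k by (intro flux_diff_chord) auto
      have 1: "\<bar>u p - k\<bar> + \<bar>u p - k'\<bar> - \<bar>k - k'\<bar> = 2 * \<bar>u p - k\<bar>"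
        using s sk up k c by (auto simp: k'_def)
      have 2: "sgn (u p - k) = s" using s sk by (auto simp: sgn_if)
      have 3: "sgn (u p - k') = s \<or> u p = k'" using s sk up k c by (auto simp: sgn_if k'_def)
      have "sgn (u p - k) * (flux rm rp lam (u p) - flux rm rp lam k)
          + sgn (u p - k') * (flux rm rp lam (u p) - flux rm rp lam k') - d
        = 2 * s * (flux rm rp lam (u p) - flux rm rp lam k)"
        using 2 3 s sk up k c by (auto simp: d_def algebra_simps k'_def)
      also have "\<dots> = 2 * \<bar>u p - k\<bar> * ?c" using s sk by (auto simp: f)
      finally have 4: "sgn (u p - k) * (flux rm rp lam (u p) - flux rm rp lam k)
          + sgn (u p - k') * (flux rm rp lam (u p) - flux rm rp lam k') - d = 2 * \<bar>u p - k\<bar> * ?c" .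
      show ?thesis unfolding X_def 1 4 by (simp add: algebra_simps)
    qed
    \<comment> \<open>Convexity of the flux: nothing enters through the ray.\<close>
    have ca: "s * (2 * a - g * ?c) \<le> 0"
    proof -
      have "s * chord rm rp lam k k \<le> s * ?c"
        using s sk up k c chord_mono[of rm lam k "u p" k k rp] chord_mono[of rm lam "u p" k k k rp] by auto
      then have "g * (s * chord rm rp lam k k) \<le> g * (s * ?c)" by (rule mult_left_mono) (use g in simp)
      then show ?thesis by (simp add: a_def algebra_simps)
    qed
    \<comment> \<open>Nothing enters through the far end.\<close>
    have cb: "s * (g * ?c - 2 * b) \<le> 0"
      using s g up k c chord_mono[of rm lam "u p" rp k rp rp] chord_nonneg[of rm lam "u p" rp k]
      by (auto simp: b_def)
    have "pd \<phi> (0, 1) p + g * snd p * ?c * pd \<phi> (1, 0) p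
      = (flat 2 (\<alpha> p) * flat 0 (\<beta> p) * flat 0 (\<theta> p) * snd p) * (s * (2 * a - g * ?c))
       + (flat 0 (\<alpha> p) * flat 2 (\<beta> p) * flat 0 (\<theta> p) * snd p) * (s * (g * ?c - 2 * b))
       - flat 0 (\<alpha> p) * flat 0 (\<beta> p) * flat 2 (\<theta> p)"
      unfolding pdt pdy by (simp add: algebra_simps)
    also have "\<dots> \<le> 0 + 0 - flat 0 (\<alpha> p) * flat 0 (\<beta> p) * flat 2 (\<theta> p)"
      using t by (intro add_mono diff_mono mult_nonneg_nonpos[OF _ ca] mult_nonneg_nonpos[OF _ cb]
          mult_nonneg_nonneg flat_nonneg) auto
    finally have "2 * \<bar>u p - k\<bar> * (pd \<phi> (0, 1) p + g * snd p * ?c * pd \<phi> (1, 0) p)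
      \<le> 2 * \<bar>u p - k\<bar> * (- (flat 0 (\<alpha> p) * flat 0 (\<beta> p) * flat 2 (\<theta> p)))"
      by (intro mult_left_mono) auto
    then show ?thesis by (simp add: X)
  qed
  have Xle: "AE p in ?M. X p \<le> 0"
    using strip u_rng
  proof eventually_elim
    fix p assume p: "p \<in> strip T" "rm \<le> u p \<and> u p \<le> rp"
    show "X p \<le> 0"
    proof (cases "s * (u p - k) \<le> 0")
      case True then show ?thesis using zero p by simp
    next
      case False
      then have "X p \<le> - 2 * \<bar>u p - k\<bar> * (flat 0 (\<alpha> p) * flat 0 (\<beta> p) * flat 2 (\<theta> p))"
        using neg p by simp
      also have "\<dots> \<le> 0" by (simp add: flat_nonneg)
      finally show ?thesis .
    qed
  qed
  have "integral\<^sup>L ?M (\<lambda>p. - X p) = 0"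
  proof -
    have "0 \<le> integral\<^sup>L ?M (\<lambda>p. - X p)" by (rule integral_nonneg_AE) (use Xle in auto)
    then show ?thesis using XX by simp
  qed
  then have "AE p in ?M. - X p = 0"
    using integral_nonneg_eq_0_iff_AE[of ?M "\<lambda>p. - X p"] XX(1) Xle by auto
  then show ?thesis using strip u_rng
  proof eventually_elim
    fix p assume X: "- X p = 0" and p: "p \<in> strip T" and up: "rm \<le> u p \<and> u p \<le> rp"
    show "0 < s * (chord rm rp lam k k * g / 2 * (snd p)\<^sup>2 - fst p) \<longrightarrow>
      0 < R + s * fst p - (chord rm rp lam rp rp * g / 2) * (snd p)\<^sup>2 \<longrightarrow> snd p < T' \<longrightarrow>
      s * (u p - k) \<le> 0"
    proof (intro impI, rule ccontr)
      assume 1: "0 < s * (chord rm rp lam k k * g / 2 * (snd p)\<^sup>2 - fst p)"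
        and 2: "0 < R + s * fst p - (chord rm rp lam rp rp * g / 2) * (snd p)\<^sup>2"
        and 3: "snd p < T'" and 4: "\<not> s * (u p - k) \<le> 0"
      have "0 < \<alpha> p" using 1 by (simp add: \<alpha>_def a_def power2_eq_square)
      moreover have "0 < \<beta> p"
      proof -
        have "s * b \<le> chord rm rp lam rp rp * g / 2"
          using s c g chord_nonneg[of rm lam rp rp rp] by (auto simp: b_def)
        then have "s * b * (snd p)\<^sup>2 \<le> chord rm rp lam rp rp * g / 2 * (snd p)\<^sup>2"
          by (intro mult_right_mono) auto
        then show ?thesis using 2 by (simp add: \<beta>_def power2_eq_square algebra_simps)
      qed
      moreover have "0 < \<theta> p" using 3 by (simp add: \<theta>_def)
      moreover have "0 < \<bar>u p - k\<bar>" using 4 by auto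
      ultimately have "0 < 2 * \<bar>u p - k\<bar> * (flat 0 (\<alpha> p) * flat 0 (\<beta> p) * flat 2 (\<theta> p))"
        by (intro mult_pos_pos flat_pos) auto
      then show False using neg[OF p up] 4 X by auto
    qed
  qed
qed


section \<open>The entropy solution is a rarefaction wave\<close>

text \<open>
  The inverse of the derivative of the flux, extended by constants: F'(r) = 1 - lam + lam rm rp / (rm
  + rp - r)^2.
\<close>

definition fan :: "real \<Rightarrow> real \<Rightarrow> real \<Rightarrow> real \<Rightarrow> real" where
  "fan rm rp lam \<xi> =
     (if \<xi> \<le> chord rm rp lam rm rm then rm else if chord rm rp lam rp rp \<le> \<xi> then rp
      else rm + rp - sqrt (lam * rm * rp / (\<xi> - (1 - lam))))"

lemma chord_diag: "chord rm rp lam k k = 1 - lam + lam * rm * rp / (rm + rp - k)\<^sup>2"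
  by (simp add: chord_def power2_eq_square)

lemma chord_diag_le_iff:
  assumes "0 < rm" "rm < rp" "0 < lam" "k \<le> rp" "1 - lam < \<xi>"
  shows "\<xi> \<le> chord rm rp lam k k \<longleftrightarrow> rm + rp - k \<le> sqrt (lam * rm * rp / (\<xi> - (1 - lam)))"
    and "chord rm rp lam k k \<le> \<xi> \<longleftrightarrow> sqrt (lam * rm * rp / (\<xi> - (1 - lam))) \<le> rm + rp - k"
proof -
  define x where "x = \<xi> - (1 - lam)"
  define K where "K = lam * rm * rp"
  define y where "y = rm + rp - k"
  have p: "0 < x" "0 < K" "0 < y" using assms by (auto simp: x_def K_def y_def)
  have "\<xi> \<le> chord rm rp lam k k \<longleftrightarrow> x \<le> K / y\<^sup>2"
    by (auto simp: chord_diag x_def K_def y_def)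
  also have "\<dots> \<longleftrightarrow> y\<^sup>2 \<le> K / x" using p by (simp add: field_simps)
  also have "\<dots> \<longleftrightarrow> y \<le> sqrt (K / x)" using real_sqrt_le_iff[of "y\<^sup>2" "K / x"] p by simp
  finally show "\<xi> \<le> chord rm rp lam k k \<longleftrightarrow> rm + rp - k \<le> sqrt (lam * rm * rp / (\<xi> - (1 - lam)))"
    by (simp add: x_def K_def y_def)
  have "chord rm rp lam k k \<le> \<xi> \<longleftrightarrow> K / y\<^sup>2 \<le> x"
    by (auto simp: chord_diag x_def K_def y_def)
  also have "\<dots> \<longleftrightarrow> K / x \<le> y\<^sup>2" using p by (simp add: field_simps)
  also have "\<dots> \<longleftrightarrow> sqrt (K / x) \<le> y" using real_sqrt_le_iff[of "K / x" "y\<^sup>2"] p by simp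
  finally show "chord rm rp lam k k \<le> \<xi> \<longleftrightarrow> sqrt (lam * rm * rp / (\<xi> - (1 - lam))) \<le> rm + rp - k"
    by (simp add: x_def K_def y_def)
qed

definition prof :: "real \<Rightarrow> real \<Rightarrow> real \<Rightarrow> real \<Rightarrow> real" where
  "prof rm rp lam \<xi> = (rp - fan rm rp lam \<xi>) * (fan rm rp lam \<xi> - rm)"

text \<open>
  The bounded factor in the derivative of the square of \<open>prof\<close>. Inside the wave s = rm +
  rp - \<open>fan\<close> equals sqrt (lam rm rp / (\<xi> - (1 - lam))), hence ds/d\<xi> = - s^3 / (2
  lam rm rp).
\<close>

definition prof_slope :: "real \<Rightarrow> real \<Rightarrow> real \<Rightarrow> real \<Rightarrow> real" where
  "prof_slope rm rp lam \<xi> =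
    (rm + rp - 2 * fan rm rp lam \<xi>) * (rm + rp - fan rm rp lam \<xi>) ^ 3 / (lam * rm * rp)"

context
  fixes rm rp lam :: real
  assumes c: "0 < rm" "rm < rp" "0 < lam"
begin

lemma chord_gt: "k \<le> rp \<Longrightarrow> 1 - lam < chord rm rp lam k k"
  using c by (simp add: chord_diag)

lemma chord_diag_strict_mono:
  assumes "k < k'" "k' \<le> rp"
  shows "chord rm rp lam k k < chord rm rp lam k' k'"
  unfolding chord_diag using c assms
  by (auto intro!: divide_strict_left_mono power_strict_mono mult_pos_pos zero_less_power)

lemma fan_range: "rm \<le> fan rm rp lam \<xi>" "fan rm rp lam \<xi> \<le> rp"
proof -
  have "rm \<le> fan rm rp lam \<xi> \<and> fan rm rp lam \<xi> \<le> rp"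
  proof (cases "\<xi> \<le> chord rm rp lam rm rm \<or> chord rm rp lam rp rp \<le> \<xi>")
    case True then show ?thesis using c by (auto simp: fan_def)
  next
    case False
    then have "1 - lam < \<xi>" using chord_gt[of rm] c by auto
    with False show ?thesis
      using c chord_diag_le_iff[of rm rp lam rm \<xi>] chord_diag_le_iff[of rm rp lam rp \<xi>]
      by (auto simp: fan_def)
  qed
  then show "rm \<le> fan rm rp lam \<xi>" "fan rm rp lam \<xi> \<le> rp" by auto
qed

lemma fan_less_imp: 
  assumes "k \<le> rp" "fan rm rp lam \<xi> < k" shows "\<xi> < chord rm rp lam k k"
proof (cases "\<xi> \<le> chord rm rp lam rm rm")
  case True
  then have "rm < k" using assms by (simp add: fan_def)
  then show ?thesis using True chord_diag_strict_mono[of rm k] c assms by auto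
next
  case False
  then have "1 - lam < \<xi>" using chord_gt[of rm] c by auto
  then show ?thesis using False assms c chord_diag_le_iff(2)[of rm rp lam k \<xi>]
    by (auto simp: fan_def split: if_splits)
qed

lemma less_fan_imp: 
  assumes "rm \<le> k" "k < fan rm rp lam \<xi>" shows "chord rm rp lam k k < \<xi>"
proof (cases "chord rm rp lam rp rp \<le> \<xi>")
  case True
  have "k < rp" using assms fan_range(2)[of \<xi>] by linarith
  then show ?thesis using True chord_diag_strict_mono[of k rp] by auto
next
  case False
  then have m: "chord rm rp lam rm rm < \<xi>" using assms by (auto simp: fan_def split: if_splits)
  then have "1 - lam < \<xi>" using chord_gt[of rm] c by auto
  moreover have "k \<le> rp" using assms fan_range(2)[of \<xi>] by linarith
  ultimately show ?thesis using False m assms c chord_diag_le_iff(1)[of rm rp lam k \<xi>]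
    by (auto simp: fan_def split: if_splits)
qed

lemma fan_borel: "fan rm rp lam \<in> borel_measurable borel"
  unfolding fan_def by measurable

lemma prof_nonneg: "0 \<le> prof rm rp lam \<xi>" and prof_le: "prof rm rp lam \<xi> \<le> rp * rp"
proof -
  show "0 \<le> prof rm rp lam \<xi>" using fan_range[of \<xi>] by (simp add: prof_def)
  show "prof rm rp lam \<xi> \<le> rp * rp" unfolding prof_def using fan_range[of \<xi>] c by (intro mult_mono) auto
qed

lemma prof_slope_le: "\<bar>prof_slope rm rp lam \<xi>\<bar> \<le> rp * rp ^ 3 / (lam * rm * rp)"
proof -
  have "\<bar>rm + rp - 2 * fan rm rp lam \<xi>\<bar> \<le> rp" "\<bar>rm + rp - fan rm rp lam \<xi>\<bar> \<le> rp"
    using fan_range[of \<xi>] c by auto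
  then have "\<bar>rm + rp - 2 * fan rm rp lam \<xi>\<bar> * \<bar>rm + rp - fan rm rp lam \<xi>\<bar> ^ 3 \<le> rp * rp ^ 3"
    using c by (intro mult_mono power_mono) auto
  moreover have "\<bar>prof_slope rm rp lam \<xi>\<bar>
      = \<bar>rm + rp - 2 * fan rm rp lam \<xi>\<bar> * \<bar>rm + rp - fan rm rp lam \<xi>\<bar> ^ 3 / (lam * rm * rp)"
    using c by (simp add: prof_slope_def abs_mult power_abs)
  ultimately show ?thesis using c by (simp only: divide_right_mono mult_nonneg_nonneg less_imp_le)
qed

lemma prof_eq_0_outside:
  "\<xi> \<le> chord rm rp lam rm rm \<Longrightarrow> prof rm rp lam \<xi> = 0"
  "chord rm rp lam rp rp \<le> \<xi> \<Longrightarrow> prof rm rp lam \<xi> = 0"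
  using chord_diag_strict_mono[of rm rp] c by (auto simp: prof_def fan_def)

lemma max_sq_DERIV: "((\<lambda>x::real. (max 0 x)\<^sup>2) has_real_derivative 2 * max 0 x) (at x)"
proof -
  consider "x > 0" | "x < 0" | "x = 0" by linarith
  then show ?thesis
  proof cases
    case 1
    have "((\<lambda>x. x\<^sup>2) has_real_derivative 2 * max 0 x) (at x)"
      using 1 by (auto intro!: derivative_eq_intros)
    then show ?thesis
      by (rule has_field_derivative_transform_within_open[where S = "{0<..}"]) (use 1 in auto)
  next
    case 2
    have "((\<lambda>x. 0) has_real_derivative 2 * max 0 x) (at x)"
      using 2 by auto
    then show ?thesis
      by (rule has_field_derivative_transform_within_open[where S = "{..<0}"]) (use 2 in auto)
  next
    case 3
    have "((\<lambda>h::real. (max 0 h)\<^sup>2 / h) \<longlongrightarrow> 0) (at 0)"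
    proof (rule Lim_null_comparison)
      show "\<forall>\<^sub>F h in at 0. norm ((max 0 h)\<^sup>2 / h) \<le> \<bar>h::real\<bar>"
        by (intro always_eventually) (auto simp: max_def power2_eq_square)
      show "((\<lambda>h::real. \<bar>h\<bar>) \<longlongrightarrow> 0) (at 0)" by (auto intro!: tendsto_eq_intros)
    qed
    then show ?thesis using 3 by (simp add: has_field_derivative_iff)
  qed
qed

text \<open>
  To the right of 1 - lam, \<open>prof\<close> is the positive part of a smooth function q, and the
  square of the positive part is continuously differentiable; this treats the inside of the wave, its
  edges and the constant states alike. Up to 1 - lam, where the formula for q breaks down,
  \<open>prof\<close> vanishes.
\<close>

lemma prof_sq_DERIV:
  "((\<lambda>\<xi>. (prof rm rp lam \<xi>)\<^sup>2) has_real_derivative prof rm rp lam \<xi> * prof_slope rm rp lam \<xi>) (at \<xi>)"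
proof (cases "1 - lam < \<xi>")
  case False
  then have l: "\<xi> < chord rm rp lam rm rm" using chord_gt[of rm] c by auto
  have "((\<lambda>_. 0) has_real_derivative prof rm rp lam \<xi> * prof_slope rm rp lam \<xi>) (at \<xi>)"
    using l by (simp add: prof_eq_0_outside)
  then show ?thesis
    by (rule has_field_derivative_transform_within_open[where S = "{..<chord rm rp lam rm rm}"])
      (use l in \<open>auto simp: prof_eq_0_outside\<close>)
next
  case True
  define K where "K = lam * rm * rp"
  define s where "s \<xi> = sqrt (K / (\<xi> - (1 - lam)))" for \<xi>
  define q where "q \<xi> = (s \<xi> - rm) * (rp - s \<xi>)" for \<xi>
  have K: "0 < K" using c by (simp add: K_def)
  have prof_q: "prof rm rp lam \<xi> = max 0 (q \<xi>)" if "1 - lam < \<xi>" for \<xi>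
  proof -
    note i = chord_diag_le_iff[OF c _ that, folded K_def, folded s_def]
    consider "\<xi> \<le> chord rm rp lam rm rm" | "chord rm rp lam rp rp \<le> \<xi>"
      | "chord rm rp lam rm rm < \<xi>" "\<xi> < chord rm rp lam rp rp" by linarith
    then show ?thesis
    proof cases
      case 1
      then have "q \<xi> \<le> 0" unfolding q_def
        using i(1)[of rm] c by (intro mult_nonneg_nonpos) auto
      then show ?thesis using 1 by (simp add: prof_eq_0_outside)
    next
      case 2
      then have "q \<xi> \<le> 0" unfolding q_def
        using i(2)[of rp] c by (intro mult_nonpos_nonneg) auto
      then show ?thesis using 2 by (simp add: prof_eq_0_outside)
    next
      case 3
      then have f: "fan rm rp lam \<xi> = rm + rp - s \<xi>" by (simp add: fan_def s_def K_def)
      then have "prof rm rp lam \<xi> = q \<xi>" by (simp add: prof_def q_def)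
      then show ?thesis using prof_nonneg[of \<xi>] by simp
    qed
  qed
  have x: "0 < \<xi> - (1 - lam)" using True by simp
  have spos: "0 < s \<xi>" using K x by (simp add: s_def)
  have ds: "(s has_real_derivative - (s \<xi> ^ 3) / (2 * K)) (at \<xi>)"
  proof -
    have "((\<lambda>\<xi>. K / (\<xi> - (1 - lam))) has_real_derivative - K / (\<xi> - (1 - lam))\<^sup>2) (at \<xi>)"
      using x by (auto intro!: derivative_eq_intros simp: power2_eq_square)
    moreover have "0 < K / (\<xi> - (1 - lam))" using K x by simp
    ultimately have "(s has_real_derivative
        inverse (s \<xi>) / 2 * (- K / (\<xi> - (1 - lam))\<^sup>2)) (at \<xi>)"
      unfolding s_def by (intro DERIV_chain2[OF DERIV_real_sqrt])
    also have "- K / (\<xi> - (1 - lam))\<^sup>2 = - ((s \<xi>)\<^sup>2 * (s \<xi>)\<^sup>2 / K)"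
    proof -
      have "(s \<xi>)\<^sup>2 = K / (\<xi> - (1 - lam))" using K x by (simp add: s_def)
      then show ?thesis using K x by (simp add: power2_eq_square)
    qed
    also have "inverse (s \<xi>) / 2 * - ((s \<xi>)\<^sup>2 * (s \<xi>)\<^sup>2 / K) = - (s \<xi> ^ 3) / (2 * K)"
      using spos by (simp add: field_simps power2_eq_square power3_eq_cube)
    finally show ?thesis .
  qed
  have dq: "(q has_real_derivative (rp + rm - 2 * s \<xi>) * (- (s \<xi> ^ 3) / (2 * K))) (at \<xi>)"
  proof -
    define s' where "s' = - (s \<xi> ^ 3) / (2 * K)"
    have "(s has_real_derivative s') (at \<xi>)" using ds by (simp add: s'_def)
    then have "(q has_real_derivative (rp + rm - 2 * s \<xi>) * s') (at \<xi>)"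
      unfolding q_def by (auto intro!: derivative_eq_intros simp: algebra_simps)
    then show ?thesis by (simp add: s'_def)
  qed
  have "((\<lambda>\<xi>. (max 0 (q \<xi>))\<^sup>2) has_real_derivative
      2 * max 0 (q \<xi>) * ((rp + rm - 2 * s \<xi>) * (- (s \<xi> ^ 3) / (2 * K)))) (at \<xi>)"
    by (rule DERIV_chain2[OF max_sq_DERIV dq])
  moreover have "2 * max 0 (q \<xi>) * ((rp + rm - 2 * s \<xi>) * (- (s \<xi> ^ 3) / (2 * K)))
      = prof rm rp lam \<xi> * prof_slope rm rp lam \<xi>"
  proof (cases "\<xi> \<le> chord rm rp lam rm rm \<or> chord rm rp lam rp rp \<le> \<xi>")
    case True
    then show ?thesis using prof_q[of \<xi>] x prof_eq_0_outside[of \<xi>] by auto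
  next
    case False
    then have s: "s \<xi> = rm + rp - fan rm rp lam \<xi>" by (simp add: fan_def s_def K_def)
    have "prof rm rp lam \<xi> = max 0 (q \<xi>)" using prof_q x by simp
    then show ?thesis unfolding s prof_slope_def K_def[symmetric] using K by (simp add: field_simps)
  qed
  ultimately have "((\<lambda>\<xi>. (max 0 (q \<xi>))\<^sup>2) has_real_derivative prof rm rp lam \<xi> * prof_slope rm rp lam \<xi>) (at \<xi>)" by simp
  then show ?thesis
    by (rule has_field_derivative_transform_within_open[where S = "{1 - lam<..}"])
      (use True prof_q in auto)
qed

lemma prof_borel: "prof rm rp lam \<in> borel_measurable borel" "prof_slope rm rp lam \<in> borel_measurable borel"
  unfolding prof_def prof_slope_def using fan_borel by measurable

end

text \<open>
  If u and the rarefaction wave differed at a point, a rational k would separate the two values; by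
  the monotonicity of the speed the point then lies on the side of the ray for k on which u is bounded
  by k in the contradictory direction. Countably many k, sides and truncation parameters suffice.
\<close>

lemma entropy_solution_eq_fan:
  fixes u :: "real \<times> real \<Rightarrow> real"
  assumes ent: "entropy_solution rm rp g lam T u" and T: "0 < T" and g: "0 < g"
    and c: "0 < rm" "rm < rp" "0 < lam" "lam \<le> 1"
  shows "AE p in lebesgue_on (strip T). u p = fan rm rp lam (2 * fst p / (g * (snd p)\<^sup>2))"
proof -
  let ?M = "lebesgue_on (strip T)"
  define I where "I = ({k \<in> \<rat>. rm \<le> k \<and> k \<le> rp} \<times> {1, - 1 :: real}) \<times> (UNIV :: nat set)"
  have I: "countable I" unfolding I_def
    by (intro countable_SIGMA countable_Collect countable_rat) auto
  \<comment> \<open>The index j makes the far end and the final time of the truncated region recede.\<close>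
  have "AE p in ?M. \<forall>i\<in>I. case i of ((k, s), j) \<Rightarrow>
      0 < s * (chord rm rp lam k k * g / 2 * (snd p)\<^sup>2 - fst p) \<longrightarrow>
      0 < real j + s * fst p - (chord rm rp lam rp rp * g / 2) * (snd p)\<^sup>2 \<longrightarrow>
      snd p < T - inverse (real (Suc j)) \<longrightarrow> s * (u p - k) \<le> 0"
  proof (rule AE_ball_countable[OF I, THEN iffD2], rule ballI)
    fix i assume "i \<in> I"
    then obtain k s j where i: "i = ((k, s), j)" "rm \<le> k" "k \<le> rp" "s = 1 \<or> s = - 1"
      by (auto simp: I_def)
    show "AE p in ?M. case i of ((k, s), j) \<Rightarrow>
      0 < s * (chord rm rp lam k k * g / 2 * (snd p)\<^sup>2 - fst p) \<longrightarrow>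
      0 < real j + s * fst p - (chord rm rp lam rp rp * g / 2) * (snd p)\<^sup>2 \<longrightarrow>
      snd p < T - inverse (real (Suc j)) \<longrightarrow> s * (u p - k) \<le> 0"
      unfolding i(1) prod.case
      by (rule entropy_solution_one_side[OF ent T g]) (use c i in auto)
  qed
  moreover have "AE p in ?M. rm \<le> u p \<and> u p \<le> rp"
    using ent by (auto simp: entropy_solution_def)
  moreover have "AE p in ?M. p \<in> strip T"
    using AE_space[of ?M] strip_measurable by simp
  ultimately show ?thesis
  proof eventually_elim
    fix p assume all: "\<forall>i\<in>I. case i of ((k, s), j) \<Rightarrow>
      0 < s * (chord rm rp lam k k * g / 2 * (snd p)\<^sup>2 - fst p) \<longrightarrow>
      0 < real j + s * fst p - (chord rm rp lam rp rp * g / 2) * (snd p)\<^sup>2 \<longrightarrow>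
      snd p < T - inverse (real (Suc j)) \<longrightarrow> s * (u p - k) \<le> 0"
      and up: "rm \<le> u p \<and> u p \<le> rp" and p: "p \<in> strip T"
    let ?\<xi> = "2 * fst p / (g * (snd p)\<^sup>2)"
    let ?v = "fan rm rp lam ?\<xi>"
    have t: "0 < g * (snd p)\<^sup>2" "snd p < T" using p g by auto
    have key: "s * (u p - k) \<le> 0"
      if s: "s = 1 \<or> s = - 1" and k: "k \<in> \<rat>" "rm \<le> k" "k \<le> rp"
        and \<xi>: "0 < s * (chord rm rp lam k k - ?\<xi>)" for s k
    proof -
      have pos: "0 < s * (chord rm rp lam k k * g / 2 * (snd p)\<^sup>2 - fst p)"
      proof -
        have "s * (chord rm rp lam k k * g / 2 * (snd p)\<^sup>2 - fst p)
            = (g * (snd p)\<^sup>2 / 2) * (s * (chord rm rp lam k k - ?\<xi>))"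
          using p g by (auto simp: field_simps)
        also have "0 < \<dots>" using t by (intro mult_pos_pos \<xi>) auto
        finally show ?thesis .
      qed
      obtain j1 :: nat where j1: "inverse (real (Suc j1)) < T - snd p"
        using reals_Archimedean[of "T - snd p"] t by auto
      obtain j2 :: nat where j2: "(chord rm rp lam rp rp * g / 2) * (snd p)\<^sup>2 - s * fst p < real j2"
        using reals_Archimedean2 by blast
      let ?j = "max j1 j2"
      have "inverse (real (Suc ?j)) \<le> inverse (real (Suc j1))"
        by (intro le_imp_inverse_le) auto
      with j1 have "snd p < T - inverse (real (Suc ?j))" by linarith
      moreover have "real j2 \<le> real ?j" by simp
      with j2 have "0 < real ?j + s * fst p - (chord rm rp lam rp rp * g / 2) * (snd p)\<^sup>2" by linarith
      moreover have "((k, s), ?j) \<in> I" using k s by (auto simp: I_def)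
      ultimately show ?thesis using all pos by fastforce
    qed
    show "u p = ?v"
    proof (rule ccontr)
      assume "u p \<noteq> ?v"
      then consider "?v < u p" | "u p < ?v" by linarith
      then show False
      proof cases
        case 1
        obtain k where k: "k \<in> \<rat>" "?v < k" "k < u p" using Rats_dense_in_real[OF 1] by blast
        have "rm \<le> k" "k \<le> rp" using fan_range[OF c(1-3), of ?\<xi>] k up by linarith+
        moreover have "?\<xi> < chord rm rp lam k k"
          using fan_less_imp[OF c(1-3)] k \<open>k \<le> rp\<close> by blast
        ultimately have "1 * (u p - k) \<le> 0" using k by (intro key) auto
        then show False using k by simp
      next
        case 2
        obtain k where k: "k \<in> \<rat>" "u p < k" "k < ?v" using Rats_dense_in_real[OF 2] by blast
        have "rm \<le> k" "k \<le> rp" using fan_range[OF c(1-3), of ?\<xi>] k up by linarith+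
        moreover have "chord rm rp lam k k < ?\<xi>"
          using less_fan_imp[OF c(1-3)] k \<open>rm \<le> k\<close> by blast
        ultimately have "- 1 * (u p - k) \<le> 0" using k by (intro key) auto
        then show False using k by simp
      qed
    qed
  qed
qed


section \<open>Integration by parts against the fan\<close>

lemma Dom_iff: "p \<in> Dom N g L T \<longleftrightarrow> 0 < snd p \<and> snd p < T \<and> \<bar>fst p $ N - g * (snd p)\<^sup>2 / 2\<bar> < L"
proof -
  have "y \<in> Dslice N g L t \<longleftrightarrow> \<bar>y $ N - g * t\<^sup>2 / 2\<bar> < L" for y t
  proof -
    have "y \<in> Dslice N g L t \<longleftrightarrow> y - ((1/2) * g * t\<^sup>2) *\<^sub>R axis N 1 \<in> Omega N L"
      by (force simp: Dslice_def image_iff)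
    also have "\<dots> \<longleftrightarrow> \<bar>y $ N - g * t\<^sup>2 / 2\<bar> < L"
      by (auto simp: Omega_def abs_less_iff)
    finally show ?thesis .
  qed
  then show ?thesis by (cases p) (simp add: Dom_def)
qed

lemma Dom_subset_Dbar: "Dom N g L T \<subseteq> Dbar N g L T"
  using closure_subset by (fastforce simp: Dom_def Dbar_def)

lemma open_Dom: "open (Dom N g L T)"
proof -
  have "Dom N g L T = {p. 0 < snd p} \<inter> {p. snd p < T} \<inter> {p. \<bar>fst p $ N - g * (snd p)\<^sup>2 / 2\<bar> < L}"
    by (auto simp: Dom_iff)
  then show ?thesis
    by (auto intro!: open_Int open_Collect_less continuous_intros)
qed

lemma cylinder_borel: "torus_cell N \<times> UNIV \<in> sets (borel :: ((real ^ 'n) \<times> real) measure)"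
proof -
  have "torus_cell N \<times> UNIV = (\<Inter>i\<in>{i. i \<noteq> N}. {p :: (real ^ 'n) \<times> real. 0 \<le> fst p $ i} \<inter> {p. fst p $ i < 1})"
    by (auto simp: torus_cell_def)
  moreover have "{p :: (real ^ 'n) \<times> real. 0 \<le> fst p $ i} \<inter> {p. fst p $ i < 1} \<in> sets borel" for i
    by (intro sets.Int borel_closed borel_open closed_Collect_le open_Collect_less continuous_intros)
  ultimately show ?thesis by (cases "{i. i \<noteq> N} = {}") (auto intro: sets.finite_INT)
qed

abbreviation cellDom :: "'n::finite \<Rightarrow> real \<Rightarrow> real \<Rightarrow> real \<Rightarrow> ((real ^ 'n) \<times> real) set" where
  "cellDom N g L T \<equiv> Dom N g L T \<inter> (torus_cell N \<times> UNIV)"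

lemma Dom_lebesgue:
  fixes N :: "'n::finite"
  shows "Dom N g L T \<in> sets lebesgue"
  using borel_open[OF open_Dom[of N g L T]] by simp

lemma cellDom_bounded:
  fixes N :: "'n::finite"
  assumes "0 < g" "0 < L"
  obtains r where "\<And>p. p \<in> cellDom N g L T \<Longrightarrow> norm p \<le> r"
proof (rule that)
  fix p :: "(real ^ 'n) \<times> real" assume p: "p \<in> cellDom N g L T"
  have t: "0 < snd p" "snd p < T" "\<bar>fst p $ N - g * (snd p)\<^sup>2 / 2\<bar> < L" using p by (auto simp: Dom_iff)
  have "g * (snd p)\<^sup>2 / 2 \<le> g * T\<^sup>2 / 2" using t assms by (auto intro!: power_mono)
  moreover have "0 \<le> g * (snd p)\<^sup>2 / 2" using assms by simp
  ultimately have 1: "\<bar>fst p $ N\<bar> \<le> 1 + L + g * T\<^sup>2 / 2" using t(3) assms by linarith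
  have "\<bar>fst p $ i\<bar> \<le> 1 + L + g * T\<^sup>2 / 2" for i
  proof (cases "i = N")
    case True then show ?thesis using 1 by simp
  next
    case False
    then have "\<bar>fst p $ i\<bar> \<le> 1" using p by (force simp: torus_cell_def)
    moreover have "0 \<le> L + g * T\<^sup>2 / 2" using assms by simp
    ultimately show ?thesis by linarith
  qed
  then have "(\<Sum>i\<in>UNIV. \<bar>fst p $ i\<bar>) \<le> (\<Sum>i\<in>(UNIV::'n set). 1 + L + g * T\<^sup>2 / 2)" by (intro sum_mono)
  with norm_le_l1_cart[of "fst p"]
  have "norm (fst p) \<le> real CARD('n) * (1 + L + g * T\<^sup>2 / 2)" by simp
  then show "norm p \<le> real CARD('n) * (1 + L + g * T\<^sup>2 / 2) + T"
    using norm_Pair_le[of "fst p" "snd p"] t by simp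
qed

lemma cellDom_lmeasurable:
  fixes N :: "'n::finite"
  assumes "0 < g" "0 < L"
  shows "cellDom N g L T \<in> lmeasurable"
proof (rule bounded_set_imp_lmeasurable)
  show "bounded (cellDom N g L T)"
    using cellDom_bounded[OF assms] unfolding bounded_iff by metis
  show "cellDom N g L T \<in> sets lebesgue"
    using Dom_lebesgue[of N] cylinder_borel[of N] by (intro sets.Int) auto
qed

lemma smooth_bounded:
  assumes "smooth (f :: 'a::euclidean_space \<Rightarrow> real)"
  obtains M where "\<And>p. norm p \<le> r \<Longrightarrow> \<bar>f p\<bar> \<le> M"
proof -
  have "compact (f ` cball 0 r)"
    by (intro compact_continuous_image smooth_continuous_on assms compact_cball)
  then obtain M where "\<forall>x\<in>f ` cball 0 r. norm x \<le> M"
    using compact_imp_bounded bounded_iff by metis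
  then show ?thesis by (intro that[of M]) auto
qed

lemma axis_in_Basis_prod: "(axis i 1, 0) \<in> (Basis :: ((real ^ 'n) \<times> real) set)"
  and time_in_Basis_prod: "(0, 1) \<in> (Basis :: ((real ^ 'n) \<times> real) set)"
  by (auto simp: Basis_prod_def axis_in_Basis_iff)

text \<open>
  The similarity variable: the flux of the conservation law carries the factor g t, so g t^2 / 2 plays
  the role of time.
\<close>

definition sim :: "'n \<Rightarrow> real \<Rightarrow> (real ^ 'n) \<times> real \<Rightarrow> real" where
  "sim N g p = 2 * fst p $ N / (g * (snd p)\<^sup>2)"

lemma sim_borel:
  fixes N :: "'n::finite"
  shows "sim N g \<in> borel_measurable borel"
proof -
  have "(\<lambda>p :: (real ^ 'n) \<times> real. fst p $ N) \<in> borel_measurable borel"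
    "(\<lambda>p :: (real ^ 'n) \<times> real. snd p) \<in> borel_measurable borel"
    by (intro borel_measurable_continuous_onI continuous_intros)+
  then show ?thesis unfolding sim_def by measurable
qed

lemma abs_mult_le: "\<bar>a\<bar> \<le> A \<Longrightarrow> \<bar>b\<bar> \<le> B \<Longrightarrow> \<bar>a * b\<bar> \<le> A * (B::real)"
  unfolding abs_mult by (intro mult_mono) auto

lemma prof_ne_0:
  assumes c: "0 < rm" "rm < rp" "0 < lam" "lam < 1" and nz: "prof rm rp lam \<xi> \<noteq> 0"
  shows "\<bar>\<xi> - 1\<bar> \<le> lam * ((rp - rm) / rm)" "\<bar>\<xi>\<bar> \<le> 1 + lam * ((rp - rm) / rm)"
proof -
  have "chord rm rp lam rm rm < \<xi>" "\<xi> < chord rm rp lam rp rp"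
    using prof_eq_0_outside[OF c(1-3), of \<xi>] nz by (auto simp: not_le[symmetric])
  moreover have "chord rm rp lam rp rp = 1 + lam * ((rp - rm) / rm)"
    using c by (simp add: chord_diag power2_eq_square field_simps)
  moreover have "chord rm rp lam rm rm = 1 - lam * ((rp - rm) / rp)"
    using c by (simp add: chord_diag power2_eq_square field_simps)
  moreover have "lam * ((rp - rm) / rp) \<le> lam * ((rp - rm) / rm)"
    using c by (intro mult_left_mono divide_left_mono) auto
  ultimately show 1: "\<bar>\<xi> - 1\<bar> \<le> lam * ((rp - rm) / rm)" by linarith
  have "0 \<le> lam * ((rp - rm) / rm)" using c by simp
  then show "\<bar>\<xi>\<bar> \<le> 1 + lam * ((rp - rm) / rm)" using 1 by linarith
qed

text \<open>
  The bound on T means that up to this time the wave does not reach the lateral boundary.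
\<close>

lemma prof_ne_0_in_Dom:
  assumes c: "0 < rm" "rm < rp" "0 < lam" "lam < 1" and g: "0 < g"
    and T: "lam * ((rp - rm) / rm) * (g * T\<^sup>2 / 2) < L"
    and t: "0 < snd p" "snd p < T" and nz: "prof rm rp lam (sim N g p) \<noteq> 0"
  shows "p \<in> Dom N g L T"
proof -
  let ?G = "g * (snd p)\<^sup>2 / 2"
  have G: "0 < ?G" using g t by simp
  have eq: "fst p $ N - ?G = (sim N g p - 1) * ?G" using g t by (simp add: sim_def field_simps)
  have "\<bar>fst p $ N - ?G\<bar> = \<bar>sim N g p - 1\<bar> * ?G"
    by (simp only: eq abs_mult abs_of_pos[OF G])
  also have "\<dots> \<le> lam * ((rp - rm) / rm) * (g * T\<^sup>2 / 2)"
    using prof_ne_0(1)[OF c nz] g t c by (intro mult_mono) (auto intro!: power_mono)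
  finally show ?thesis using T t by (simp add: Dom_iff)
qed

text \<open>
  The weak form of d(t^2 B)/dt + \<gamma> g t d(t^2 B)/dy_n = t (2 B + 2 (\<gamma> - \<xi>) B'), where
  \<xi> is the similarity variable and B' the derivative of B with respect to it. No boundary terms
  arise: t^2 B vanishes near the lateral boundary and to second order at t = 0, and \<Psi> vanishes
  near t = T. Extended by 0, the product with \<Psi> is therefore differentiable along all lines in
  both directions.
\<close>

lemma int_Dom_fan_by_parts:
  fixes N :: "'n::finite"
  assumes c: "0 < rm" "rm < rp" "0 < lam" "lam < 1" and g: "0 < g" and L: "0 < L" and T0: "0 < T"
    and T: "lam * ((rp - rm) / rm) * (g * T\<^sup>2 / 2) < L"
    and \<Psi>: "testfun N g L T \<Psi>"
  defines "B \<equiv> \<lambda>p. (prof rm rp lam (sim N g p))\<^sup>2"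
    and "B' \<equiv> \<lambda>p. prof rm rp lam (sim N g p) * prof_slope rm rp lam (sim N g p)"
  shows "int_Dom N g L T (\<lambda>p. (snd p)\<^sup>2 * B p * pd \<Psi> (0, 1) p
      + \<gamma> * (g * snd p) * ((snd p)\<^sup>2 * B p) * pd \<Psi> (axis N 1, 0) p
      + snd p * (2 * B p + 2 * (\<gamma> - sim N g p) * B' p) * \<Psi> p) = 0"
proof -
  let ?S = "torus_cell N \<times> UNIV :: ((real ^ 'n) \<times> real) set"
  define I where "I p \<longleftrightarrow> 0 < snd p \<and> snd p < T" for p :: "(real ^ 'n) \<times> real"
  define A where "A p = (if I p then (snd p)\<^sup>2 * B p else 0)" for p
  define W1 where "W1 p = A p * \<Psi> p" for p
  define W1' where "W1' p = (if I p then snd p * (2 * B p - 2 * sim N g p * B' p) * \<Psi> p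
      + (snd p)\<^sup>2 * B p * pd \<Psi> (0, 1) p else 0)" for p
  define W2 where "W2 p = \<gamma> * (g * snd p) * A p * \<Psi> p" for p
  define W2' where "W2' p = (if I p then snd p * (2 * \<gamma> * B' p) * \<Psi> p
      + \<gamma> * (g * snd p) * ((snd p)\<^sup>2 * B p) * pd \<Psi> (axis N 1, 0) p else 0)" for p
  have sm: "smooth \<Psi>" using \<Psi> by (simp add: testfun_def)
  obtain T' where T': "T' < T" "\<And>p. p \<in> Dbar N g L T \<Longrightarrow> T' \<le> snd p \<Longrightarrow> \<Psi> p = 0"
    using \<Psi> by (auto simp: testfun_def vanishes_from_def)
  have B_out: "B p = 0" "B' p = 0" if "I p" "p \<notin> Dom N g L T" for p
    using prof_ne_0_in_Dom[OF c g T, of p N] that by (auto simp: B_def B'_def I_def)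
  obtain r where r: "\<And>p. p \<in> cellDom N g L T \<Longrightarrow> norm p \<le> r"
    using cellDom_bounded[OF g L, where T = T and N = N] by blast
  obtain M0 where M0: "\<And>p. norm p \<le> r \<Longrightarrow> \<bar>\<Psi> p\<bar> \<le> M0" using smooth_bounded[OF sm] by blast
  obtain M1 where M1: "\<And>p. norm p \<le> r \<Longrightarrow> \<bar>pd \<Psi> (0, 1) p\<bar> \<le> M1"
    using smooth_bounded[OF smooth_pd[OF sm time_in_Basis_prod]] by blast
  obtain M2 where M2: "\<And>p. norm p \<le> r \<Longrightarrow> \<bar>pd \<Psi> (axis N 1, 0) p\<bar> \<le> M2"
    using smooth_bounded[OF smooth_pd[OF sm axis_in_Basis_prod]] by blast
  have pb: "\<bar>prof rm rp lam \<xi>\<bar> \<le> rp * rp" for \<xi>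
    using prof_nonneg[OF c(1-3), of \<xi>] prof_le[OF c(1-3), of \<xi>] by simp
  define H where "H = rp * rp ^ 3 / (lam * rm * rp)"
  define Q where "Q = 1 + lam * ((rp - rm) / rm)"
  have Bb: "\<bar>B p\<bar> \<le> (rp * rp) * (rp * rp)" for p
    unfolding B_def power2_eq_square by (intro abs_mult_le pb)
  have B'b: "\<bar>B' p\<bar> \<le> (rp * rp) * H" for p
    unfolding B'_def H_def by (intro abs_mult_le pb prof_slope_le c)
  have \<xi>B'b: "\<bar>sim N g p * B' p\<bar> \<le> Q * ((rp * rp) * H)" for p
  proof (cases "prof rm rp lam (sim N g p) = 0")
    case True
    have "0 \<le> Q" "0 \<le> H" using c by (auto simp: Q_def H_def)
    then show ?thesis using True by (simp add: B'_def)
  next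
    case False
    then show ?thesis unfolding Q_def by (intro abs_mult_le B'b prof_ne_0(2) c)
  qed
  have out: "W1 p = 0 \<and> W1' p = 0 \<and> W2 p = 0 \<and> W2' p = 0" if "p \<notin> Dom N g L T" for p
    using B_out[of p] that by (cases "I p") (auto simp: W1_def W1'_def W2_def W2'_def A_def)
  define K1 where "K1 = T * (2 * ((rp * rp) * (rp * rp)) + 2 * (Q * ((rp * rp) * H))) * M0 + T * T * ((rp * rp) * (rp * rp)) * M1"
  define K2 where "K2 = T * (2 * \<bar>\<gamma>\<bar> * ((rp * rp) * H)) * M0 + \<bar>\<gamma>\<bar> * (g * T) * (T * T * ((rp * rp) * (rp * rp))) * M2"
  define K3 where "K3 = T * T * ((rp * rp) * (rp * rp)) * M0"
  define K4 where "K4 = \<bar>\<gamma>\<bar> * (g * T) * (T * T * ((rp * rp) * (rp * rp))) * M0"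
  have bounds: "\<bar>W1' p\<bar> \<le> \<bar>K1\<bar>" "\<bar>W2' p\<bar> \<le> \<bar>K2\<bar>" "\<bar>W1 p\<bar> \<le> \<bar>K3\<bar>" "\<bar>W2 p\<bar> \<le> \<bar>K4\<bar>" if "p \<in> ?S" for p
  proof -
    have "\<bar>W1' p\<bar> \<le> \<bar>K1\<bar> \<and> \<bar>W2' p\<bar> \<le> \<bar>K2\<bar> \<and> \<bar>W1 p\<bar> \<le> \<bar>K3\<bar> \<and> \<bar>W2 p\<bar> \<le> \<bar>K4\<bar>"
    proof (cases "p \<in> Dom N g L T")
      case False then show ?thesis using out by simp
    next
      case True
      then have n: "norm p \<le> r" using r that by blast
      have I: "I p" using True by (simp add: I_def Dom_iff)
      then have t: "\<bar>snd p\<bar> \<le> T" by (simp add: I_def)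
      have gt: "\<bar>g * snd p\<bar> \<le> g * T" using g t by (intro abs_mult_le) auto
      have 1: "\<bar>2 * B p - 2 * sim N g p * B' p\<bar> \<le> 2 * ((rp * rp) * (rp * rp)) + 2 * (Q * ((rp * rp) * H))"
        using Bb[of p] \<xi>B'b[of p] by (auto simp: abs_le_iff mult.assoc)
      have 2: "\<bar>(snd p)\<^sup>2 * B p\<bar> \<le> T * T * ((rp * rp) * (rp * rp))"
        unfolding power2_eq_square by (intro abs_mult_le t Bb)
      have "\<bar>W1' p\<bar> \<le> K1"
        unfolding W1'_def K1_def if_P[OF I]
        by (intro order_trans[OF abs_triangle_ineq] add_mono abs_mult_le t 1 2 M0 M1 n)
      moreover have "\<bar>W2' p\<bar> \<le> K2"
        unfolding W2'_def K2_def if_P[OF I]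
        by (intro order_trans[OF abs_triangle_ineq] add_mono abs_mult_le t gt 2 B'b M0 M2 n) auto
      moreover have "\<bar>W1 p\<bar> \<le> K3"
        unfolding W1_def K3_def A_def if_P[OF I] by (intro abs_mult_le 2 M0 n)
      moreover have "\<bar>W2 p\<bar> \<le> K4"
        unfolding W2_def K4_def A_def if_P[OF I] by (intro abs_mult_le gt 2 M0 n) auto
      ultimately show ?thesis by simp
    qed
    then show "\<bar>W1' p\<bar> \<le> \<bar>K1\<bar>" "\<bar>W2' p\<bar> \<le> \<bar>K2\<bar>" "\<bar>W1 p\<bar> \<le> \<bar>K3\<bar>" "\<bar>W2 p\<bar> \<le> \<bar>K4\<bar>" by auto
  qed
  have der1: "((\<lambda>s. W1 (p + s *\<^sub>R (0, 1))) has_real_derivative W1' p) (at 0)" for p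
  proof -
    obtain y t where p: "p = (y, t)" by fastforce
    have d\<Psi>: "((\<lambda>s. \<Psi> (p + s *\<^sub>R (0, 1))) has_real_derivative pd \<Psi> (0, 1) p) (at 0)"
      by (rule directional_DERIV[OF smooth_differentiable[OF sm]])
    consider "t < 0" | "t = 0" | "I p" | "T \<le> t" unfolding I_def p by fastforce
    then show ?thesis
    proof cases
      case 1
      then have "((\<lambda>s. 0) has_real_derivative W1' p) (at 0)" by (simp add: W1'_def I_def p)
      then show ?thesis
        by (rule has_field_derivative_transform_within_open[where S = "{..<-t}"])
          (use 1 in \<open>auto simp: W1_def A_def I_def p\<close>)
    next
      case 2
      \<comment> \<open>At t = 0 differentiability comes from the factor t^2 alone; the similarity variable is singular there.\<close>
      have "((\<lambda>s. A (y, s) / s) \<longlongrightarrow> 0) (at 0)"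
      proof (rule Lim_null_comparison)
        show "\<forall>\<^sub>F s in at 0. norm (A (y, s) / s) \<le> \<bar>s\<bar> * ((rp * rp) * (rp * rp))"
        proof (intro always_eventually allI)
          fix s :: real
          have "\<bar>s * B (y, s)\<bar> \<le> \<bar>s\<bar> * ((rp * rp) * (rp * rp))"
            by (intro abs_mult_le Bb order_refl)
          moreover have "A (y, s) / s = (if I (y, s) then s * B (y, s) else 0)"
            by (auto simp: A_def I_def power2_eq_square)
          ultimately show "norm (A (y, s) / s) \<le> \<bar>s\<bar> * ((rp * rp) * (rp * rp))"
            by simp
        qed
        show "((\<lambda>s. \<bar>s\<bar> * ((rp * rp) * (rp * rp))) \<longlongrightarrow> 0) (at 0)"
          by (auto intro!: tendsto_eq_intros)
      qed
      moreover have "((\<lambda>s. \<Psi> (p + s *\<^sub>R (0, 1))) \<longlongrightarrow> \<Psi> (p + 0 *\<^sub>R (0, 1))) (at 0)"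
        using DERIV_isCont[OF d\<Psi>] unfolding isCont_def .
      ultimately have "((\<lambda>s. A (y, s) / s * \<Psi> (p + s *\<^sub>R (0, 1))) \<longlongrightarrow> 0 * \<Psi> (p + 0 *\<^sub>R (0, 1))) (at 0)"
        by (rule tendsto_mult)
      then show ?thesis
        using 2 by (simp add: has_field_derivative_iff W1_def W1'_def A_def I_def p)
    next
      case 3
      then have t: "0 < t" "t < T" by (auto simp: I_def p)
      have "((\<lambda>s. 2 * y $ N / (g * (t + s)\<^sup>2)) has_real_derivative - 2 * sim N g p / t) (at 0)"
        using t g by (auto intro!: derivative_eq_intros simp: p sim_def power2_eq_square field_simps)
      from DERIV_chain2[OF prof_sq_DERIV[OF c(1-3)] this]
      have "((\<lambda>s. (prof rm rp lam (2 * y $ N / (g * (t + s)\<^sup>2)))\<^sup>2) has_real_derivative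
          B' p * (- 2 * sim N g p / t)) (at 0)"
        by (simp add: B'_def sim_def p)
      then have "((\<lambda>s. B (p + s *\<^sub>R (0, 1))) has_real_derivative B' p * (- 2 * sim N g p / t)) (at 0)"
        by (simp add: B_def sim_def p)
      moreover have "((\<lambda>s. (t + s)\<^sup>2) has_real_derivative 2 * t) (at 0)"
        by (auto intro!: derivative_eq_intros)
      ultimately have "((\<lambda>s. (t + s)\<^sup>2 * B (p + s *\<^sub>R (0, 1)) * \<Psi> (p + s *\<^sub>R (0, 1))) has_real_derivative
          (((2 * t) * B (p + 0 *\<^sub>R (0, 1)) + (B' p * (- 2 * sim N g p / t)) * (t + 0)\<^sup>2) * \<Psi> (p + 0 *\<^sub>R (0, 1))
           + pd \<Psi> (0, 1) p * ((t + 0)\<^sup>2 * B (p + 0 *\<^sub>R (0, 1))))) (at 0)"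
        by (intro DERIV_mult d\<Psi>)
      moreover have "(((2 * t) * B (p + 0 *\<^sub>R (0, 1)) + (B' p * (- 2 * sim N g p / t)) * (t + 0)\<^sup>2) * \<Psi> (p + 0 *\<^sub>R (0, 1))
           + pd \<Psi> (0, 1) p * ((t + 0)\<^sup>2 * B (p + 0 *\<^sub>R (0, 1)))) = W1' p"
        using t by (simp add: W1'_def I_def p power2_eq_square algebra_simps)
      ultimately have "((\<lambda>s. (t + s)\<^sup>2 * B (p + s *\<^sub>R (0, 1)) * \<Psi> (p + s *\<^sub>R (0, 1))) has_real_derivative W1' p) (at 0)"
        by simp
      then show ?thesis
        by (rule has_field_derivative_transform_within_open[where S = "{-t<..<T-t}"])
          (use t in \<open>auto simp: W1_def A_def I_def p\<close>)
    next
      case 4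
      have "W1 q = 0" if "T' < snd q" for q
      proof (cases "q \<in> Dom N g L T")
        case True
        then have "\<Psi> q = 0" using T'(2) that Dom_subset_Dbar by (meson less_imp_le subsetD)
        then show ?thesis by (simp add: W1_def)
      qed (simp add: out)
      then have W0: "0 = W1 (p + s *\<^sub>R (0, 1))" if "s \<in> {T'-t<..}" for s
        using that by (simp add: p)
      have "((\<lambda>s. 0) has_real_derivative W1' p) (at 0)" using 4 by (simp add: W1'_def I_def p)
      then show ?thesis
        by (rule has_field_derivative_transform_within_open[where S = "{T'-t<..}"])
          (use 4 T' W0 in auto)
    qed
  qed
  have der2: "((\<lambda>s. W2 (p + s *\<^sub>R (axis N 1, 0))) has_real_derivative W2' p) (at 0)" for p
  proof -
    obtain y t where p: "p = (y, t)" by fastforce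
    have d\<Psi>: "((\<lambda>s. \<Psi> (p + s *\<^sub>R (axis N 1, 0))) has_real_derivative pd \<Psi> (axis N 1, 0) p) (at 0)"
      by (rule directional_DERIV[OF smooth_differentiable[OF sm]])
    show ?thesis
    proof (cases "I p")
      case False
      then have "W2 (p + s *\<^sub>R (axis N 1, 0)) = 0" for s
        by (auto simp: W2_def A_def I_def p)
      moreover have "W2' p = 0" using False by (auto simp: W2'_def)
      ultimately show ?thesis by simp
    next
      case True
      then have t: "0 < t" "t < T" by (auto simp: I_def p)
      have "((\<lambda>s. 2 * (y $ N + s) / (g * t\<^sup>2)) has_real_derivative 2 / (g * t\<^sup>2)) (at 0)"
        using t g by (auto intro!: derivative_eq_intros)
      from DERIV_chain2[OF prof_sq_DERIV[OF c(1-3)] this]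
      have "((\<lambda>s. (prof rm rp lam (2 * (y $ N + s) / (g * t\<^sup>2)))\<^sup>2) has_real_derivative
          B' p * (2 / (g * t\<^sup>2))) (at 0)"
        by (simp add: B'_def sim_def p)
      then have "((\<lambda>s. B (p + s *\<^sub>R (axis N 1, 0))) has_real_derivative B' p * (2 / (g * t\<^sup>2))) (at 0)"
        by (simp add: B_def sim_def p)
      from DERIV_mult[OF DERIV_cmult[OF this, of "\<gamma> * (g * t) * t\<^sup>2"] d\<Psi>]
      have "((\<lambda>s. \<gamma> * (g * t) * t\<^sup>2 * B (p + s *\<^sub>R (axis N 1, 0)) * \<Psi> (p + s *\<^sub>R (axis N 1, 0))) has_real_derivative
         \<gamma> * (g * t) * t\<^sup>2 * (B' p * (2 / (g * t\<^sup>2))) * \<Psi> (p + 0 *\<^sub>R (axis N 1, 0))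
           + pd \<Psi> (axis N 1, 0) p * (\<gamma> * (g * t) * t\<^sup>2 * B (p + 0 *\<^sub>R (axis N 1, 0)))) (at 0)" .
      moreover have "\<gamma> * (g * t) * t\<^sup>2 * (B' p * (2 / (g * t\<^sup>2))) * \<Psi> (p + 0 *\<^sub>R (axis N 1, 0))
           + pd \<Psi> (axis N 1, 0) p * (\<gamma> * (g * t) * t\<^sup>2 * B (p + 0 *\<^sub>R (axis N 1, 0))) = W2' p"
      proof -
        have "p + 0 *\<^sub>R (axis N 1, 0) = p" by (simp add: zero_prod_def[symmetric])
        then show ?thesis using True t g
          by (simp add: W2'_def power2_eq_square) (simp add: p field_simps)
      qed
      moreover have "W2 (p + s *\<^sub>R (axis N 1, 0))
          = \<gamma> * (g * t) * t\<^sup>2 * B (p + s *\<^sub>R (axis N 1, 0)) * \<Psi> (p + s *\<^sub>R (axis N 1, 0))" for s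
        using True by (simp add: W2_def A_def I_def p mult.assoc)
      ultimately show ?thesis by simp
    qed
  qed
  have borel: "W1 \<in> borel_measurable borel" "W2 \<in> borel_measurable borel"
  proof -
    have [measurable]: "\<Psi> \<in> borel_measurable borel" using sm by (rule smooth_borel)
    have [measurable]: "sim N g \<in> borel_measurable borel" by (rule sim_borel)
    have [measurable]: "prof rm rp lam \<in> borel_measurable borel" by (rule prof_borel[OF c(1-3)])
    have snd_m[measurable]: "(snd :: (real ^ 'n) \<times> real \<Rightarrow> real) \<in> borel_measurable borel"
      by (intro borel_measurable_continuous_onI continuous_on_snd continuous_on_id)
    have A: "A \<in> borel_measurable borel" unfolding A_def I_def B_def by measurable
    show "W1 \<in> borel_measurable borel" "W2 \<in> borel_measurable borel"
      unfolding W1_def W2_def using A by measurable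
  qed
  have supp: "W1 p = 0" "W2 p = 0" if "p \<in> ?S" "r < norm p" for p
    using out[of p] r[of p] that by fastforce+
  have S_inv: "p + s *\<^sub>R (0, 1) \<in> ?S" "p + s *\<^sub>R (axis N 1, 0) \<in> ?S" if "p \<in> ?S" for p s
    using that by (auto simp: torus_cell_def axis_def)
  note Z1 = integral_directional_derivative_eq_0[where v = "(0, 1)" and W = W1 and W' = W1'
      and M = "max \<bar>K1\<bar> \<bar>K3\<bar>" and r = r and S = ?S, OF cylinder_borel S_inv(1) borel(1) der1]
  note Z2 = integral_directional_derivative_eq_0[where v = "(axis N 1, 0)" and W = W2 and W' = W2'
      and M = "max \<bar>K2\<bar> \<bar>K4\<bar>" and r = r and S = ?S, OF cylinder_borel S_inv(2) borel(2) der2]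
  have i: "integrable (lebesgue_on ?S) W1'" "integrable (lebesgue_on ?S) W2'"
    and z: "integral\<^sup>L (lebesgue_on ?S) W1' = 0" "integral\<^sup>L (lebesgue_on ?S) W2' = 0"
    by (rule Z1[OF _ max.coboundedI1[OF bounds(1)] max.coboundedI2[OF bounds(3)] supp(1)]
        Z2[OF _ max.coboundedI1[OF bounds(2)] max.coboundedI2[OF bounds(4)] supp(2)]; assumption)+
  have S: "?S \<in> sets lebesgue" using cylinder_borel[of N] by simp
  let ?F = "\<lambda>p. (snd p)\<^sup>2 * B p * pd \<Psi> (0, 1) p
      + \<gamma> * (g * snd p) * ((snd p)\<^sup>2 * B p) * pd \<Psi> (axis N 1, 0) p
      + snd p * (2 * B p + 2 * (\<gamma> - sim N g p) * B' p) * \<Psi> p"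
  have "int_Dom N g L T ?F = integral\<^sup>L lebesgue (\<lambda>p. indicator (cellDom N g L T) p *\<^sub>R ?F p)"
    unfolding int_Dom_def using fmeasurableD[OF cellDom_lmeasurable[OF g L, of N T]] by (intro integral_restrict_space) simp
  also have "\<dots> = integral\<^sup>L lebesgue (\<lambda>p. indicator ?S p *\<^sub>R (W1' p + W2' p))"
  proof (rule Bochner_Integration.integral_cong[OF refl])
    fix p
    show "indicator (cellDom N g L T) p *\<^sub>R ?F p = indicator ?S p *\<^sub>R (W1' p + W2' p)"
    proof (cases "p \<in> Dom N g L T")
      case True
      then have "I p" by (simp add: I_def Dom_iff)
      then have "?F p = W1' p + W2' p" by (simp add: W1'_def W2'_def algebra_simps)
      then show ?thesis using True by (simp add: indicator_def)
    next
      case False then show ?thesis using out[of p] by (simp add: indicator_def)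
    qed
  qed
  also have "\<dots> = integral\<^sup>L (lebesgue_on ?S) (\<lambda>p. W1' p + W2' p)"
    using S by (intro integral_restrict_space[symmetric]) auto
  also have "\<dots> = 0" using i z by simp
  finally show ?thesis .
qed


section \<open>Essentially bounded fields and the one-dimensional state\<close>

lemma lebesgue_on_AE_space: "S \<in> sets lebesgue \<Longrightarrow> AE p in lebesgue_on S. p \<in> S"
  using AE_space[of "lebesgue_on S"] by simp

lemma AE_lebesgue_on_subset:
  assumes "AE p in lebesgue_on S. P p" "R \<subseteq> S" "S \<in> sets lebesgue" "R \<in> sets lebesgue"
  shows "AE p in lebesgue_on R. P p"
proof -
  have "AE p in lebesgue. p \<in> S \<longrightarrow> P p" using assms by (simp add: AE_restrict_space_iff)
  then have "AE p in lebesgue. p \<in> R \<longrightarrow> P p" by eventually_elim (use assms in auto)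
  then show ?thesis using assms by (simp add: AE_restrict_space_iff)
qed

lemma Linfty_subset:
  assumes "Linfty S f" "R \<subseteq> S" "S \<in> sets lebesgue" "R \<in> sets lebesgue"
  shows "Linfty R f"
  unfolding Linfty_def
proof
  have "f \<in> borel_measurable (lebesgue_on S)" using assms(1) unfolding Linfty_def by (rule conjunct1)
  then show "f \<in> borel_measurable (lebesgue_on R)" by (rule measurable_restrict_mono[OF _ assms(2)])
  obtain K where "AE p in lebesgue_on S. norm (f p) \<le> K"
    using assms(1) unfolding Linfty_def by (elim conjE exE)
  then have "AE p in lebesgue_on R. norm (f p) \<le> K"
    by (rule AE_lebesgue_on_subset) (rule assms)+
  then show "\<exists>K. AE p in lebesgue_on R. norm (f p) \<le> K" ..
qed

lemma Linfty_cong: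
  assumes "Linfty S f" "\<And>p. p \<in> S \<Longrightarrow> f p = h p" "S \<in> sets lebesgue"
  shows "Linfty S h"
  unfolding Linfty_def
proof
  show "h \<in> borel_measurable (lebesgue_on S)"
    using assms measurable_cong[of "lebesgue_on S" f h borel] by (simp add: Linfty_def)
  obtain K where "AE p in lebesgue_on S. norm (f p) \<le> K" using assms by (auto simp: Linfty_def)
  then have "AE p in lebesgue_on S. norm (h p) \<le> K"
    using lebesgue_on_AE_space[OF assms(3)] by eventually_elim (simp add: assms(2)[symmetric])
  then show "\<exists>K. AE p in lebesgue_on S. norm (h p) \<le> K" ..
qed

lemma Linfty_diff:
  fixes f h :: "'a::euclidean_space \<Rightarrow> real"
  assumes "Linfty S f" "Linfty S h"
  shows "Linfty S (\<lambda>p. f p - h p)"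
  unfolding Linfty_def
proof
  show "(\<lambda>p. f p - h p) \<in> borel_measurable (lebesgue_on S)"
    using assms by (auto simp: Linfty_def)
  obtain K K' where "AE p in lebesgue_on S. norm (f p) \<le> K" "AE p in lebesgue_on S. norm (h p) \<le> K'"
    using assms by (auto simp: Linfty_def)
  then have "AE p in lebesgue_on S. norm (f p - h p) \<le> K + K'"
    by eventually_elim (auto intro: order_trans[OF norm_triangle_ineq4] add_mono)
  then show "\<exists>K. AE p in lebesgue_on S. norm (f p - h p) \<le> K" ..
qed

lemma Linfty_of_bounded:
  fixes f :: "'a::euclidean_space \<Rightarrow> real"
  assumes "f \<in> borel_measurable borel" "\<And>p. p \<in> S \<Longrightarrow> \<bar>f p\<bar> \<le> K" "S \<in> sets lebesgue"
  shows "Linfty S f"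
  using assms borel_measurable_lebesgue_on[OF assms(1), of S]
  by (auto simp: Linfty_def intro!: exI[of _ K] AE_I2)

text \<open>
  Essential bounds pass through continuous functions because such functions are bounded on compact
  sets.
\<close>

lemma Linfty_compose:
  fixes z :: "'a::euclidean_space \<times> real \<Rightarrow> 'b::euclidean_space"
    and \<Theta> :: "'b \<times> real \<Rightarrow> 'c::euclidean_space"
  assumes z: "Linfty S z" and \<Theta>: "continuous_on UNIV \<Theta>" and S: "S \<in> sets lebesgue"
    and t: "\<And>p. p \<in> S \<Longrightarrow> \<bar>snd p\<bar> \<le> T"
  shows "Linfty S (\<lambda>p. \<Theta> (z p, snd p))"
  unfolding Linfty_def
proof
  have "(snd :: 'a \<times> real \<Rightarrow> real) \<in> borel_measurable borel"
    by (intro borel_measurable_continuous_onI continuous_on_snd continuous_on_id)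
  then have "(\<lambda>p. (z p, snd p)) \<in> borel_measurable (lebesgue_on S)"
    using z by (intro borel_measurable_Pair[OF _ borel_measurable_lebesgue_on]) (auto simp: Linfty_def)
  then show "(\<lambda>p. \<Theta> (z p, snd p)) \<in> borel_measurable (lebesgue_on S)"
    by (rule measurable_compose) (rule borel_measurable_continuous_onI[OF \<Theta>])
  obtain K where K: "AE p in lebesgue_on S. norm (z p) \<le> K" using z by (auto simp: Linfty_def)
  have "compact (\<Theta> ` (cball 0 K \<times> cball 0 T))"
    by (intro compact_continuous_image continuous_on_subset[OF \<Theta>] compact_Times compact_cball) auto
  then obtain K' where K': "\<forall>x\<in>\<Theta> ` (cball 0 K \<times> cball 0 T). norm x \<le> K'"
    using compact_imp_bounded bounded_iff by metis
  have "AE p in lebesgue_on S. norm (\<Theta> (z p, snd p)) \<le> K'"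
    using K lebesgue_on_AE_space[OF S]
  proof eventually_elim
    fix p assume "norm (z p) \<le> K" "p \<in> S"
    then have "(z p, snd p) \<in> cball 0 K \<times> cball 0 T" using t by simp
    then show "norm (\<Theta> (z p, snd p)) \<le> K'" using K' by blast
  qed
  then show "\<exists>K. AE p in lebesgue_on S. norm (\<Theta> (z p, snd p)) \<le> K" ..
qed

lemma integrable_Linfty_smooth:
  fixes N :: "'n::finite"
  assumes f: "Linfty (Dom N g L T) f" and h: "smooth h" and g: "0 < g" and L: "0 < L"
  shows "integrable (lebesgue_on (cellDom N g L T)) (\<lambda>p. f p * h p :: real)"
proof -
  have cd: "cellDom N g L T \<in> sets lebesgue" by (rule fmeasurableD[OF cellDom_lmeasurable[OF g L]])
  obtain r where r: "\<And>p. p \<in> cellDom N g L T \<Longrightarrow> norm p \<le> r"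
    using cellDom_bounded[OF g L, where T = T and N = N] by blast
  obtain M where M: "\<And>p. norm p \<le> r \<Longrightarrow> \<bar>h p\<bar> \<le> M" using smooth_bounded[OF h] by blast
  have f': "Linfty (cellDom N g L T) f"
    by (rule Linfty_subset[OF f _ Dom_lebesgue cd]) auto
  then obtain K where K: "AE p in lebesgue_on (cellDom N g L T). norm (f p) \<le> K"
    by (auto simp: Linfty_def)
  interpret finite_measure "lebesgue_on (cellDom N g L T)"
    by (rule finite_measure_lebesgue_on[OF cellDom_lmeasurable[OF g L]])
  show ?thesis
  proof (rule integrable_const_bound[where B = "K * M"])
    show "AE p in lebesgue_on (cellDom N g L T). norm (f p * h p) \<le> K * M"
      using K lebesgue_on_AE_space[OF cd]
    proof eventually_elim
      fix p assume "norm (f p) \<le> K" "p \<in> cellDom N g L T"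
      then show "norm (f p * h p) \<le> K * M"
        using abs_mult_le[of "f p" K "h p" M] M[OF r] by simp
    qed
    show "(\<lambda>p. f p * h p) \<in> borel_measurable (lebesgue_on (cellDom N g L T))"
    proof -
      have "f \<in> borel_measurable (lebesgue_on (cellDom N g L T))"
        using f' unfolding Linfty_def by (rule conjunct1)
      then show ?thesis
        by (rule borel_measurable_times[OF _ borel_measurable_lebesgue_on[OF smooth_borel[OF h]]])
    qed
  qed
qed

text \<open>
  A bounded nonpositive density defines a functional of order 0: its continuity constant is the
  integral of the modulus of the density.
\<close>

lemma dissipation_measure_of_density:
  fixes N :: "'n::finite"
  assumes g: "0 < g" and L: "0 < L"
    and d: "Linfty (Dom N g L T) d" "periodic N d" and neg: "\<And>p. p \<in> Dom N g L T \<Longrightarrow> d p \<le> 0"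
  defines "\<nu> \<equiv> \<lambda>\<phi>. int_Dom N g L T (\<lambda>p. d p * \<phi> p)"
  shows "dissipation_measure N g L T \<nu>" "has_density N g L T \<nu> d"
proof -
  let ?M = "lebesgue_on (cellDom N g L T)"
  have cd: "cellDom N g L T \<in> sets lebesgue" by (rule fmeasurableD[OF cellDom_lmeasurable[OF g L]])
  have sp: "p \<in> Dom N g L T" if "p \<in> space ?M" for p using that cd by simp
  have di: "integrable ?M d"
    using integrable_Linfty_smooth[OF d(1) smooth_const[of 1] g L] by simp
  have i: "integrable ?M (\<lambda>p. d p * \<phi> p)" if "testfun N g L T \<phi>" for \<phi>
    using that by (intro integrable_Linfty_smooth d g L) (auto simp: testfun_def)
  show "has_density N g L T \<nu> d"
    using d di by (simp add: has_density_def Linfty_def \<nu>_def)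
  show "dissipation_measure N g L T \<nu>"
    unfolding dissipation_measure_def
  proof (intro conjI allI impI)
    fix \<phi> \<psi> :: "(real ^ 'n) \<times> real \<Rightarrow> real" and a b :: real
    assume t: "testfun N g L T \<phi>" "testfun N g L T \<psi>"
    have "\<nu> (\<lambda>p. a * \<phi> p + b * \<psi> p) = integral\<^sup>L ?M (\<lambda>p. a * (d p * \<phi> p) + b * (d p * \<psi> p))"
      by (simp add: \<nu>_def int_Dom_def algebra_simps)
    also have "\<dots> = a * \<nu> \<phi> + b * \<nu> \<psi>"
      using i[OF t(1)] i[OF t(2)] by (simp add: \<nu>_def int_Dom_def)
    finally show "\<nu> (\<lambda>p. a * \<phi> p + b * \<psi> p) = a * \<nu> \<phi> + b * \<nu> \<psi>" .
  next
    fix T' :: real assume "T' < T"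
    show "\<exists>k K. \<forall>\<phi> M. testfun N g L T \<phi> \<longrightarrow> vanishes_from N g L T T' \<phi> \<longrightarrow>
        derivs_le k M (Dbar N g L T) \<phi> \<longrightarrow> \<bar>\<nu> \<phi>\<bar> \<le> K * M"
    proof (rule exI[of _ 0], rule exI[of _ "integral\<^sup>L ?M (\<lambda>p. \<bar>d p\<bar>)"], intro allI impI)
      fix \<phi> :: "(real ^ 'n) \<times> real \<Rightarrow> real" and M
      assume t: "testfun N g L T \<phi>" and M: "derivs_le 0 M (Dbar N g L T) \<phi>"
      have "\<bar>\<nu> \<phi>\<bar> \<le> integral\<^sup>L ?M (\<lambda>p. \<bar>d p * \<phi> p\<bar>)"
        unfolding \<nu>_def int_Dom_def by (rule integral_abs_bound)
      also have "\<dots> \<le> integral\<^sup>L ?M (\<lambda>p. \<bar>d p\<bar> * M)"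
      proof (rule integral_mono)
        show "integrable ?M (\<lambda>p. \<bar>d p * \<phi> p\<bar>)" by (rule integrable_abs[OF i[OF t]])
        show "integrable ?M (\<lambda>p. \<bar>d p\<bar> * M)" by (intro integrable_mult_left integrable_abs di)
        fix p assume "p \<in> space ?M"
        then have "\<bar>\<phi> p\<bar> \<le> M" using sp M Dom_subset_Dbar by fastforce
        then show "\<bar>d p * \<phi> p\<bar> \<le> \<bar>d p\<bar> * M" unfolding abs_mult by (intro mult_left_mono) auto
      qed
      finally show "\<bar>\<nu> \<phi>\<bar> \<le> integral\<^sup>L ?M (\<lambda>p. \<bar>d p\<bar>) * M" by simp
    qed
  next
    fix \<phi> :: "(real ^ 'n) \<times> real \<Rightarrow> real"
    assume t: "testfun N g L T \<phi>" and pos: "\<forall>p\<in>Dbar N g L T. 0 \<le> \<phi> p"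
    have "0 \<le> integral\<^sup>L ?M (\<lambda>p. - (d p * \<phi> p))"
    proof (rule integral_nonneg_AE, rule AE_I2)
      fix p assume "p \<in> space ?M"
      then have p: "p \<in> Dom N g L T" by (rule sp)
      then have "0 \<le> \<phi> p" using pos Dom_subset_Dbar by (meson subsetD)
      then show "0 \<le> - (d p * \<phi> p)" using neg[OF p] by (simp add: mult_nonpos_nonneg)
    qed
    then show "\<nu> \<phi> \<le> 0" by (simp add: \<nu>_def int_Dom_def)
  qed
qed

lemma zproj:
  "zmu z = fst z" "zw z = fst (snd z)" "zm z = fst (snd (snd z))" "zh z = fst (snd (snd (snd z)))"
  "zsigma z = fst (snd (snd (snd (snd z))))" "ze z = snd (snd (snd (snd (snd z))))"
  by (cases z rule: zmu.cases; simp)+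

lemma lambda_max_scalar: "lambda_max (mat c :: real ^ 'n::finite ^ 'n) = c"
proof -
  have m: "mat c *v v = c *\<^sub>R v" for v :: "real ^ 'n"
  proof -
    have "(\<Sum>j\<in>UNIV. (if i = j then c else 0) * v $ j) = c * v $ i" for i :: 'n
    proof -
      have "(\<Sum>j\<in>UNIV. (if i = j then c else 0) * v $ j) = (\<Sum>j\<in>UNIV. if i = j then c * v $ j else 0)"
        by (rule sum.cong) auto
      then show ?thesis by simp
    qed
    then show ?thesis by (simp add: vec_eq_iff matrix_vector_mult_def mat_def)
  qed
  have "{l. \<exists>v :: real ^ 'n. v \<noteq> 0 \<and> mat c *v v = l *\<^sub>R v} = {c}"
    unfolding m using zero_neq_one[where 'a = "real ^ 'n"] by auto
  then show ?thesis by (simp add: lambda_max_def)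
qed

text \<open>
  Only the entry for the vertical direction of the bracket in Mtilde is nonzero, and after division it
  is f. Subtracting sigma leaves f - (n-1) f / n = f / n in this entry and 0 + f / n in the other
  diagonal entries.
\<close>

lemma Mtilde_one_dimensional:
  fixes N :: "'n::finite" and z :: "'n state"
  assumes w: "zw z = (g * t) *\<^sub>R axis N 1" and m: "\<And>j. j \<noteq> N \<Longrightarrow> zm z $ j = 0"
    and s: "zsigma z = sigma1d N (fz N rm rp g t z)" and mu: "rm < zmu z" "zmu z < rp"
  shows "Mtilde rm rp z = mat (fz N rm rp g t z / real CARD('n))"
proof -
  let ?f = "fz N rm rp g t z"
  define k where "k = (rp - zmu z) * (zmu z - rm)"
  have k: "k \<noteq> 0" using mu by (simp add: k_def)
  have f: "?f = (zmu z * rm * rp * (g * t) * (g * t)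
      - rm * rp * (zm z $ N * (g * t) + (g * t) * zm z $ N) + (rp + rm - zmu z) * zm z $ N * zm z $ N) / k"
    using mu by (simp add: fz_def f1d_def k_def power2_eq_square algebra_simps)
  have n: "real CARD('n) \<noteq> 0" by simp
  have "Mtilde rm rp z $ i $ j = (mat (?f / real CARD('n)) :: real ^ 'n ^ 'n) $ i $ j" for i j
  proof (cases "i = N \<and> j = N")
    case True
    have o: "outer (zw z) (zw z) $ N $ N = (g * t) * (g * t)" "outer (zm z) (zw z) $ N $ N = zm z $ N * (g * t)"
      "outer (zw z) (zm z) $ N $ N = (g * t) * zm z $ N" "outer (zm z) (zm z) $ N $ N = zm z $ N * zm z $ N"
      by (simp_all add: outer_def w)
    have sN: "zsigma z $ N $ N = (real CARD('n) - 1) * ?f / real CARD('n)"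
      unfolding s by (simp add: sigma1d_def)
    have "Mtilde rm rp z $ N $ N = 1 / k * (zmu z * rm * rp * ((g * t) * (g * t))
        - rm * rp * (zm z $ N * (g * t) + (g * t) * zm z $ N)
        + (rp + rm - zmu z) * (zm z $ N * zm z $ N)) - zsigma z $ N $ N"
      by (simp only: Mtilde_def k_def vector_minus_component vector_scaleR_component
          vector_add_component real_scaleR_def o)
    also have "\<dots> = ?f - (real CARD('n) - 1) * ?f / real CARD('n)"
      unfolding sN by (subst (1) f) (simp add: mult.assoc)
    also have "\<dots> = ?f / real CARD('n)" by (simp add: field_simps)
    finally show ?thesis using True by (simp add: mat_def)
  next
    case False
    then have "outer (zw z) (zw z) $ i $ j = 0" "outer (zm z) (zw z) $ i $ j = 0"
      "outer (zw z) (zm z) $ i $ j = 0" "outer (zm z) (zm z) $ i $ j = 0"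
      using m by (auto simp: outer_def w axis_def)
    then show ?thesis using False by (auto simp: Mtilde_def s sigma1d_def mat_def)
  qed
  then show ?thesis by (simp add: vec_eq_iff)
qed

lemma sigma1d_scale: "sigma1d N f = f *\<^sub>R sigma1d N 1"
  by (simp add: sigma1d_def vec_eq_iff)

text \<open>
  For \<open>\<gamma> = 1 - 2 / n\<close> this is the change of the dissipation density, divided by
  \<open>\<delta> t\<close>.
\<close>

definition fan_source :: "real \<Rightarrow> real \<Rightarrow> real \<Rightarrow> real \<Rightarrow> real \<Rightarrow> real" where
  "fan_source rm rp lam \<gamma> \<xi> = 2 * (prof rm rp lam \<xi>)\<^sup>2
     + 2 * (\<gamma> - \<xi>) * (prof rm rp lam \<xi> * prof_slope rm rp lam \<xi>)"

text \<open>
  One factor P can be split off, and the wave occupies a bounded range of the similarity variable.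
\<close>

lemma fan_source_le:
  assumes c: "0 < rm" "rm < rp" "0 < lam" "lam < 1" and \<gamma>: "\<bar>\<gamma>\<bar> \<le> 1"
  shows "\<bar>fan_source rm rp lam \<gamma> \<xi>\<bar> \<le>
    (2 * (rp * rp) + 2 * (2 + lam * ((rp - rm) / rm)) * (rp * rp ^ 3 / (lam * rm * rp))) * prof rm rp lam \<xi>"
proof (cases "prof rm rp lam \<xi> = 0")
  case True then show ?thesis by (simp add: fan_source_def)
next
  case False
  let ?p = "prof rm rp lam \<xi>" and ?s = "prof_slope rm rp lam \<xi>"
  have p: "0 \<le> ?p" "?p \<le> rp * rp" using prof_nonneg prof_le c by auto
  have 1: "\<bar>2 * (\<gamma> - \<xi>)\<bar> \<le> 2 * (2 + lam * ((rp - rm) / rm))"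
  proof -
    have "\<bar>\<gamma> - \<xi>\<bar> \<le> 2 + lam * ((rp - rm) / rm)"
      using prof_ne_0(2)[OF c False] \<gamma> by linarith
    then show ?thesis by (simp only: abs_mult) simp
  qed
  have "\<bar>2 * ?p + 2 * (\<gamma> - \<xi>) * ?s\<bar>
      \<le> 2 * (rp * rp) + 2 * (2 + lam * ((rp - rm) / rm)) * (rp * rp ^ 3 / (lam * rm * rp))"
    by (rule order_trans[OF abs_triangle_ineq], rule add_mono, use p in simp,
        rule abs_mult_le[OF 1 prof_slope_le[OF c(1-3)]])
  then have "\<bar>2 * ?p + 2 * (\<gamma> - \<xi>) * ?s\<bar> * ?p
      \<le> (2 * (rp * rp) + 2 * (2 + lam * ((rp - rm) / rm)) * (rp * rp ^ 3 / (lam * rm * rp))) * ?p"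
    using p by (intro mult_right_mono) auto
  moreover have "fan_source rm rp lam \<gamma> \<xi> = (2 * ?p + 2 * (\<gamma> - \<xi>) * ?s) * ?p"
    by (simp add: fan_source_def power2_eq_square algebra_simps)
  ultimately show ?thesis using p by (simp add: abs_mult)
qed

lemma entropy_solution_eq_fan_on_Dom:
  fixes N :: "'n::finite"
  assumes ent: "entropy_solution rm rp g lam T u" and T: "0 < T" and g: "0 < g"
    and c: "0 < rm" "rm < rp" "0 < lam" "lam \<le> 1"
  shows "AE p in lebesgue_on (Dom N g L T). u (fst p $ N, snd p) = fan rm rp lam (sim N g p)"
proof -
  define f where "f p = (fst p $ N, snd p)" for p :: "(real ^ 'n) \<times> real"
  define j :: "real \<times> real \<Rightarrow> (real ^ 'n) \<times> real"
    where "j = (\<lambda>v. (fst v *\<^sub>R axis N 1, snd v))"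
  have S: "strip T \<in> sets lebesgue" using strip_measurable by simp
  have "AE q in lebesgue. q \<in> strip T \<longrightarrow> u q = fan rm rp lam (2 * fst q / (g * (snd q)\<^sup>2))"
    using entropy_solution_eq_fan[OF ent T g c] S by (simp only: AE_restrict_space_iff sets.Int_space_eq2)
  then have "AE p in lebesgue. f p \<in> strip T \<longrightarrow>
      u (f p) = fan rm rp lam (2 * fst (f p) / (g * (snd (f p))\<^sup>2))"
  proof (rule AE_lebesgue_pullback[of f j, rotated 3])
    show "f \<in> borel_measurable borel" unfolding f_def
      by (intro borel_measurable_continuous_onI continuous_intros)
    show "j \<in> borel_measurable borel" unfolding j_def
      by (intro borel_measurable_continuous_onI continuous_intros)
    show "f (p + j v) = f p + v" for p v by (cases v) (simp add: f_def j_def)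
  qed
  then have "AE p in lebesgue. p \<in> Dom N g L T \<longrightarrow> u (fst p $ N, snd p) = fan rm rp lam (sim N g p)"
    by eventually_elim (auto simp: f_def sim_def Dom_iff)
  then show ?thesis
    using Dom_lebesgue[of N g L T] by (simp add: AE_restrict_space_iff)
qed


section \<open>Raising the energy\<close>

definition energy_gain :: "real \<Rightarrow> real \<Rightarrow> real \<Rightarrow> real \<Rightarrow> 'n::finite state \<Rightarrow> real" where
  "energy_gain rm rp \<delta> t z = \<delta> * t\<^sup>2 * (rp - zmu z)\<^sup>2 * (zmu z - rm)\<^sup>2"

text \<open>
  If the pressure drops by (2/n) A at the same time, e + q grows by (1 - 2/n) A; the change of h
  compensates this.
\<close>

definition raise_energy :: "real \<Rightarrow> 'n::finite state \<Rightarrow> 'n state" where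
  "raise_energy A z = (zmu z, zw z, zm z, zh z + ((1 - 2 / real CARD('n)) * A) *\<^sub>R zw z, zsigma z, ze z + A)"

lemma raise_energy_simps [simp]:
  fixes z :: "'n::finite state"
  shows "zmu (raise_energy A z) = zmu z" "zw (raise_energy A z) = zw z" "zm (raise_energy A z) = zm z"
  "zh (raise_energy A z) = zh z + ((1 - 2 / real CARD('n)) * A) *\<^sub>R zw z"
  "zsigma (raise_energy A z) = zsigma z" "ze (raise_energy A z) = ze z + A"
  "Tplus rm rp (raise_energy A z) = Tplus rm rp z" "Tminus rm rp (raise_energy A z) = Tminus rm rp z"
  "Mtilde rm rp (raise_energy A z) = Mtilde rm rp z"
  by (simp_all add: raise_energy_def Tplus_def Tminus_def Mtilde_def)

lemma continuous_on_zproj: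
  "continuous_on S zmu" "continuous_on S zw" "continuous_on S zm" "continuous_on S zh"
  "continuous_on S zsigma" "continuous_on S ze"
  unfolding zproj by (intro continuous_intros)+

lemma continuous_on_zproj_comp:
  assumes "continuous_on S f"
  shows "continuous_on S (\<lambda>x. zmu (f x))" "continuous_on S (\<lambda>x. zw (f x))" "continuous_on S (\<lambda>x. zm (f x))"
    "continuous_on S (\<lambda>x. zh (f x))" "continuous_on S (\<lambda>x. zsigma (f x))" "continuous_on S (\<lambda>x. ze (f x))"
  unfolding zproj by (intro continuous_intros assms)+

lemma continuous_on_energy_gain:
  assumes "continuous_on S f" "continuous_on S \<tau>"
  shows "continuous_on S (\<lambda>x. energy_gain rm rp \<delta> (\<tau> x) (f x))"
  unfolding energy_gain_def by (intro continuous_intros continuous_on_zproj_comp assms)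

lemma continuous_on_raise_energy:
  assumes "continuous_on S f" "continuous_on S A"
  shows "continuous_on S (\<lambda>x. raise_energy (A x) (f x))"
  unfolding raise_energy_def by (intro continuous_intros continuous_on_zproj_comp assms)

text \<open>
  The structure of a one-dimensional state is known almost everywhere only, whereas the strict
  inequality is required at every point of the mixing zone. Continuity closes the gap; for sigma this
  uses that the denominator of f does not vanish there.
\<close>

lemma one_dimensional_on_mixing_zone:
  fixes N :: "'n::finite"
  assumes mix: "mixing_zone N rm rp g L T z q U" and od: "one_dimensional N rm rp g L T z q \<nu>"
    and p: "p \<in> U"
  shows "zw (z p) = (g * snd p) *\<^sub>R axis N 1" and "\<And>j. j \<noteq> N \<Longrightarrow> zm (z p) $ j = 0"
    and "zsigma (z p) = sigma1d N (fz N rm rp g (snd p) (z p))"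
proof -
  have U: "open U" "U \<subseteq> Dom N g L T" and zc: "continuous_on U z"
    and mu: "\<And>p. p \<in> U \<Longrightarrow> rm < zmu (z p) \<and> zmu (z p) < rp"
    using mix by (auto simp: mixing_zone_def)
  have AE: "AE p in lebesgue_on (Dom N g L T).
        zw (z p) = (g * snd p) *\<^sub>R axis N 1 \<and>
        (\<forall>j. j \<noteq> N \<longrightarrow> zm (z p) $ j = 0 \<and> zh (z p) $ j = 0) \<and>
        zsigma (z p) = sigma1d N (fz N rm rp g (snd p) (z p))"
    using od by (simp add: one_dimensional_def)
  note eqI = AE_eq_imp_eq_on_open[OF U Dom_lebesgue _ _ _ p]
  show "zw (z p) = (g * snd p) *\<^sub>R axis N 1"
  proof (rule eqI)
    show "continuous_on U (\<lambda>p. zw (z p))" by (rule continuous_on_zproj_comp[OF zc])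
    show "continuous_on U (\<lambda>p. (g * snd p) *\<^sub>R axis N 1 :: real ^ 'n)" by (intro continuous_intros)
    show "AE p in lebesgue_on (Dom N g L T). zw (z p) = (g * snd p) *\<^sub>R axis N 1"
      using AE by eventually_elim simp
  qed
  show "zm (z p) $ j = 0" if j: "j \<noteq> N" for j
  proof (rule eqI)
    show "continuous_on U (\<lambda>p. zm (z p) $ j)" by (intro continuous_intros continuous_on_zproj_comp[OF zc])
    show "continuous_on U (\<lambda>p. 0)" by (intro continuous_intros)
    show "AE p in lebesgue_on (Dom N g L T). zm (z p) $ j = 0"
      using AE by eventually_elim (use j in simp)
  qed
  show "zsigma (z p) = sigma1d N (fz N rm rp g (snd p) (z p))"
  proof (rule eqI)
    show "continuous_on U (\<lambda>p. zsigma (z p))" by (rule continuous_on_zproj_comp[OF zc])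
    have "continuous_on U (\<lambda>p. (zmu (z p) * rm * rp * g\<^sup>2 * (snd p)\<^sup>2 - 2 * rm * rp * zm (z p) $ N * g * snd p
        + (rp + rm - zmu (z p)) * (zm (z p) $ N)\<^sup>2) / ((rp - zmu (z p)) * (zmu (z p) - rm)))"
      by (intro continuous_intros continuous_on_zproj_comp[OF zc]) (use mu in fastforce)
    then have "continuous_on U (\<lambda>p. fz N rm rp g (snd p) (z p))"
      by (rule continuous_on_cong[THEN iffD1, rotated 2, OF _ refl]) (use mu in \<open>simp add: fz_def f1d_def\<close>)
    then have "continuous_on U (\<lambda>p. fz N rm rp g (snd p) (z p) *\<^sub>R sigma1d N 1)"
      by (intro continuous_intros)
    then show "continuous_on U (\<lambda>p. sigma1d N (fz N rm rp g (snd p) (z p)))"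
      by (subst sigma1d_scale)
    show "AE p in lebesgue_on (Dom N g L T). zsigma (z p) = sigma1d N (fz N rm rp g (snd p) (z p))"
      using AE by eventually_elim simp
  qed
qed

lemma bpt_notin_Dom: "s \<in> {1, - 1} \<Longrightarrow> bpt N g L s p \<notin> Dom N g L T"
  by (cases p) (auto simp: bpt_def Dom_iff)

lemma periodic_Dom: "periodic N (\<lambda>p. p \<in> Dom N g L T)"
  by (auto simp: periodic_def Dom_iff axis_def)

lemma mat_component: "mat k $ i $ j = (if i = j then k else 0)"
  by (simp add: mat_def)

text \<open>
  The norm is exactly 0, so the coefficient 1 could be replaced by any other.
\<close>

lemma raised_strict_inequality:
  fixes N :: "'n::finite"
  assumes mix: "mixing_zone N rm rp g L T z q U" and od: "one_dimensional N rm rp g L T z q \<nu>"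
    and p: "p \<in> U"
    and e: "ze (z p) = (1/2) * fz N rm rp g (snd p) (z p)"
    and h: "zh (z p) = (ze (z p) + q p) *\<^sub>R zw (z p)
             + ((Tplus rm rp (z p) - Tminus rm rp (z p)) / (rp - rm)) *\<^sub>R
                 (zm (z p) - zmu (z p) *\<^sub>R zw (z p))"
    and A: "0 < A" and zd: "zd = raise_energy A (z p)" and qd: "qd = q p - 2 / real CARD('n) * A"
  shows "lambda_max (Mtilde rm rp zd)
           + 1 * norm (zh zd - (ze zd + qd) *\<^sub>R zw zd
                - ((Tplus rm rp zd - Tminus rm rp zd) / (rp - rm)) *\<^sub>R (zm zd - zmu zd *\<^sub>R zw zd))
           < 2 / real CARD('n) * ze zd"
proof -
  let ?n = "real CARD('n)" and ?f = "fz N rm rp g (snd p) (z p)"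
  have mu: "rm < zmu (z p)" "zmu (z p) < rp" using mix p by (auto simp: mixing_zone_def)
  have "Mtilde rm rp zd = mat (?f / ?n)"
    unfolding zd raise_energy_simps
    by (rule Mtilde_one_dimensional) (use one_dimensional_on_mixing_zone[OF mix od p] mu in auto)
  then have l: "lambda_max (Mtilde rm rp zd) = ?f / ?n" by (simp add: lambda_max_scalar)
  have "(ze zd + qd) *\<^sub>R zw zd = (ze (z p) + q p) *\<^sub>R zw (z p) + ((1 - 2 / ?n) * A) *\<^sub>R zw (z p)"
  proof -
    have "ze zd + qd = (ze (z p) + q p) + (1 - 2 / ?n) * A" by (simp add: zd qd algebra_simps)
    then show ?thesis by (simp only: scaleR_add_left zd raise_energy_simps)
  qed
  then have "zh zd - (ze zd + qd) *\<^sub>R zw zd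
      - ((Tplus rm rp zd - Tminus rm rp zd) / (rp - rm)) *\<^sub>R (zm zd - zmu zd *\<^sub>R zw zd) = 0"
    by (simp add: zd h)
  moreover have "?f / ?n < 2 / ?n * ze zd"
    using A by (simp add: zd e divide_strict_right_mono field_simps)
  ultimately show ?thesis using l by simp
qed

lemma raised_mixing_zone:
  fixes N :: "'n::finite"
  assumes mix: "mixing_zone N rm rp g L T z q U"
    and qL: "Linfty (Dom N g L T) qd"
    and zd: "\<And>p. zd p = raise_energy (energy_gain rm rp \<delta> (snd p) (z p)) (z p)"
    and qd: "\<And>p. p \<in> Dom N g L T \<Longrightarrow> qd p = q p - 2 / real CARD('n) * energy_gain rm rp \<delta> (snd p) (z p)"
  shows "mixing_zone N rm rp g L T zd qd U"
proof -
  have U: "open U" "U \<subseteq> Dom N g L T" "periodic N (\<lambda>p. p \<in> U)" "continuous_on U z" "continuous_on U q"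
    "Linfty U (\<lambda>p. Tplus rm rp (z p))" "Linfty U (\<lambda>p. Tminus rm rp (z p))"
    "\<forall>p\<in>U. rm < zmu (z p) \<and> zmu (z p) < rp"
    and out: "AE p in lebesgue_on (Dom N g L T - U).
        zm (z p) = zmu (z p) *\<^sub>R zw (z p) \<and>
        zh (z p) = (ze (z p) + q p) *\<^sub>R zw (z p) \<and>
        zmu (z p) *\<^sub>R outer (zw (z p)) (zw (z p))
          = zsigma (z p) + mat (2 / real CARD('n) * ze (z p)) \<and>
        zmu (z p) \<in> {rm, rp}"
    using mix unfolding mixing_zone_def by blast+
  have Ul: "U \<in> sets lebesgue" using borel_open[OF U(1)] by simp
  have gain: "continuous_on U (\<lambda>p. energy_gain rm rp \<delta> (snd p) (z p))"
    by (intro continuous_on_energy_gain U continuous_on_snd continuous_on_id)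
  show ?thesis
    unfolding mixing_zone_def
  proof (intro conjI U)
    show "continuous_on U zd"
      unfolding zd[abs_def] by (intro continuous_on_raise_energy U gain)
    show "Linfty U qd" by (rule Linfty_subset[OF qL U(2) Dom_lebesgue Ul])
    have "continuous_on U (\<lambda>p. q p - 2 / real CARD('n) * energy_gain rm rp \<delta> (snd p) (z p))"
      by (intro continuous_intros U gain)
    then show "continuous_on U qd"
      by (rule continuous_on_eq) (use U qd in auto)
    show "Linfty U (\<lambda>p. Tplus rm rp (zd p))" "Linfty U (\<lambda>p. Tminus rm rp (zd p))"
      using U by (simp_all add: zd)
    show "\<forall>p\<in>U. rm < zmu (zd p) \<and> zmu (zd p) < rp" using U by (simp add: zd)
    have "AE p in lebesgue_on (Dom N g L T - U). p \<in> Dom N g L T - U"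
      by (rule lebesgue_on_AE_space) (intro sets.Diff Dom_lebesgue Ul)
    with out show "AE p in lebesgue_on (Dom N g L T - U).
        zm (zd p) = zmu (zd p) *\<^sub>R zw (zd p) \<and>
        zh (zd p) = (ze (zd p) + qd p) *\<^sub>R zw (zd p) \<and>
        zmu (zd p) *\<^sub>R outer (zw (zd p)) (zw (zd p))
          = zsigma (zd p) + mat (2 / real CARD('n) * ze (zd p)) \<and>
        zmu (zd p) \<in> {rm, rp}"
    proof eventually_elim
      case (elim p)
      then have "energy_gain rm rp \<delta> (snd p) (z p) = 0" by (auto simp: energy_gain_def)
      then show ?case using elim qd[of p] by (simp add: zd)
    qed
  qed
qed


section \<open>The perturbed subsolution\<close>

definition raised_density :: "'n::finite \<Rightarrow> real \<Rightarrow> real \<Rightarrow> real \<Rightarrow> real \<Rightarrow> real \<Rightarrow> (real ^ 'n) \<times> real \<Rightarrow> real" where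
  "raised_density N rm rp g lam \<delta> p =
     lam * (2 * lam - 1) * g\<^sup>2 * snd p * afun rm rp (fan rm rp lam (sim N g p))
     + \<delta> * (snd p * fan_source rm rp lam (1 - 2 / real CARD('n)) (sim N g p))"

text \<open>
  The constant of \<open>fan_source_le\<close>; it serves as the constant C of the main result.
\<close>

definition gain_rate :: "real \<Rightarrow> real \<Rightarrow> real \<Rightarrow> real" where
  "gain_rate rm rp lam =
     2 * (rp * rp) + 2 * (2 + lam * ((rp - rm) / rm)) * (rp * rp ^ 3 / (lam * rm * rp))"

lemma afun_fan:
  "afun rm rp (fan rm rp lam \<xi>) = prof rm rp lam \<xi> / (rp + rm - fan rm rp lam \<xi>)"
  by (simp add: afun_def prof_def)

context
  fixes rm rp lam g :: real
  assumes c: "0 < rm" "rm < rp" "0 < lam" "lam < 1/2" and g: "0 < g"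
begin

lemma gain_rate_pos: "0 < gain_rate rm rp lam"
  unfolding gain_rate_def using c by (intro add_pos_nonneg mult_nonneg_nonneg) auto

lemma raised_density_error:
  fixes N :: "'n::finite"
  assumes \<delta>: "0 < \<delta>" and t: "0 < snd p" and n: "2 \<le> CARD('n)"
  shows "\<bar>raised_density N rm rp g lam \<delta> p
      - lam * (2 * lam - 1) * g\<^sup>2 * snd p * afun rm rp (fan rm rp lam (sim N g p))\<bar>
    \<le> gain_rate rm rp lam * \<delta> * snd p * prof rm rp lam (sim N g p)"
proof -
  have "\<bar>1 - 2 / real CARD('n)\<bar> \<le> 1" using n by (simp add: field_simps)
  then have "\<bar>fan_source rm rp lam (1 - 2 / real CARD('n)) (sim N g p)\<bar>
      \<le> gain_rate rm rp lam * prof rm rp lam (sim N g p)"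
    unfolding gain_rate_def using c by (intro fan_source_le) auto
  then have "(\<delta> * snd p) * \<bar>fan_source rm rp lam (1 - 2 / real CARD('n)) (sim N g p)\<bar>
      \<le> (\<delta> * snd p) * (gain_rate rm rp lam * prof rm rp lam (sim N g p))"
    using \<delta> t by (intro mult_left_mono) auto
  then show ?thesis using \<delta> t by (simp add: raised_density_def abs_mult mult_ac)
qed

text \<open>
  The original density is at most -lam (1 - 2 lam) g^2 t P / rp, since the denominator of a is at most
  rp; the perturbation is at most the multiple \<open>gain_rate * \<delta>\<close> of t P.
\<close>

lemma raised_density_nonpos:
  fixes N :: "'n::finite"
  assumes \<delta>: "0 < \<delta>" "\<delta> \<le> lam * (1 - 2 * lam) * g\<^sup>2 / (rp * gain_rate rm rp lam)"
    and t: "0 < snd p" and n: "2 \<le> CARD('n)"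
  shows "raised_density N rm rp g lam \<delta> p \<le> 0"
proof -
  let ?P = "prof rm rp lam (sim N g p)" and ?v = "fan rm rp lam (sim N g p)"
  have P: "0 \<le> ?P" by (rule prof_nonneg) (use c in auto)
  have v: "rm \<le> ?v" "?v \<le> rp" using fan_range[of rm rp lam] c by auto
  have a: "?P / rp \<le> afun rm rp ?v"
    unfolding afun_fan using P v c by (intro divide_left_mono) auto
  have "gain_rate rm rp lam * \<delta> \<le> lam * (1 - 2 * lam) * g\<^sup>2 / rp"
    using \<delta> gain_rate_pos c by (simp add: field_simps)
  then have "gain_rate rm rp lam * \<delta> * (snd p * ?P) \<le> lam * (1 - 2 * lam) * g\<^sup>2 / rp * (snd p * ?P)"
    using t P by (intro mult_right_mono) auto
  also have "\<dots> = lam * (1 - 2 * lam) * g\<^sup>2 * snd p * (?P / rp)" by simp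
  also have "\<dots> \<le> lam * (1 - 2 * lam) * g\<^sup>2 * snd p * afun rm rp ?v"
    using a c g t by (intro mult_left_mono) auto
  also have "\<dots> = - (lam * (2 * lam - 1) * g\<^sup>2 * snd p * afun rm rp ?v)" by (simp add: algebra_simps)
  finally show ?thesis using raised_density_error[OF \<delta>(1) t n, of N] by (simp add: mult.assoc)
qed

lemma fan_source_borel: "fan_source rm rp lam \<gamma> \<in> borel_measurable borel"
  unfolding fan_source_def using prof_borel[OF c(1-3)] by measurable

lemma Linfty_fan_source:
  fixes N :: "'n::finite"
  assumes n: "2 \<le> CARD('n)"
  shows "Linfty (Dom N g L T) (\<lambda>p. snd p * fan_source rm rp lam (1 - 2 / real CARD('n)) (sim N g p))"
proof (rule Linfty_of_bounded[where K = "T * (gain_rate rm rp lam * (rp * rp))"])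
  have "(snd :: (real ^ 'n) \<times> real \<Rightarrow> real) \<in> borel_measurable borel"
    by (intro borel_measurable_continuous_onI continuous_on_snd continuous_on_id)
  then show "(\<lambda>p. snd p * fan_source rm rp lam (1 - 2 / real CARD('n)) (sim N g p)) \<in> borel_measurable borel"
    using measurable_compose[OF sim_borel fan_source_borel] by (rule borel_measurable_times)
  fix p assume p: "p \<in> Dom N g L T"
  have "\<bar>1 - 2 / real CARD('n)\<bar> \<le> 1" using n by (simp add: field_simps)
  then have "\<bar>fan_source rm rp lam (1 - 2 / real CARD('n)) (sim N g p)\<bar>
      \<le> gain_rate rm rp lam * prof rm rp lam (sim N g p)"
    unfolding gain_rate_def using c by (intro fan_source_le) auto
  also have "\<dots> \<le> gain_rate rm rp lam * (rp * rp)"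
    using gain_rate_pos prof_le[OF c(1-3)] by (intro mult_left_mono) auto
  finally show "\<bar>snd p * fan_source rm rp lam (1 - 2 / real CARD('n)) (sim N g p)\<bar>
      \<le> T * (gain_rate rm rp lam * (rp * rp))"
    using p by (intro abs_mult_le) (auto simp: Dom_iff)
qed (rule Dom_lebesgue)

lemma Linfty_raised_density:
  fixes N :: "'n::finite"
  assumes n: "2 \<le> CARD('n)"
  shows "Linfty (Dom N g L T) (raised_density N rm rp g lam \<delta>)"
proof -
  let ?b = "\<lambda>p. lam * (2 * lam - 1) * g\<^sup>2 * (snd p * afun rm rp (fan rm rp lam (sim N g p)))"
  let ?s = "\<lambda>p. snd p * fan_source rm rp lam (1 - 2 / real CARD('n)) (sim N g p)"
  have b: "Linfty (Dom N g L T) ?b"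
  proof (rule Linfty_of_bounded[where K = "\<bar>lam * (2 * lam - 1) * g\<^sup>2\<bar> * (T * (rp * rp / rm))"])
    have [measurable]: "(snd :: (real ^ 'n) \<times> real \<Rightarrow> real) \<in> borel_measurable borel"
      by (intro borel_measurable_continuous_onI continuous_on_snd continuous_on_id)
    have [measurable]: "afun rm rp \<in> borel_measurable borel" unfolding afun_def by measurable
    have [measurable]: "fan rm rp lam \<in> borel_measurable borel" by (rule fan_borel[OF c(1-3)])
    have [measurable]: "sim N g \<in> borel_measurable borel" by (rule sim_borel)
    show "?b \<in> borel_measurable borel" by measurable
    fix p assume p: "p \<in> Dom N g L T"
    let ?v = "fan rm rp lam (sim N g p)"
    have v: "rm \<le> ?v" "?v \<le> rp" using fan_range[of rm rp lam] c by auto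
    have "0 \<le> prof rm rp lam (sim N g p)" "prof rm rp lam (sim N g p) \<le> rp * rp"
      using prof_nonneg prof_le c by auto
    then have "\<bar>afun rm rp ?v\<bar> \<le> rp * rp / rm"
      unfolding afun_fan using v c by (simp add: frac_le)
    then show "\<bar>?b p\<bar> \<le> \<bar>lam * (2 * lam - 1) * g\<^sup>2\<bar> * (T * (rp * rp / rm))"
      using p by (intro abs_mult_le) (auto simp: Dom_iff)
  qed (rule Dom_lebesgue)
  have s: "Linfty (Dom N g L T) (\<lambda>p. - \<delta> * ?s p)"
  proof -
    have "continuous_on UNIV (\<lambda>x::real \<times> real. - \<delta> * fst x)" by (intro continuous_intros)
    moreover have "\<bar>snd p\<bar> \<le> T" if "p \<in> Dom N g L T" for p using that by (simp add: Dom_iff)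
    ultimately show ?thesis using Linfty_compose[OF Linfty_fan_source[OF n] _ Dom_lebesgue] by fastforce
  qed
  show ?thesis
    by (rule Linfty_cong[OF Linfty_diff[OF b s] _ Dom_lebesgue]) (simp add: raised_density_def mult.assoc)
qed

text \<open>
  Only the energy equation changes. On the domain its integrand grows by A d\<Psi>/dt + (1 - 2/n) g t
  A d\<Psi>/dy_n, where A = \<delta> t^2 P^2 almost everywhere by the identification of the density
  with the rarefaction wave, and integration by parts turns this into the additional dissipation
  density. The pressure is left unchanged outside the open domain so that its traces on the lateral
  boundary stay the same.
\<close>

lemma raised_weak_solution:
  fixes N :: "'n::finite"
  assumes n: "2 \<le> CARD('n)" and L: "0 < L" and T0: "0 < T"
    and T: "lam * ((rp - rm) / rm) * (g * T\<^sup>2 / 2) < L"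
    and ws: "weak_solution N rm rp g L T z q \<nu>"
    and mu: "AE p in lebesgue_on (Dom N g L T). zmu (z p) = fan rm rp lam (sim N g p)"
    and w: "AE p in lebesgue_on (Dom N g L T). zw (z p) = (g * snd p) *\<^sub>R axis N 1"
    and dens: "has_density N g L T \<nu> (\<lambda>p. lam * (2 * lam - 1) * g\<^sup>2 * snd p * afun rm rp (zmu (z p)))"
    and \<delta>: "0 < \<delta>" "\<delta> \<le> lam * (1 - 2 * lam) * g\<^sup>2 / (rp * gain_rate rm rp lam)"
  defines "A \<equiv> \<lambda>p. energy_gain rm rp \<delta> (snd p) (z p)"
  defines "zd \<equiv> \<lambda>p. raise_energy (A p) (z p)"
    and "qd \<equiv> \<lambda>p. if p \<in> Dom N g L T then q p - 2 / real CARD('n) * A p else q p"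
    and "\<nu>d \<equiv> \<lambda>\<phi>. int_Dom N g L T (\<lambda>p. raised_density N rm rp g lam \<delta> p * \<phi> p)"
  shows "weak_solution N rm rp g L T zd qd \<nu>d"
    and "has_density N g L T \<nu>d (raised_density N rm rp g lam \<delta>)"
    and "Linfty (Dom N g L T) qd"
proof -
  let ?D = "Dom N g L T" and ?M = "lebesgue_on (cellDom N g L T)"
  let ?\<gamma> = "1 - 2 / real CARD('n)"
  have W: "periodic N z" "periodic N q" "Linfty ?D z" "AE p in lebesgue_on ?D. z p \<in> Zset"
    "Linfty ?D q" "\<forall>s\<in>{1, -1}. integrable (lebesgue_on (bdry_cell T)) (\<lambda>p. q (bpt N g L s p))"
    and momentum: "\<And>\<Phi> :: (real ^ 'n) \<times> real \<Rightarrow> real ^ 'n. testfun N g L T \<Phi> \<Longrightarrow>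
        int_Dom N g L T (\<lambda>p.
            zm (z p) \<bullet> pd \<Phi> (0, 1) p
            + (\<Sum>i\<in>UNIV. \<Sum>j\<in>UNIV.
                 (zsigma (z p) + mat (2 / real CARD('n) * ze (z p)) + mat (q p)) $ i $ j
                 * pd \<Phi> (axis j 1, 0) p $ i))
        - int_bdry_normal N g L T (\<lambda>p. q p * \<Phi> p $ N) = 0"
    and scalar: "\<And>\<Psi> :: (real ^ 'n) \<times> real \<Rightarrow> real. testfun N g L T \<Psi> \<Longrightarrow>
        int_Dom N g L T (\<lambda>p. \<Sum>i\<in>UNIV.
            (zw (z p) - (g * snd p) *\<^sub>R axis N 1) $ i * pd \<Psi> (axis i 1, 0) p) = 0 \<and>
        int_Dom N g L T (\<lambda>p. zmu (z p) * pd \<Psi> (0, 1) p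
            + (\<Sum>i\<in>UNIV. zm (z p) $ i * pd \<Psi> (axis i 1, 0) p))
          + int_Omega N L (\<lambda>x. rho0 rm rp (x $ N) * \<Psi> (x, 0)) = 0 \<and>
        int_Dom N g L T (\<lambda>p. ze (z p) * pd \<Psi> (0, 1) p
            + (\<Sum>i\<in>UNIV. zh (z p) $ i * pd \<Psi> (axis i 1, 0) p))
          - int_bdry_normal N g L T (\<lambda>p. g * snd p * q p * \<Psi> p) = - \<nu> \<Psi>"
    using ws unfolding weak_solution_def by blast+
  have cd: "cellDom N g L T \<in> sets lebesgue" by (rule fmeasurableD[OF cellDom_lmeasurable[OF g L]])
  have snd_le: "\<bar>snd p\<bar> \<le> T" if "p \<in> ?D" for p using that by (simp add: Dom_iff)
  have comp: "Linfty ?D (\<lambda>p. \<Theta> (z p, snd p))" if "continuous_on UNIV \<Theta>"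
    for \<Theta> :: "'n state \<times> real \<Rightarrow> 'x::euclidean_space"
    by (rule Linfty_compose[OF W(3) that Dom_lebesgue snd_le])
  have zdL: "Linfty ?D zd"
    using comp[of "\<lambda>x. raise_energy (energy_gain rm rp \<delta> (snd x) (fst x)) (fst x)"]
    by (simp add: zd_def A_def continuous_on_raise_energy continuous_on_energy_gain continuous_on_fst continuous_on_snd)
  have AL': "Linfty ?D (\<lambda>p. 2 / real CARD('n) * A p)"
  proof -
    have "continuous_on UNIV (\<lambda>x :: 'n state \<times> real. 2 / real CARD('n) * energy_gain rm rp \<delta> (snd x) (fst x))"
      by (intro continuous_on_mult continuous_on_const continuous_on_energy_gain continuous_on_fst
          continuous_on_snd continuous_on_id)
    from comp[OF this] show ?thesis by (simp add: A_def)
  qed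
  show qdL: "Linfty ?D qd"
    by (rule Linfty_cong[OF Linfty_diff[OF W(5) AL'] _ Dom_lebesgue]) (simp add: qd_def)
  have per: "periodic N (raised_density N rm rp g lam \<delta>)"
    by (auto simp: periodic_def raised_density_def sim_def axis_def)
  have neg: "raised_density N rm rp g lam \<delta> p \<le> 0" if "p \<in> ?D" for p
    using that by (intro raised_density_nonpos \<delta> n) (auto simp: Dom_iff)
  note \<nu>d = dissipation_measure_of_density[OF g L Linfty_raised_density[OF n] per neg]
  show "has_density N g L T \<nu>d (raised_density N rm rp g lam \<delta>)"
    unfolding \<nu>d_def by (rule \<nu>d(2))
  have q_bdry: "qd (bpt N g L s p) = q (bpt N g L s p)" if "s \<in> {1, - 1}" for s p
    using bpt_notin_Dom[OF that, of N g L p T] by (simp add: qd_def)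
  have int_bdry: "int_bdry_normal N g L T (\<lambda>p. F p (qd p)) = int_bdry_normal N g L T (\<lambda>p. F p (q p))"
    for F by (simp add: int_bdry_normal_def q_bdry)
  have mom_eq: "(zsigma (zd p) + mat (2 / real CARD('n) * ze (zd p)) + mat (qd p)) $ i $ j
      = (zsigma (z p) + mat (2 / real CARD('n) * ze (z p)) + mat (q p)) $ i $ j"
    if "p \<in> ?D" for p and i j :: 'n
    using that by (simp add: zd_def qd_def mat_component algebra_simps add_divide_distrib)
  have energy: "int_Dom N g L T (\<lambda>p. ze (zd p) * pd \<Psi> (0, 1) p
            + (\<Sum>i\<in>UNIV. zh (zd p) $ i * pd \<Psi> (axis i 1, 0) p))
          - int_bdry_normal N g L T (\<lambda>p. g * snd p * qd p * \<Psi> p) = - \<nu>d \<Psi>"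
    if \<Psi>: "testfun N g L T \<Psi>" for \<Psi> :: "(real ^ 'n) \<times> real \<Rightarrow> real"
  proof -
    have sm: "smooth \<Psi>" using \<Psi> by (simp add: testfun_def)
    let ?E = "\<lambda>z p. ze (z p) * pd \<Psi> (0, 1) p + (\<Sum>i\<in>UNIV. zh (z p) $ i * pd \<Psi> (axis i 1, 0) p)"
    define B where "B p = (prof rm rp lam (sim N g p))\<^sup>2" for p :: "(real ^ 'n) \<times> real"
    let ?F = "\<lambda>p. (snd p)\<^sup>2 * B p * pd \<Psi> (0, 1) p
      + ?\<gamma> * (g * snd p) * ((snd p)\<^sup>2 * B p) * pd \<Psi> (axis N 1, 0) p
      + snd p * fan_source rm rp lam ?\<gamma> (sim N g p) * \<Psi> p"
    let ?S = "\<lambda>p. snd p * fan_source rm rp lam ?\<gamma> (sim N g p) * \<Psi> p"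
    let ?d = "\<lambda>p. lam * (2 * lam - 1) * g\<^sup>2 * snd p * afun rm rp (fan rm rp lam (sim N g p))"
    have F0: "integral\<^sup>L ?M ?F = 0"
      using int_Dom_fan_by_parts[OF c(1-3) _ g L T0 T \<Psi>, of ?\<gamma>] c
      by (simp add: int_Dom_def fan_source_def B_def)
    have smt: "smooth (pd \<Psi> (0, 1))" by (rule smooth_pd[OF sm time_in_Basis_prod])
    have smx: "smooth (pd \<Psi> (axis i 1, 0))" for i by (rule smooth_pd[OF sm axis_in_Basis_prod])
    have iE: "integrable ?M (?E z)"
    proof (intro Bochner_Integration.integrable_add Bochner_Integration.integrable_sum)
      show "integrable ?M (\<lambda>p. ze (z p) * pd \<Psi> (0, 1) p)"
        using comp[of "\<lambda>x. ze (fst x)"]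
        by (intro integrable_Linfty_smooth smt g L) (simp add: continuous_on_zproj_comp continuous_on_fst)
      show "integrable ?M (\<lambda>p. zh (z p) $ i * pd \<Psi> (axis i 1, 0) p)" for i
        using comp[of "\<lambda>x. zh (fst x) $ i"]
        by (intro integrable_Linfty_smooth smx g L)
          (simp add: continuous_on_zproj_comp continuous_on_fst continuous_on_component)
    qed
    have iS: "integrable ?M ?S"
      by (intro integrable_Linfty_smooth sm g L Linfty_fan_source n)
    have snd_m[measurable]: "(snd :: (real ^ 'n) \<times> real \<Rightarrow> real) \<in> borel_measurable borel"
      by (intro borel_measurable_continuous_onI continuous_on_snd continuous_on_id)
    have B_m[measurable]: "B \<in> borel_measurable borel"
      unfolding B_def using measurable_compose[OF sim_borel prof_borel(1)[OF c(1-3)]] by measurable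
    have Bb: "\<bar>B p\<bar> \<le> (rp * rp) * (rp * rp)" for p
      unfolding B_def power2_eq_square using prof_nonneg[OF c(1-3)] prof_le[OF c(1-3)]
      by (intro abs_mult_le) (simp_all add: abs_of_nonneg)
    have tB: "\<bar>(snd p)\<^sup>2 * B p\<bar> \<le> T * T * ((rp * rp) * (rp * rp))" if "p \<in> ?D" for p
      unfolding power2_eq_square by (intro abs_mult_le snd_le that Bb)
    have iF: "integrable ?M ?F"
    proof (intro Bochner_Integration.integrable_add iS)
      have "Linfty ?D (\<lambda>p. (snd p)\<^sup>2 * B p)"
        by (rule Linfty_of_bounded[OF _ tB Dom_lebesgue]) measurable
      then show "integrable ?M (\<lambda>p. (snd p)\<^sup>2 * B p * pd \<Psi> (0, 1) p)"
        by (intro integrable_Linfty_smooth smt g L)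
      have "Linfty ?D (\<lambda>p. ?\<gamma> * (g * snd p) * ((snd p)\<^sup>2 * B p))"
      proof (rule Linfty_of_bounded[OF _ _ Dom_lebesgue])
        show "\<bar>?\<gamma> * (g * snd p) * ((snd p)\<^sup>2 * B p)\<bar> \<le> \<bar>?\<gamma>\<bar> * (\<bar>g\<bar> * T) * (T * T * ((rp * rp) * (rp * rp)))"
          if "p \<in> ?D" for p
          by (intro abs_mult_le tB snd_le that order_refl)
      qed measurable
      then show "integrable ?M (\<lambda>p. ?\<gamma> * (g * snd p) * ((snd p)\<^sup>2 * B p) * pd \<Psi> (axis N 1, 0) p)"
        by (intro integrable_Linfty_smooth smx g L)
    qed
    have AE: "AE p in ?M. p \<in> cellDom N g L T \<and> zmu (z p) = fan rm rp lam (sim N g p)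
        \<and> zw (z p) = (g * snd p) *\<^sub>R axis N 1"
      using AE_lebesgue_on_subset[OF mu _ Dom_lebesgue cd] AE_lebesgue_on_subset[OF w _ Dom_lebesgue cd]
        lebesgue_on_AE_space[OF cd] by simp
    have "AE p in ?M. ?E zd p = ?E z p + (\<delta> * ?F p - \<delta> * ?S p)"
      using AE
    proof eventually_elim
      case (elim p)
      have A: "A p = \<delta> * ((snd p)\<^sup>2 * B p)"
        using elim by (simp add: A_def energy_gain_def B_def prof_def power_mult_distrib)
      have "(\<Sum>i\<in>UNIV. zh (zd p) $ i * pd \<Psi> (axis i 1, 0) p)
          = (\<Sum>i\<in>UNIV. zh (z p) $ i * pd \<Psi> (axis i 1, 0) p
              + (if i = N then ?\<gamma> * A p * (g * snd p) * pd \<Psi> (axis N 1, 0) p else 0))"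
        using elim by (intro sum.cong) (auto simp: zd_def axis_def algebra_simps)
      also have "\<dots> = (\<Sum>i\<in>UNIV. zh (z p) $ i * pd \<Psi> (axis i 1, 0) p)
          + ?\<gamma> * A p * (g * snd p) * pd \<Psi> (axis N 1, 0) p"
        by (simp add: sum.distrib)
      finally have "?E zd p = ?E z p + A p * pd \<Psi> (0, 1) p
          + ?\<gamma> * A p * (g * snd p) * pd \<Psi> (axis N 1, 0) p"
        by (simp add: zd_def algebra_simps)
      then show ?case unfolding A by (simp only: algebra_simps)
    qed
    moreover have "integrable ?M (\<lambda>p. ?E z p + (\<delta> * ?F p - \<delta> * ?S p))"
      by (intro Bochner_Integration.integrable_add Bochner_Integration.integrable_diff integrable_mult_right iE iF iS)
    moreover have "?E zd \<in> borel_measurable ?M"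
    proof -
      have "Linfty (cellDom N g L T) zd" by (rule Linfty_subset[OF zdL _ Dom_lebesgue cd]) auto
      then have zm: "zd \<in> borel_measurable ?M" unfolding Linfty_def by (rule conjunct1)
      have "(\<lambda>p. ze (zd p)) \<in> borel_measurable ?M" "(\<lambda>p. zh (zd p) $ i) \<in> borel_measurable ?M" for i
        by (rule measurable_compose[OF zm], intro borel_measurable_continuous_onI continuous_on_zproj continuous_on_component)+
      moreover have "pd \<Psi> (0, 1) \<in> borel_measurable ?M" "pd \<Psi> (axis i 1, 0) \<in> borel_measurable ?M" for i
        by (intro borel_measurable_lebesgue_on smooth_borel smt smx)+
      ultimately show ?thesis
        by (intro borel_measurable_add borel_measurable_times borel_measurable_sum)
    qed
    ultimately have "integral\<^sup>L ?M (?E zd) = integral\<^sup>L ?M (\<lambda>p. ?E z p + (\<delta> * ?F p - \<delta> * ?S p))"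
      by (intro integral_cong_AE) auto
    also have "\<dots> = integral\<^sup>L ?M (?E z) + (\<delta> * integral\<^sup>L ?M ?F - \<delta> * integral\<^sup>L ?M ?S)"
      by (simp only: Bochner_Integration.integral_add[OF iE Bochner_Integration.integrable_diff[OF integrable_mult_right[OF iF] integrable_mult_right[OF iS]]]
         Bochner_Integration.integral_diff[OF integrable_mult_right[OF iF] integrable_mult_right[OF iS]] integral_mult_right_zero)
    finally have E: "int_Dom N g L T (?E zd) = int_Dom N g L T (?E z) - \<delta> * integral\<^sup>L ?M ?S"
      using F0 by (simp add: int_Dom_def)
    have dens_L: "integrable ?M (\<lambda>p. raised_density N rm rp g lam \<delta> p * \<Psi> p)"
      by (intro integrable_Linfty_smooth sm g L Linfty_raised_density n)
    have id: "integrable ?M (\<lambda>p. raised_density N rm rp g lam \<delta> p * \<Psi> p - \<delta> * ?S p)"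
      by (intro Bochner_Integration.integrable_diff dens_L integrable_mult_right iS)
    have "\<nu> \<Psi> = int_Dom N g L T (\<lambda>p. lam * (2 * lam - 1) * g\<^sup>2 * snd p * afun rm rp (zmu (z p)) * \<Psi> p)"
      using dens \<Psi> by (simp add: has_density_def)
    also have "\<dots> = integral\<^sup>L ?M (\<lambda>p. raised_density N rm rp g lam \<delta> p * \<Psi> p - \<delta> * ?S p)"
      unfolding int_Dom_def
    proof (rule integral_cong_AE)
      have "(\<lambda>p. lam * (2 * lam - 1) * g\<^sup>2 * snd p * afun rm rp (zmu (z p))) \<in> borel_measurable (lebesgue_on ?D)"
        using dens by (simp add: has_density_def)
      then have "(\<lambda>p. lam * (2 * lam - 1) * g\<^sup>2 * snd p * afun rm rp (zmu (z p))) \<in> borel_measurable ?M"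
        by (rule measurable_restrict_mono) auto
      then show "(\<lambda>p. lam * (2 * lam - 1) * g\<^sup>2 * snd p * afun rm rp (zmu (z p)) * \<Psi> p) \<in> borel_measurable ?M"
        by (rule borel_measurable_times[OF _ borel_measurable_lebesgue_on[OF smooth_borel[OF sm]]])
      show "(\<lambda>p. raised_density N rm rp g lam \<delta> p * \<Psi> p - \<delta> * ?S p) \<in> borel_measurable ?M"
        by (rule borel_measurable_integrable[OF id])
      show "AE p in ?M. lam * (2 * lam - 1) * g\<^sup>2 * snd p * afun rm rp (zmu (z p)) * \<Psi> p
          = raised_density N rm rp g lam \<delta> p * \<Psi> p - \<delta> * ?S p"
        using AE by eventually_elim (simp add: raised_density_def algebra_simps)
    qed
    also have "\<dots> = \<nu>d \<Psi> - \<delta> * integral\<^sup>L ?M ?S"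
      using dens_L iS by (simp add: \<nu>d_def int_Dom_def)
    finally have "\<nu> \<Psi> = \<nu>d \<Psi> - \<delta> * integral\<^sup>L ?M ?S" .
    moreover have "int_bdry_normal N g L T (\<lambda>p. g * snd p * qd p * \<Psi> p)
        = int_bdry_normal N g L T (\<lambda>p. g * snd p * q p * \<Psi> p)" by (rule int_bdry)
    ultimately show ?thesis using E scalar[OF \<Psi>] by simp
  qed
  show "weak_solution N rm rp g L T zd qd \<nu>d"
    unfolding weak_solution_def
  proof (intro conjI allI impI)
    show "periodic N zd" "periodic N qd"
      using W(1,2) periodic_Dom[of N g L T] by (simp_all add: periodic_def zd_def qd_def A_def)
    show "Linfty ?D zd" "Linfty ?D qd" by (rule zdL qdL)+
    show "AE p in lebesgue_on ?D. zd p \<in> Zset"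
      using W(4) by eventually_elim (simp add: Zset_def zd_def)
    show "\<forall>s\<in>{1, - 1}. integrable (lebesgue_on (bdry_cell T)) (\<lambda>p. qd (bpt N g L s p))"
      using W(6) by (simp add: q_bdry)
    show "dissipation_measure N g L T \<nu>d" unfolding \<nu>d_def by (rule \<nu>d(1))
    show "int_Dom N g L T (\<lambda>p.
            zm (zd p) \<bullet> pd \<Phi> (0, 1) p
            + (\<Sum>i\<in>UNIV. \<Sum>j\<in>UNIV.
                 (zsigma (zd p) + mat (2 / real CARD('n) * ze (zd p)) + mat (qd p)) $ i $ j
                 * pd \<Phi> (axis j 1, 0) p $ i))
        - int_bdry_normal N g L T (\<lambda>p. qd p * \<Phi> p $ N) = 0"
      if "testfun N g L T \<Phi>" for \<Phi> :: "(real ^ 'n) \<times> real \<Rightarrow> real ^ 'n"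
    proof -
      have "int_Dom N g L T (\<lambda>p.
            zm (zd p) \<bullet> pd \<Phi> (0, 1) p
            + (\<Sum>i\<in>UNIV. \<Sum>j\<in>UNIV.
                 (zsigma (zd p) + mat (2 / real CARD('n) * ze (zd p)) + mat (qd p)) $ i $ j
                 * pd \<Phi> (axis j 1, 0) p $ i))
        = int_Dom N g L T (\<lambda>p.
            zm (z p) \<bullet> pd \<Phi> (0, 1) p
            + (\<Sum>i\<in>UNIV. \<Sum>j\<in>UNIV.
                 (zsigma (z p) + mat (2 / real CARD('n) * ze (z p)) + mat (q p)) $ i $ j
                 * pd \<Phi> (axis j 1, 0) p $ i))"
        unfolding int_Dom_def
      proof (rule Bochner_Integration.integral_cong[OF refl])
        fix p assume "p \<in> space ?M"
        then have p: "p \<in> ?D" using cd by simp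
        show "zm (zd p) \<bullet> pd \<Phi> (0, 1) p
            + (\<Sum>i\<in>UNIV. \<Sum>j\<in>UNIV.
                 (zsigma (zd p) + mat (2 / real CARD('n) * ze (zd p)) + mat (qd p)) $ i $ j
                 * pd \<Phi> (axis j 1, 0) p $ i)
          = zm (z p) \<bullet> pd \<Phi> (0, 1) p
            + (\<Sum>i\<in>UNIV. \<Sum>j\<in>UNIV.
                 (zsigma (z p) + mat (2 / real CARD('n) * ze (z p)) + mat (q p)) $ i $ j
                 * pd \<Phi> (axis j 1, 0) p $ i)"
          unfolding mom_eq[OF p] by (simp add: zd_def)
      qed
      then show ?thesis using momentum[OF that] int_bdry[of "\<lambda>p x. x * \<Phi> p $ N"] by simp
    qed
    fix \<Psi> :: "(real ^ 'n) \<times> real \<Rightarrow> real" assume \<Psi>: "testfun N g L T \<Psi>"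
    show "int_Dom N g L T (\<lambda>p. \<Sum>i\<in>UNIV.
            (zw (zd p) - (g * snd p) *\<^sub>R axis N 1) $ i * pd \<Psi> (axis i 1, 0) p) = 0"
      using scalar[OF \<Psi>] by (simp add: zd_def)
    show "int_Dom N g L T (\<lambda>p. zmu (zd p) * pd \<Psi> (0, 1) p
            + (\<Sum>i\<in>UNIV. zm (zd p) $ i * pd \<Psi> (axis i 1, 0) p))
          + int_Omega N L (\<lambda>x. rho0 rm rp (x $ N) * \<Psi> (x, 0)) = 0"
      using scalar[OF \<Psi>] by (simp add: zd_def)
    show "int_Dom N g L T (\<lambda>p. ze (zd p) * pd \<Psi> (0, 1) p
            + (\<Sum>i\<in>UNIV. zh (zd p) $ i * pd \<Psi> (axis i 1, 0) p))
          - int_bdry_normal N g L T (\<lambda>p. g * snd p * qd p * \<Psi> p) = - \<nu>d \<Psi>"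
      by (rule energy[OF \<Psi>])
  qed
qed

end

theorem lemma1p12:
  fixes g rm rp lam :: real
  assumes n: "CARD('n::finite) \<in> {2, 3}"
    and g: "g > 0"
    and rho: "0 < rm" "rm < rp"
    and lam: "0 < lam" "lam < 1/2"
  shows "\<exists>C>0. \<exists>\<delta>0>0. \<forall>(N::'n) L T zl ql \<nu>l \<mu>.
    L > 0 \<longrightarrow> T > 0 \<longrightarrow> lam * ((rp - rm) / rm) * (g * T\<^sup>2 / 2) < L \<longrightarrow>
    nonstrict_subsolution_1d N rm rp g L T zl ql \<nu>l \<longrightarrow>
    entropy_solution rm rp g lam T \<mu> \<longrightarrow>
    (AE p in lebesgue_on (Dom N g L T).
       zmu (zl p) = \<mu> (fst p $ N, snd p) \<and>
       zm (zl p) = (g * snd p * (zmu (zl p) - lam * afun rm rp (zmu (zl p)))) *\<^sub>R axis N 1) \<longrightarrow>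
    has_density N g L T \<nu>l (\<lambda>p. lam * (2 * lam - 1) * g\<^sup>2 * snd p * afun rm rp (zmu (zl p))) \<longrightarrow>
    (\<forall>\<delta>. 0 < \<delta> \<and> \<delta> < \<delta>0 \<longrightarrow>
      (\<exists>zd qd \<nu>d dens.
        strict_subsolution_with 1 N rm rp g L T zd qd \<nu>d \<and>
        (AE p in lebesgue_on (Dom N g L T).
           zmu (zd p) = zmu (zl p) \<and>
           zm (zd p) = zm (zl p) \<and>
           ze (zd p) = ze (zl p)
             + \<delta> * (snd p)\<^sup>2 * (rp - zmu (zl p))\<^sup>2 * (zmu (zl p) - rm)\<^sup>2) \<and>
        has_density N g L T \<nu>d dens \<and>
        (AE p in lebesgue_on (Dom N g L T).
           dens p \<le> 0 \<and>
           \<bar>dens p - lam * (2 * lam - 1) * g\<^sup>2 * snd p * afun rm rp (zmu (zl p))\<bar>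
             \<le> C * \<delta> * snd p * (rp - zmu (zl p)) * (zmu (zl p) - rm))))"
proof -
  let ?C = "gain_rate rm rp lam"
  let ?\<delta>0 = "lam * (1 - 2 * lam) * g\<^sup>2 / (rp * ?C)"
  have C: "0 < ?C" by (rule gain_rate_pos[OF rho lam g])
  have \<delta>0: "0 < ?\<delta>0" using C rho lam g by simp
  have n2: "2 \<le> CARD('n)" using n by auto
  show ?thesis
  proof (rule exI[of _ ?C], rule conjI[OF C], rule exI[of _ ?\<delta>0], rule conjI[OF \<delta>0], intro allI impI)
    fix N :: 'n and L T zl ql \<nu>l \<mu> \<delta>
    assume L: "0 < L" and T: "0 < T" and TL: "lam * ((rp - rm) / rm) * (g * T\<^sup>2 / 2) < L"
      and ns: "nonstrict_subsolution_1d N rm rp g L T zl ql \<nu>l"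
      and ent: "entropy_solution rm rp g lam T \<mu>"
      and \<mu>: "AE p in lebesgue_on (Dom N g L T).
         zmu (zl p) = \<mu> (fst p $ N, snd p) \<and>
         zm (zl p) = (g * snd p * (zmu (zl p) - lam * afun rm rp (zmu (zl p)))) *\<^sub>R axis N 1"
      and dens: "has_density N g L T \<nu>l (\<lambda>p. lam * (2 * lam - 1) * g\<^sup>2 * snd p * afun rm rp (zmu (zl p)))"
      and \<delta>: "0 < \<delta> \<and> \<delta> < ?\<delta>0"
    let ?D = "Dom N g L T"
    obtain U where ws: "weak_solution N rm rp g L T zl ql \<nu>l" and od: "one_dimensional N rm rp g L T zl ql \<nu>l"
      and mix: "mixing_zone N rm rp g L T zl ql U"
      and eh: "\<And>p. p \<in> U \<Longrightarrow>
           ze (zl p) = (1/2) * fz N rm rp g (snd p) (zl p) \<and>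
           zh (zl p) = (ze (zl p) + ql p) *\<^sub>R zw (zl p)
             + ((Tplus rm rp (zl p) - Tminus rm rp (zl p)) / (rp - rm)) *\<^sub>R
                 (zm (zl p) - zmu (zl p) *\<^sub>R zw (zl p))"
      using ns unfolding nonstrict_subsolution_1d_def by blast
    have mu: "AE p in lebesgue_on ?D. zmu (zl p) = fan rm rp lam (sim N g p)"
    proof -
      have "AE p in lebesgue_on ?D. \<mu> (fst p $ N, snd p) = fan rm rp lam (sim N g p)"
        by (rule entropy_solution_eq_fan_on_Dom[OF ent T g rho]) (use lam in auto)
      with \<mu> show ?thesis by eventually_elim simp
    qed
    have w: "AE p in lebesgue_on ?D. zw (zl p) = (g * snd p) *\<^sub>R axis N 1"
      using od by (auto simp: one_dimensional_def)
    define zd where "zd = (\<lambda>p. raise_energy (energy_gain rm rp \<delta> (snd p) (zl p)) (zl p))"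
    define qd where "qd = (\<lambda>p. if p \<in> ?D then ql p - 2 / real CARD('n) * energy_gain rm rp \<delta> (snd p) (zl p) else ql p)"
    define \<nu>d where "\<nu>d = (\<lambda>\<phi>. int_Dom N g L T (\<lambda>p. raised_density N rm rp g lam \<delta> p * \<phi> p))"
    note weak = raised_weak_solution[OF rho lam g n2 L T TL ws mu w dens, of \<delta>, folded zd_def qd_def \<nu>d_def]
    have weak': "weak_solution N rm rp g L T zd qd \<nu>d"
      "has_density N g L T \<nu>d (raised_density N rm rp g lam \<delta>)" "Linfty ?D qd"
      using weak \<delta> by auto
    have mix': "mixing_zone N rm rp g L T zd qd U"
      by (rule raised_mixing_zone[OF mix weak'(3)]) (auto simp: zd_def qd_def)
    have "strict_subsolution_with 1 N rm rp g L T zd qd \<nu>d"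
      unfolding strict_subsolution_with_def
    proof (intro conjI exI[of _ U] ballI weak' mix')
      fix p assume p: "p \<in> U"
      have pD: "p \<in> ?D" and m: "rm < zmu (zl p)" "zmu (zl p) < rp"
        using mix p by (auto simp: mixing_zone_def)
      have A: "0 < energy_gain rm rp \<delta> (snd p) (zl p)"
        using \<delta> pD m by (auto simp: energy_gain_def Dom_iff)
      show "lambda_max (Mtilde rm rp (zd p))
           + 1 * norm (zh (zd p) - (ze (zd p) + qd p) *\<^sub>R zw (zd p)
                - ((Tplus rm rp (zd p) - Tminus rm rp (zd p)) / (rp - rm)) *\<^sub>R
                    (zm (zd p) - zmu (zd p) *\<^sub>R zw (zd p)))
           < 2 / real CARD('n) * ze (zd p)"
        by (rule raised_strict_inequality[OF mix od p _ _ A]) (use eh[OF p] pD in \<open>auto simp: zd_def qd_def\<close>)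
    qed simp
    moreover have "AE p in lebesgue_on ?D.
           zmu (zd p) = zmu (zl p) \<and>
           zm (zd p) = zm (zl p) \<and>
           ze (zd p) = ze (zl p)
             + \<delta> * (snd p)\<^sup>2 * (rp - zmu (zl p))\<^sup>2 * (zmu (zl p) - rm)\<^sup>2"
      by (simp add: zd_def energy_gain_def)
    moreover have "AE p in lebesgue_on ?D.
           raised_density N rm rp g lam \<delta> p \<le> 0 \<and>
           \<bar>raised_density N rm rp g lam \<delta> p - lam * (2 * lam - 1) * g\<^sup>2 * snd p * afun rm rp (zmu (zl p))\<bar>
             \<le> ?C * \<delta> * snd p * (rp - zmu (zl p)) * (zmu (zl p) - rm)"
      using mu lebesgue_on_AE_space[OF Dom_lebesgue[of N g L T]]
    proof eventually_elim
      case (elim p)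
      then have t: "0 < snd p" by (simp add: Dom_iff)
      show ?case
        using raised_density_nonpos[OF rho lam g _ _ t n2, of \<delta> N]
          raised_density_error[OF rho lam g _ t n2, of \<delta> N] \<delta> elim
        by (simp add: prof_def mult.assoc)
    qed
    ultimately show "\<exists>zd qd \<nu>d dens.
        strict_subsolution_with 1 N rm rp g L T zd qd \<nu>d \<and>
        (AE p in lebesgue_on ?D.
           zmu (zd p) = zmu (zl p) \<and>
           zm (zd p) = zm (zl p) \<and>
           ze (zd p) = ze (zl p)
             + \<delta> * (snd p)\<^sup>2 * (rp - zmu (zl p))\<^sup>2 * (zmu (zl p) - rm)\<^sup>2) \<and>
        has_density N g L T \<nu>d dens \<and>
        (AE p in lebesgue_on ?D.
           dens p \<le> 0 \<and>
           \<bar>dens p - lam * (2 * lam - 1) * g\<^sup>2 * snd p * afun rm rp (zmu (zl p))\<bar>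
             \<le> ?C * \<delta> * snd p * (rp - zmu (zl p)) * (zmu (zl p) - rm))"
      using weak'(2) by blast
  qed
qed

end
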